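(* Let $t$ be a positive integer, $\nu$ a partition with $t$-quotients $\nu^0,\dots,\nu^{t-1}$, and $\mu$ a $t$-core partition. Let $g_1,\dots,g_v$ be $\mu$-admissible functions of partitions. Then there exists $r\in\mathbb N$ such that $$D_t^r\Bigl(G_\lambda\prod_{u=1}^vg_u(\lambda)\prod_{i=0}^{t-1}q_{\nu^i}(\lambda^i)\Bigr)=0$$ for every partition $\lambda$ whose $t$-core is $\mu$. Furthermore, $$P(n)=\sum_{\substack{\lambda_{t\text{-core}}=\mu\\ |\lambda|-|\mu|=nt}}F_{\lambda/\mu}G_\lambda\prod_{u=1}^vg_u(\lambda)$$ is a polynomial in $n$.
   Context: Partitions are identified with Young diagrams (box $(i,j)$ in row $i$, column $j$; content $j-i$); $\mathcal H(\lambda)$ is the multiset of hook lengths (for a box: boxes to its right in its row, plus below it, plus one). A $t$-core has no hook length divisible by $t$. $G_\lambda=1/\prod_{h\in\mathcal H(\lambda),\,t\mid h}h$. The 01-sequence $(z_i)_{i\in\mathbb Z}$ of $\lambda$: traverse the boundary of its Young diagram from the bottom (infinite vertical ray below the first column) to the right (infinite horizontal ray right of the first row), labelling vertical edges $0$ and horizontal edges $1$, indexed so that $\#\{i\ge0:z_i=0\}=\#\{i<0:z_i=1\}$. Adding (resp. removing) a $t$-hook exchanges some $z_i=0,z_{i+t}=1$ into $1,0$ (resp. the reverse); $\lambda\ge_t\mu$ means $\lambda$ is obtained from $\mu$ by adding $t$-hooks; the $t$-core $\lambda_{t\text{-core}}$ is obtained by removing $t$-hooks until impossible. The $i$-th $t$-quotient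 $\lambda^i$ ($0\le i\le t-1$) is the partition with 01-sequence $(z_{tj+i})_{j\in\mathbb Z}$. The Littlewood decomposition $\lambda\mapsto(\lambda_{t\text{-core}};\lambda^0,\dots,\lambda^{t-1})$ is a bijection onto $\{t\text{-cores}\}\times\{\text{partitions}\}^t$, and we write $\lambda=(\lambda_{t\text{-core}};\lambda^0,\dots,\lambda^{t-1})$. $F_{\lambda/\mu}$: $F_{\mu/\mu}=1$, $F_{\lambda/\mu}=\sum F_{\lambda^-/\mu}$ over $\lambda\ge_t\lambda^-\ge_t\mu$ with $|\lambda|-|\lambda^-|=t$. $D_tg(\lambda)=\sum_{\lambda^+}g(\lambda^+)-g(\lambda)$ over all $\lambda^+$ obtained from $\lambda$ by adding one $t$-hook; $D_t^0g=g$, $D_t^rg=D_t(D_t^{r-1}g)$. Corners and $q$: for a partition $\lambda$ let $(\alpha_1,\beta_1),\dots,(\alpha_m,\beta_m)$ be its removable boxes with $\alpha_1>\dots>\alpha_m$; set $\alpha_{m+1}=\beta_0=0$, $y_j=\beta_j-\alpha_j$, $x_i=\beta_i-\alpha_{i+1}$ ($0\le i\le m$); $q_k(\lambda)=\sum_{i=0}^mx_i^k-\sum_{j=1}^my_j^k$ ($0^0=1$), and $q_\delta(\lambda)=\prod_s q_{\delta_s}(\lambda)$ for a partition $\delta=(\delta_1,\dots,\delta_\ell)$, $q_\emptyset=1$. $\mu$-admissible: a function $g$ on partitions is $\mu$-admissible if for each $0\le i\le t-1$ there are a nonnegative integer $s'$ and functions $\eta_0,\dots,\eta_{s'}$ on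 partitions (depending on $t,g,i,\mu$), each $\eta_s(\lambda)$ being a fixed linear combination of products $\prod_{j=0}^{t-1}q_{\tau^j}(\lambda^j)$ for $t$-tuples of partitions $(\tau^0,\dots,\tau^{t-1})$, such that $g(\lambda^+)-g(\lambda)=\sum_{s=0}^{s'}\eta_s(\lambda)c_{\square_i}^s$ whenever $\lambda=(\mu;\lambda^0,\dots,\lambda^{t-1})$ and $\lambda^+=(\mu;\lambda^0,\dots,\lambda^{i-1},\lambda^i\cup\{\square_i\},\lambda^{i+1},\dots,\lambda^{t-1})$, where $\lambda^i\cup\{\square_i\}$ is a partition and $c_{\square_i}$ is the content of $\square_i$ in it. *)

theory Defs
  imports "HOL-Library.Multiset" "HOL-Computational_Algebra.Polynomial"
begin

section \<open>Partitions and Young diagrams\<close>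

typedef int_partition = "{xs :: nat list. sorted_wrt (\<ge>) xs \<and> (\<forall>x \<in> set xs. x > 0)}"
  morphisms parts Abs_int_partition
  by (rule exI[of _ "[]"]) simp

definition psize :: "int_partition \<Rightarrow> nat" where
  "psize \<kappa> = sum_list (parts \<kappa>)"

text \<open>Rows and columns are numbered from 1, and the length of a row below the diagram is 0.\<close>

definition row_len :: "int_partition \<Rightarrow> nat \<Rightarrow> nat" where
  "row_len \<kappa> i = (if 1 \<le> i \<and> i \<le> length (parts \<kappa>) then parts \<kappa> ! (i - 1) else 0)"

definition diagram :: "int_partition \<Rightarrow> (nat \<times> nat) set" where
  "diagram \<kappa> = {(i, j). 1 \<le> i \<and> 1 \<le> j \<and> j \<le> row_len \<kappa> i}"

definition content :: "nat \<times> nat \<Rightarrow> int" where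
  "content b = int (snd b) - int (fst b)"

definition hook_length :: "int_partition \<Rightarrow> nat \<times> nat \<Rightarrow> nat" where
  "hook_length \<kappa> b =
     card {j'. j' > snd b \<and> (fst b, j') \<in> diagram \<kappa>} +
     card {i'. i' > fst b \<and> (i', snd b) \<in> diagram \<kappa>} + 1"

definition hook_lengths :: "int_partition \<Rightarrow> nat multiset" where
  "hook_lengths \<kappa> = image_mset (hook_length \<kappa>) (mset_set (diagram \<kappa>))"

definition is_core :: "nat \<Rightarrow> int_partition \<Rightarrow> bool" where
  "is_core t \<kappa> \<longleftrightarrow> (\<forall>h \<in># hook_lengths \<kappa>. \<not> t dvd h)"

definition G_hook :: "nat \<Rightarrow> int_partition \<Rightarrow> 'a :: field_char_0" where
  "G_hook t \<kappa> = 1 / (\<Prod>h \<in># filter_mset (\<lambda>h. t dvd h) (hook_lengths \<kappa>). of_nat h)"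

section \<open>The 01-sequence and the Littlewood decomposition\<close>

text \<open>
  The pair \<open>(r, c)\<close> stands for the lattice point lying \<open>r\<close> rows below and \<open>c\<close> columns to
  the right of the top left corner of the diagram, i.e. for the lower right corner of the
  box \<open>(r, c)\<close> if \<open>r\<close> and \<open>c\<close> are positive. The boundary contains the two infinite rays.
\<close>

definition boundary :: "int_partition \<Rightarrow> (nat \<times> nat) set" where
  "boundary \<kappa> = {(r, c). (r + 1, c + 1) \<notin> diagram \<kappa> \<and> (r = 0 \<or> c = 0 \<or> (r, c) \<in> diagram \<kappa>)}"

text \<open>
  \<open>z\<close> is the sequence of edge labels of a traversal \<open>p\<close> of the boundary from the bottom to
  the right, where edge \<open>i\<close> leads from \<open>p i\<close> to \<open>p (i + 1)\<close>. The position of the index 0 is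
  left open here.
\<close>

definition boundary_word :: "int_partition \<Rightarrow> (int \<Rightarrow> nat) \<Rightarrow> bool" where
  "boundary_word \<kappa> z \<longleftrightarrow>
     (\<exists>p :: int \<Rightarrow> nat \<times> nat. \<forall>i. p i \<in> boundary \<kappa> \<and>
        (z i = 0 \<and> fst (p i) = fst (p (i + 1)) + 1 \<and> snd (p (i + 1)) = snd (p i) \<or>
         z i = 1 \<and> fst (p (i + 1)) = fst (p i) \<and> snd (p (i + 1)) = snd (p i) + 1))"

definition balanced :: "(int \<Rightarrow> nat) \<Rightarrow> bool" where
  "balanced z \<longleftrightarrow> card {i. i \<ge> 0 \<and> z i = 0} = card {i. i < 0 \<and> z i = 1}"

definition seq01 :: "int_partition \<Rightarrow> int \<Rightarrow> nat" where
  "seq01 \<kappa> = (THE z. boundary_word \<kappa> z \<and> balanced z)"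

text \<open>\<open>adds_hook t \<mu> \<kappa>\<close>: \<open>\<kappa>\<close> is obtained from \<open>\<mu>\<close> by adding one \<open>t\<close>-hook.\<close>

definition adds_hook :: "nat \<Rightarrow> int_partition \<Rightarrow> int_partition \<Rightarrow> bool" where
  "adds_hook t \<mu> \<kappa> \<longleftrightarrow>
     (\<exists>i. seq01 \<mu> i = 0 \<and> seq01 \<mu> (i + int t) = 1 \<and>
          seq01 \<kappa> = (seq01 \<mu>)(i := 1, i + int t := 0))"

definition hook_ge :: "nat \<Rightarrow> int_partition \<Rightarrow> int_partition \<Rightarrow> bool" where
  "hook_ge t \<kappa> \<mu> \<longleftrightarrow> (adds_hook t)\<^sup>*\<^sup>* \<mu> \<kappa>"

definition core_of :: "nat \<Rightarrow> int_partition \<Rightarrow> int_partition" where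
  "core_of t \<kappa> = (THE \<mu>. hook_ge t \<kappa> \<mu> \<and> \<not> (\<exists>\<rho>. adds_hook t \<rho> \<mu>))"

text \<open>
  The subsequence of the 01-sequence defining a quotient is in general not balanced; it is
  the 01-sequence of the quotient only up to a shift of the index. Hence
  \<^const>\<open>boundary_word\<close> is used instead of \<^const>\<open>seq01\<close> for the quotient.
\<close>

definition t_quotient :: "nat \<Rightarrow> nat \<Rightarrow> int_partition \<Rightarrow> int_partition" where
  "t_quotient t i \<kappa> = (THE \<rho>. boundary_word \<rho> (\<lambda>j. seq01 \<kappa> (int t * j + int i)))"

section \<open>The numbers \<open>F\<close> and the difference operator\<close>

lemma hook_ge_0_iff: "hook_ge 0 \<kappa> \<mu> \<longleftrightarrow> \<kappa> = \<mu>"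
proof
  assume "hook_ge 0 \<kappa> \<mu>"
  thus "\<kappa> = \<mu>"
    unfolding hook_ge_def by (induction rule: rtranclp_induct) (auto simp: adds_hook_def)
qed (simp add: hook_ge_def)

function F_hook :: "nat \<Rightarrow> int_partition \<Rightarrow> int_partition \<Rightarrow> nat" where
  "F_hook t \<kappa> \<mu> = (if \<kappa> = \<mu> then 1
     else (\<Sum>\<rho> \<in> {\<rho>. hook_ge t \<kappa> \<rho> \<and> hook_ge t \<rho> \<mu> \<and> psize \<kappa> = psize \<rho> + t}. F_hook t \<rho> \<mu>))"
  by auto
termination
proof (relation "measure (\<lambda>(t, \<kappa>, \<mu>). psize \<kappa>)")
  fix t \<kappa> \<mu> \<rho>
  assume "\<kappa> \<noteq> \<mu>" and "\<rho> \<in> {\<rho>. hook_ge t \<kappa> \<rho> \<and> hook_ge t \<rho> \<mu> \<and> psize \<kappa> = psize \<rho> + t}"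
  thus "((t, \<rho>, \<mu>), (t, \<kappa>, \<mu>)) \<in> measure (\<lambda>(t, \<kappa>, \<mu>). psize \<kappa>)"
    by (cases "t = 0") (auto simp: hook_ge_0_iff)
qed simp

declare F_hook.simps [simp del]

definition D_hook :: "nat \<Rightarrow> (int_partition \<Rightarrow> 'a :: field_char_0) \<Rightarrow> int_partition \<Rightarrow> 'a" where
  "D_hook t g \<kappa> = (\<Sum>\<kappa>' \<in> {\<kappa>'. adds_hook t \<kappa> \<kappa>'}. g \<kappa>') - g \<kappa>"

section \<open>Corners and the functions \<open>q\<close>\<close>

definition removable :: "int_partition \<Rightarrow> (nat \<times> nat) set" where
  "removable \<kappa> = {b \<in> diagram \<kappa>. \<exists>\<rho>. diagram \<rho> = diagram \<kappa> - {b}}"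

text \<open>
  The list of removable boxes, by decreasing row. There is at most one in each row, namely
  the last box of the row.
\<close>

definition corners :: "int_partition \<Rightarrow> (nat \<times> nat) list" where
  "corners \<kappa> = map (\<lambda>i. (i, row_len \<kappa> i)) (rev (sorted_list_of_set (fst ` removable \<kappa>)))"

definition corner_alpha :: "int_partition \<Rightarrow> nat \<Rightarrow> int" where
  "corner_alpha \<kappa> j =
     (if 1 \<le> j \<and> j \<le> length (corners \<kappa>) then int (fst (corners \<kappa> ! (j - 1))) else 0)"

definition corner_beta :: "int_partition \<Rightarrow> nat \<Rightarrow> int" where
  "corner_beta \<kappa> j =
     (if 1 \<le> j \<and> j \<le> length (corners \<kappa>) then int (snd (corners \<kappa> ! (j - 1))) else 0)"

definition q_fun :: "nat \<Rightarrow> int_partition \<Rightarrow> int" where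
  "q_fun k \<kappa> =
     (\<Sum>i = 0..length (corners \<kappa>). (corner_beta \<kappa> i - corner_alpha \<kappa> (i + 1)) ^ k) -
     (\<Sum>j = 1..length (corners \<kappa>). (corner_beta \<kappa> j - corner_alpha \<kappa> j) ^ k)"

definition q_part :: "int_partition \<Rightarrow> int_partition \<Rightarrow> int" where
  "q_part \<delta> \<kappa> = (\<Prod>k \<leftarrow> parts \<delta>. q_fun k \<kappa>)"

section \<open>Admissible functions\<close>

text \<open>
  The tuple \<open>(\<tau>\<^sup>0, \<dots>, \<tau>\<^sup>t\<^sup>-\<^sup>1)\<close> is represented by a function on \<open>nat\<close>, of which only the
  values below \<open>t\<close> matter.
\<close>

definition q_linear_combination :: "nat \<Rightarrow> (int_partition \<Rightarrow> 'a :: field_char_0) \<Rightarrow> bool" where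
  "q_linear_combination t \<eta> \<longleftrightarrow>
     (\<exists>(T :: (nat \<Rightarrow> int_partition) set) (a :: (nat \<Rightarrow> int_partition) \<Rightarrow> 'a). finite T \<and>
        (\<forall>\<kappa>. \<eta> \<kappa> = (\<Sum>\<tau> \<in> T. a \<tau> * (\<Prod>j < t. of_int (q_part (\<tau> j) (t_quotient t j \<kappa>))))))"

definition admissible ::
  "nat \<Rightarrow> int_partition \<Rightarrow> (int_partition \<Rightarrow> 'a :: field_char_0) \<Rightarrow> bool" where
  "admissible t \<mu> g \<longleftrightarrow>
     (\<forall>i < t. \<exists>(s' :: nat) (\<eta> :: nat \<Rightarrow> int_partition \<Rightarrow> 'a).
        (\<forall>s \<le> s'. q_linear_combination t (\<eta> s)) \<and>
        (\<forall>\<kappa> \<kappa>' b. core_of t \<kappa> = \<mu> \<and> core_of t \<kappa>' = \<mu> \<and>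
           (\<forall>j < t. j \<noteq> i \<longrightarrow> t_quotient t j \<kappa>' = t_quotient t j \<kappa>) \<and>
           b \<notin> diagram (t_quotient t i \<kappa>) \<and>
           diagram (t_quotient t i \<kappa>') = insert b (diagram (t_quotient t i \<kappa>)) \<longrightarrow>
           g \<kappa>' - g \<kappa> = (\<Sum>s \<le> s'. \<eta> s \<kappa> * of_int (content b) ^ s)))"

end

theory Submission
  imports Defs "HOL-Computational_Algebra.Polynomial_FPS"
begin

text \<open>
  A partition is encoded by the vertical edges \<open>\<lambda>\<^sub>r - r\<close> of its 01-sequence, and the \<open>t\<close>-quotients
  by the subsequences of indices congruent modulo \<open>t\<close>. Adding a \<open>t\<close>-hook adds one box, of
  content \<open>c\<close> say, to one quotient, and multiplies \<open>G\<close> by \<open>1/t\<close> times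
  \<open>(\<Prod>\<^sub>y (c - y)) / (\<Prod>\<^sub>x (c - x))\<close>, where \<open>y\<close> runs over the contents of the removable boxes and
  \<open>x\<close> over the other contents of the addable boxes of that quotient. For each quotient these weights
  add up to 1, and their \<open>s\<close>-th moment is, by a Newton identity, a polynomial of weighted degree \<open>s\<close>
  in the functions \<open>q\<close>. Moreover \<open>q\<^sub>k\<close> changes by \<open>(c + 1)\<^sup>k + (c - 1)\<^sup>k - 2 c\<^sup>k\<close>, which has degree
  less than \<open>k\<close>. Hence \<open>D\<close> turns \<open>G\<close> times a product of admissible functions and of functions \<open>q\<close>
  into \<open>G\<close> times a combination of such products in which either an admissible factor has
  disappeared or the degree in the functions \<open>q\<close> has dropped, so it is locally nilpotent. The sum
  over the partitions with \<open>n\<close> added hooks is \<open>\<Sum>\<^sub>k (n choose k) D\<^sup>k f(\<mu>)\<close>.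
\<close>

section \<open>Row lengths and 01-sequences\<close>

text \<open>The factor \<open>1 / t\<close> is what makes \<open>D\<close> a difference operator:
  each of the \<open>t\<close> quotients contributes total weight 1, so in \<open>G * f\<close> the
  old value of \<open>f\<close> is reproduced exactly and cancels against the subtracted term; only
  changes of \<open>f\<close> survive. Degree alone cannot prove nilpotency, because an admissible
  \<open>g\<close> is known only through its changes: it is not assumed to be a polynomial in the
  q's, and its change may have any degree. The set of admissible factors therefore comes first in
  the induction and the degree second. Averaging is harmless for the degree because a power
  \<open>c ^ s\<close> becomes a moment of weight \<open>s\<close>, so that \<open>c\<close> counts
  as a variable of weight 1. The other obstacle is that \<open>seq01\<close>,
  \<open>t_quotient\<close> and \<open>core_of\<close> are given by \<open>THE\<close>. All three
  are tied to one explicit sequence; quotients are shown to exist by building a partition up from a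
  core, and the index shift of each subsequence, which hook additions preserve, yields uniqueness of
  the core.\<close>

lemma row_len_antimono:
  assumes "1 \<le> i" "i \<le> j"
  shows "row_len \<rho> j \<le> row_len \<rho> i"
proof (cases "i < j \<and> j \<le> length (parts \<rho>)")
  case True
  have "sorted_wrt (\<ge>) (parts \<rho>)"
    using parts[of \<rho>] by simp
  then show ?thesis
    using True assms sorted_wrt_nth_less[of "(\<ge>)" "parts \<rho>" "i - 1" "j - 1"]
    by (auto simp: row_len_def)
next
  case False
  then show ?thesis
    using assms by (cases "i = j") (auto simp: row_len_def)
qed

lemma row_len_zero [simp]: "row_len \<rho> 0 = 0"
  by (simp add: row_len_def)

lemma row_len_pos_iff: "row_len \<rho> r > 0 \<longleftrightarrow> 1 \<le> r \<and> r \<le> length (parts \<rho>)"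
proof -
  have "\<forall>x \<in> set (parts \<rho>). x > 0"
    using parts[of \<rho>] by simp
  then show ?thesis
    by (auto simp: row_len_def)
qed

lemma row_len_eq_0: "length (parts \<rho>) < r \<Longrightarrow> row_len \<rho> r = 0"
  by (simp add: row_len_def)

lemma int_partition_eqI:
  assumes "\<And>r. 1 \<le> r \<Longrightarrow> row_len \<rho> r = row_len \<rho>' r"
  shows "\<rho> = \<rho>'"
proof -
  have *: "row_len \<rho> r = row_len \<rho>' r" for r
    using assms by (cases "r = 0") auto
  have "{r. row_len \<kappa> r > 0} = {1..length (parts \<kappa>)}" for \<kappa>
    by (auto simp: row_len_pos_iff)
  then have "length (parts \<kappa>) = card {r. row_len \<kappa> r > 0}" for \<kappa>
    by simp
  then have len: "length (parts \<rho>) = length (parts \<rho>')"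
    using * by simp
  have "parts \<rho> = parts \<rho>'"
  proof (rule nth_equalityI)
    fix i assume "i < length (parts \<rho>)"
    then show "parts \<rho> ! i = parts \<rho>' ! i"
      using *[of "Suc i"] len by (simp add: row_len_def)
  qed (fact len)
  then show ?thesis
    by (simp add: parts_inject)
qed

lemma int_partition_of_rows:
  assumes anti: "\<And>i j. 1 \<le> i \<Longrightarrow> i \<le> j \<Longrightarrow> f j \<le> (f i :: nat)" and zero: "\<And>r. r > N \<Longrightarrow> f r = 0"
  obtains \<rho> where "\<And>r. 1 \<le> r \<Longrightarrow> row_len \<rho> r = f r"
proof -
  \<comment> \<open>Parts of a partition must be positive, so the list has to stop at the last
    nonzero row instead of at the given bound \<open>N\<close>.\<close>
  define M where "M = (LEAST M. \<forall>r > M. f r = 0)"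
  have M: "\<forall>r > M. f r = 0"
    unfolding M_def by (rule LeastI[of _ N]) (use zero in auto)
  have pos: "f r > 0" if "1 \<le> r" "r \<le> M" for r
  proof (rule ccontr)
    assume "\<not> f r > 0"
    then have "\<forall>s > r - 1. f s = 0"
      using anti[of r] that(1) by fastforce
    then have "M \<le> r - 1"
      unfolding M_def by (rule Least_le)
    then show False using that by simp
  qed
  define xs where "xs = map f [1..<Suc M]"
  have "sorted_wrt (\<ge>) xs"
    unfolding xs_def by (auto simp: sorted_wrt_iff_nth_less simp del: upt_Suc intro!: anti)
  moreover have "\<forall>x \<in> set xs. x > 0"
    unfolding xs_def using pos by (auto simp del: upt_Suc)
  ultimately have xs: "parts (Abs_int_partition xs) = xs"
    by (simp add: Abs_int_partition_inverse)
  have "row_len (Abs_int_partition xs) r = f r" if "1 \<le> r" for r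
    using that M unfolding row_len_def xs by (auto simp: xs_def simp del: upt_Suc)
  then show ?thesis by (rule that)
qed

lemma psize_eq_sum:
  assumes "length (parts \<rho>) \<le> N"
  shows "psize \<rho> = (\<Sum>r = 1..N. row_len \<rho> r)"
proof -
  have "psize \<rho> = (\<Sum>i < length (parts \<rho>). parts \<rho> ! i)"
    by (simp add: psize_def sum_list_sum_nth atLeast0LessThan)
  also have "\<dots> = (\<Sum>r = 1..length (parts \<rho>). row_len \<rho> r)"
    by (rule sum.reindex_bij_witness[of _ "\<lambda>r. r - 1" Suc]) (auto simp: row_len_def)
  also have "\<dots> = (\<Sum>r = 1..N. row_len \<rho> r)"
    by (rule sum.mono_neutral_left) (use assms in \<open>auto simp: row_len_def\<close>)
  finally show ?thesis .
qed

lemma finite_diagram: "finite (diagram \<rho>)"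
proof (rule finite_subset)
  show "diagram \<rho> \<subseteq> {1..length (parts \<rho>)} \<times> {1..row_len \<rho> 1}"
    using row_len_antimono[of 1 _ \<rho>] row_len_pos_iff[of \<rho>]
    by (fastforce simp: diagram_def)
qed simp

section \<open>An explicit 01-sequence\<close>

definition beta :: "int_partition \<Rightarrow> nat \<Rightarrow> int" where
  "beta \<rho> r = int (row_len \<rho> r) - int r"

text \<open>A closed form meant to replace \<open>seq01\<close>; that the two agree can be proved
  once the possible boundary words and their balance are known.\<close>

definition edge :: "int_partition \<Rightarrow> int \<Rightarrow> nat" where
  "edge \<rho> i = (if \<exists>r \<ge> 1. i = beta \<rho> r then 0 else 1)"

lemma beta_strict: "1 \<le> r \<Longrightarrow> r < s \<Longrightarrow> beta \<rho> s < beta \<rho> r"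
  using row_len_antimono[of r s \<rho>] by (simp add: beta_def)

lemma beta_less_iff: "1 \<le> r \<Longrightarrow> 1 \<le> s \<Longrightarrow> beta \<rho> s < beta \<rho> r \<longleftrightarrow> r < s"
  by (metis beta_strict less_asym less_irrefl linorder_neqE_nat)

lemma beta_le_iff: "1 \<le> r \<Longrightarrow> 1 \<le> s \<Longrightarrow> beta \<rho> s \<le> beta \<rho> r \<longleftrightarrow> r \<le> s"
  by (metis beta_less_iff not_less)

lemma beta_eq_iff: "1 \<le> r \<Longrightarrow> 1 \<le> s \<Longrightarrow> beta \<rho> r = beta \<rho> s \<longleftrightarrow> r = s"
  by (metis beta_le_iff order_antisym order_refl)

lemma edge_eq_0_iff: "edge \<rho> i = 0 \<longleftrightarrow> (\<exists>r \<ge> 1. i = beta \<rho> r)"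
  by (simp add: edge_def)

lemma edge_eq_1_iff: "edge \<rho> i = 1 \<longleftrightarrow> \<not> (\<exists>r \<ge> 1. i = beta \<rho> r)"
  by (simp add: edge_def)

lemma edge_cases: "edge \<rho> i = 0 \<or> edge \<rho> i = 1"
  by (simp add: edge_def)

lemma edge_left: "i < - int (length (parts \<rho>)) \<Longrightarrow> edge \<rho> i = 0"
  unfolding edge_eq_0_iff
  by (rule exI[of _ "nat (- i)"]) (auto simp: beta_def row_len_def)

lemma edge_right: "int (row_len \<rho> 1) \<le> i \<Longrightarrow> edge \<rho> i = 1"
  unfolding edge_eq_1_iff using row_len_antimono[of 1 _ \<rho>] by (force simp: beta_def)

text \<open>A strictly decreasing sequence lists its range from the top down, so the range
  determines it.\<close>

lemma strict_antimono_range_eq: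
  fixes f h :: "nat \<Rightarrow> int"
  assumes f: "\<And>m n. m < n \<Longrightarrow> f n < f m" and h: "\<And>m n. m < n \<Longrightarrow> h n < h m"
    and range: "range f = range h"
  shows "f n = h n"
proof (induction n rule: less_induct)
  case (less n)
  \<comment> \<open>One inequality, used in both directions: \<open>a n\<close> occurs as some
    \<open>b m\<close>, and \<open>m < n\<close> is excluded because it would repeat an earlier
    value of \<open>a\<close>.\<close>
  have aux: "a n \<le> b n"
    if a: "\<And>m n. m < n \<Longrightarrow> a n < a m" and b: "\<And>m n. m < n \<Longrightarrow> b n < b m"
      and ran: "range a = range b" and ab: "\<And>k. k < n \<Longrightarrow> a k = b k" for a b :: "nat \<Rightarrow> int"
  proof -
    obtain m where m: "a n = b m"
      using ran by (metis rangeE rangeI)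
    have "\<not> m < n"
      using m a ab by (metis less_irrefl)
    then show ?thesis
      using m b[of n m] by (cases "n = m") auto
  qed
  show ?case
    using aux[OF f h range] aux[OF h f range[symmetric]] less by (metis order_antisym)
qed

text \<open>The positions of the 0s, read from the right, form a strictly decreasing sequence
  determined by the word. In a row below both diagrams \<open>beta\<close> is minus the row number,
  which reveals the shift. Uniqueness of quotients and of their shifts rests on this.\<close>

lemma edge_shift_unique:
  assumes "\<And>i. edge \<rho> (i + d) = edge \<rho>' (i + d')"
  shows "\<rho> = \<rho>' \<and> d = d'"
proof -
  have R: "range (\<lambda>n. beta \<kappa> (Suc n) - e) = {i. edge \<kappa> (i + e) = 0}" for \<kappa> e
    by (auto simp: edge_eq_0_iff image_iff) (metis Suc_le_D add_diff_cancel_right' One_nat_def)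
  have eq: "beta \<rho> (Suc n) - d = beta \<rho>' (Suc n) - d'" for n
    by (rule strict_antimono_range_eq[of "\<lambda>n. beta \<rho> (Suc n) - d"])
      (auto simp: R assms beta_strict)
  have "d = d'"
    using eq[of "length (parts \<rho>) + length (parts \<rho>')"] by (simp add: beta_def row_len_def)
  with eq have "row_len \<rho> (Suc n) = row_len \<rho>' (Suc n)" for n
    by (auto simp: beta_def)
  then have "\<rho> = \<rho>'"
    by (intro int_partition_eqI) (metis Suc_le_D One_nat_def)
  with \<open>d = d'\<close> show ?thesis by simp
qed

lemma edge_inject: "edge \<rho> = edge \<rho>' \<longleftrightarrow> \<rho> = \<rho>'"
  using edge_shift_unique[of \<rho> 0 \<rho>' 0] by auto

section \<open>Boundary words\<close>

text \<open>Membership depends only on the row and the content of the lattice point: the boundary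
  points of one row fill an interval between consecutive values of \<open>beta\<close>.\<close>

lemma mem_boundary_iff:
  "(r, c) \<in> boundary \<rho> \<longleftrightarrow>
     beta \<rho> (Suc r) < int c - int r \<and> (r = 0 \<or> int c - int r \<le> beta \<rho> r)"
  by (auto simp: boundary_def diagram_def beta_def)

lemma boundary_point_exists:
  obtains p where "p \<in> boundary \<rho>" "content p = k"
proof -
  \<comment> \<open>\<open>r\<close> is the number of rows whose vertical edge has index at least
    \<open>k\<close>; the wanted point lies just below them.\<close>
  define r where "r = (LEAST r. beta \<rho> (Suc r) < k)"
  have "beta \<rho> (Suc (length (parts \<rho>) + nat (- k))) < k"
    by (simp add: beta_def row_len_def)
  then have r: "beta \<rho> (Suc r) < k"
    unfolding r_def by (rule LeastI)
  have r': "r = 0 \<or> k \<le> beta \<rho> r"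
  proof (rule ccontr)
    assume *: "\<not> (r = 0 \<or> k \<le> beta \<rho> r)"
    then have "r \<le> r - 1"
      by (subst (1) r_def, intro Least_le) auto
    with * show False by linarith
  qed
  have "int r + k \<ge> 0"
    using r by (simp add: beta_def)
  then show ?thesis
    using r r' by (intro that[of "(r, nat (int r + k))"]) (auto simp: mem_boundary_iff content_def)
qed

lemma edge_eq_1_if:
  assumes "beta \<rho> (Suc r) < k" "r = 0 \<or> k < beta \<rho> r"
  shows "edge \<rho> k = 1"
proof -
  have "k \<noteq> beta \<rho> s" if "1 \<le> s" for s
    using assms beta_le_iff[of s r \<rho>] beta_le_iff[of "Suc r" s \<rho>] that by (cases "s \<le> r") auto
  then show ?thesis unfolding edge_eq_1_iff by blast
qed

lemma int_sequence_eq_shift: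
  fixes f :: "int \<Rightarrow> int"
  assumes "\<And>i. f (i + 1) = f i + 1"
  shows "f i = i + f 0"
proof (induction i rule: int_induct[where k = 0])
  case (step2 i)
  then show ?case using assms[of "i - 1"] by simp
qed (auto simp: assms)

text \<open>Either kind of step raises the content of the current point by 1, so the content is the
  index up to a shift, and it alone decides the label. Conversely, every content is attained on the
  boundary, and points chosen for consecutive contents turn out to be adjacent.\<close>

lemma boundary_word_iff: "boundary_word \<rho> z \<longleftrightarrow> (\<exists>d. \<forall>i. z i = edge \<rho> (i + d))"
proof
  assume "boundary_word \<rho> z"
  then obtain p where p: "\<And>i. p i \<in> boundary \<rho>" and
    st: "\<And>i. z i = 0 \<and> fst (p i) = fst (p (i + 1)) + 1 \<and> snd (p (i + 1)) = snd (p i) \<or>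
         z i = 1 \<and> fst (p (i + 1)) = fst (p i) \<and> snd (p (i + 1)) = snd (p i) + 1"
    unfolding boundary_word_def by blast
  have "content (p (i + 1)) = content (p i) + 1" for i
    using st[of i] by (auto simp: content_def)
  then have c: "content (p i) = i + content (p 0)" for i
    by (rule int_sequence_eq_shift)
  have "z i = edge \<rho> (i + content (p 0))" for i
  proof -
    obtain r k where rk: "p i = (r, k)" by (cases "p i")
    obtain r' k' where rk': "p (i + 1) = (r', k')" by (cases "p (i + 1)")
    have m: "(r, k) \<in> boundary \<rho>" "(r', k') \<in> boundary \<rho>"
      using p[of i] p[of "i + 1"] rk rk' by simp_all
    have i: "i + content (p 0) = int k - int r"
      using c[of i] rk by (simp add: content_def)
    from st[of i] consider "z i = 0" "r = Suc r'" "k' = k" | "z i = 1" "r' = r" "k' = Suc k"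
      unfolding rk rk' by auto
    then show ?thesis
    proof cases
      case 1
      then have "i + content (p 0) = beta \<rho> r"
        using m unfolding i mem_boundary_iff by simp
      then show ?thesis using 1 by (auto simp: edge_def intro!: exI[of _ r])
    next
      case 2
      then have "edge \<rho> (i + content (p 0)) = 1"
        using m unfolding i mem_boundary_iff by (intro edge_eq_1_if[of _ r]) auto
      then show ?thesis using 2 by simp
    qed
  qed
  then show "\<exists>d. \<forall>i. z i = edge \<rho> (i + d)" by blast
next
  assume "\<exists>d. \<forall>i. z i = edge \<rho> (i + d)"
  then obtain d where z: "\<And>i. z i = edge \<rho> (i + d)" by blast
  have "\<forall>k. \<exists>p. p \<in> boundary \<rho> \<and> content p = k"
    by (meson boundary_point_exists)
  then obtain p where p: "\<And>k. p k \<in> boundary \<rho>" "\<And>k. content (p k) = k"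
    by metis
  have "z i = 0 \<and> fst (p (i + d)) = fst (p (i + 1 + d)) + 1 \<and> snd (p (i + 1 + d)) = snd (p (i + d)) \<or>
        z i = 1 \<and> fst (p (i + 1 + d)) = fst (p (i + d)) \<and> snd (p (i + 1 + d)) = snd (p (i + d)) + 1" for i
  proof -
    obtain r k where rk: "p (i + d) = (r, k)" by (cases "p (i + d)")
    obtain r' k' where rk': "p (i + 1 + d) = (r', k')" by (cases "p (i + 1 + d)")
    have m: "(r, k) \<in> boundary \<rho>" "(r', k') \<in> boundary \<rho>"
      using p(1)[of "i + d"] p(1)[of "i + 1 + d"] rk rk' by simp_all
    have c: "int k - int r = i + d" "int k' - int r' = i + d + 1"
      using p(2)[of "i + d"] p(2)[of "i + 1 + d"] rk rk' by (simp_all add: content_def)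
    have m': "beta \<rho> (Suc r) < i + d" "r = 0 \<or> i + d \<le> beta \<rho> r"
       "beta \<rho> (Suc r') \<le> i + d" "r' = 0 \<or> i + d < beta \<rho> r'"
      using m unfolding mem_boundary_iff c by auto
    have "r' \<le> r"
      using m' beta_le_iff[of "Suc r" r' \<rho>] by (cases "r' = 0") force+
    show ?thesis
    proof (cases "r' = r")
      case True
      then have "edge \<rho> (i + d) = 1"
        using m' by (intro edge_eq_1_if[of _ r]) auto
      then show ?thesis using True c unfolding rk rk' z by simp
    next
      case False
      with \<open>r' \<le> r\<close> have lt: "r' < r" by simp
      then have "Suc r' \<le> r" by simp
      \<comment> \<open>\<open>beta \<rho> (Suc r') \<le> i + d \<le> beta \<rho> r\<close> rules
        out a drop by more than one row; for \<open>r = Suc r'\<close> it becomes an equality, so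
        the edge is vertical.\<close>
      moreover have "r \<le> Suc r'"
        using m' lt beta_le_iff[of r "Suc r'" \<rho>] beta_less_iff[of "Suc r'" r \<rho>] by force
      ultimately have r: "r = Suc r'" by simp
      then have "i + d = beta \<rho> r" using m' by auto
      then have "edge \<rho> (i + d) = 0"
        unfolding edge_eq_0_iff using r by auto
      then show ?thesis using r c unfolding rk rk' z by simp
    qed
  qed
  then show "boundary_word \<rho> z"
    unfolding boundary_word_def using p(1) by (intro exI[of _ "\<lambda>i. p (i + d)"]) simp
qed

text \<open>Moving the origin one place to the right loses a 0 on the right or gains a 1 on the
  left, so the difference drops by 1 each time. It is calibrated at \<open>- N\<close>, where only
  0s lie to the left and the 0s to the right are the \<open>N\<close> rows. Hence only shift 0 is
  balanced.\<close>

lemma card_edge_shift: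
  "int (card {i. i \<ge> 0 \<and> edge \<rho> (i + d) = 0}) - int (card {i. i < 0 \<and> edge \<rho> (i + d) = 1}) = - d"
proof -
  define Z where "Z = (\<lambda>d. {k. k \<ge> d \<and> edge \<rho> k = 0})"
  define O1 where "O1 = (\<lambda>d. {k. k < d \<and> edge \<rho> k = 1})"
  have "Z d \<subseteq> {d..<int (row_len \<rho> 1)}" for d
    unfolding Z_def using edge_right[of \<rho>] by (metis (mono_tags, lifting) atLeastLessThan_iff
        mem_Collect_eq not_less subsetI zero_neq_one)
  then have finZ: "finite (Z d)" for d
    by (rule finite_subset) simp
  have "O1 d \<subseteq> {- int (length (parts \<rho>))..<d}" for d
    unfolding O1_def using edge_left[of _ \<rho>] by (metis (mono_tags, lifting) atLeastLessThan_iff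
        mem_Collect_eq not_less subsetI zero_neq_one)
  then have finO: "finite (O1 d)" for d
    by (rule finite_subset) simp
  define c where "c = (\<lambda>d. int (card (Z d)) - int (card (O1 d)))"
  have ge: "k \<ge> d \<longleftrightarrow> k = d \<or> k \<ge> d + 1" and lt: "k < d + 1 \<longleftrightarrow> k = d \<or> k < d" for d k :: int
    by auto
  have step: "c (d + 1) = c d - 1" for d
  proof (cases "edge \<rho> d = 0")
    case True
    have "Z d = insert d (Z (d + 1))" "O1 (d + 1) = O1 d"
      using True unfolding Z_def O1_def ge[of d] lt by auto
    moreover have "d \<notin> Z (d + 1)" by (simp add: Z_def)
    ultimately show ?thesis using finZ by (simp add: c_def)
  next
    case False
    then have "edge \<rho> d = 1" using edge_cases[of \<rho> d] by simp
    then have "Z d = Z (d + 1)" "O1 (d + 1) = insert d (O1 d)"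
      unfolding Z_def O1_def ge[of d] lt by auto
    moreover have "d \<notin> O1 d" by (simp add: O1_def)
    ultimately show ?thesis using finO by (simp add: c_def)
  qed
  define N where "N = length (parts \<rho>)"
  have "Z (- int N) = beta \<rho> ` {1..N}"
  proof -
    have "beta \<rho> r \<ge> - int N \<longleftrightarrow> r \<le> N" if "1 \<le> r" for r
    proof (cases "r \<le> N")
      case False
      then show ?thesis by (simp add: beta_def row_len_eq_0 N_def)
    qed (simp add: beta_def)
    then show ?thesis
      by (auto simp: Z_def edge_eq_0_iff)
  qed
  moreover have "inj_on (beta \<rho>) {1..N}"
    by (auto simp: inj_on_def beta_eq_iff)
  ultimately have "card (Z (- int N)) = N"
    by (simp add: card_image)
  moreover have "O1 (- int N) = {}"
    using edge_left[of _ \<rho>] by (force simp: O1_def N_def)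
  ultimately have base: "c (- int N) = int N" by (simp add: c_def)
  have "c d + d = c (- int N) - int N" for d
  proof (induction d rule: int_induct[where k = "- int N"])
    case (step2 i)
    then show ?case using step[of "i - 1"] by simp
  qed (auto simp: step)
  then have cd: "c d = - d"
    using base by (metis add.commute add_cancel_right_left cancel_comm_monoid_add_class.diff_cancel minus_unique)
  have "card {i. i \<ge> 0 \<and> edge \<rho> (i + d) = 0} = card (Z d)"
    by (rule bij_betw_same_card[of "\<lambda>i. i + d"], rule bij_betwI[where g = "\<lambda>i. i - d"])
      (auto simp: Z_def)
  moreover have "card {i. i < 0 \<and> edge \<rho> (i + d) = 1} = card (O1 d)"
    by (rule bij_betw_same_card[of "\<lambda>i. i + d"], rule bij_betwI[where g = "\<lambda>i. i - d"])
      (auto simp: O1_def)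
  ultimately show ?thesis using cd by (simp add: c_def)
qed

lemma seq01_eq_edge: "seq01 \<rho> = edge \<rho>"
  unfolding seq01_def
proof (rule the_equality)
  have "balanced (edge \<rho>)"
    using card_edge_shift[of \<rho> 0] by (simp add: balanced_def)
  moreover have "boundary_word \<rho> (edge \<rho>)"
    unfolding boundary_word_iff by (rule exI[of _ 0]) simp
  ultimately show "boundary_word \<rho> (edge \<rho>) \<and> balanced (edge \<rho>)" by simp
next
  fix z assume z: "boundary_word \<rho> z \<and> balanced z"
  then obtain d where d: "z = (\<lambda>i. edge \<rho> (i + d))"
    unfolding boundary_word_iff by blast
  then have "d = 0"
    using card_edge_shift[of \<rho> d] z by (simp add: balanced_def)
  then show "z = edge \<rho>" using d by simp
qed

section \<open>Boxes and hooks as swaps in the 01-sequence\<close>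

lemma add_box:
  assumes r: "1 \<le> r" "r = 1 \<or> row_len \<rho> r < row_len \<rho> (r - 1)"
  obtains \<rho>' where "\<And>s. row_len \<rho>' s = (if s = r then row_len \<rho> r + 1 else row_len \<rho> s)"
    "diagram \<rho>' = insert (r, row_len \<rho> r + 1) (diagram \<rho>)"
proof -
  let ?f = "\<lambda>s. if s = r then row_len \<rho> r + 1 else row_len \<rho> s"
  have "?f j \<le> ?f i" if "1 \<le> i" "i \<le> j" for i j
    using that r row_len_antimono[of i j \<rho>] row_len_antimono[of i "r - 1" \<rho>] by (cases "i \<le> r - 1") auto
  moreover have "?f s = 0" if "s > length (parts \<rho>) + r" for s
    using that by (simp add: row_len_eq_0)
  ultimately obtain \<rho>' where "\<And>s. 1 \<le> s \<Longrightarrow> row_len \<rho>' s = ?f s"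
    using int_partition_of_rows[of ?f "length (parts \<rho>) + r"] by blast
  then have row: "row_len \<rho>' s = ?f s" for s
    using r by (cases "s = 0") auto
  have "diagram \<rho>' = insert (r, row_len \<rho> r + 1) (diagram \<rho>)"
    using r by (auto simp: diagram_def row split: if_splits)
  with row show ?thesis by (rule that)
qed

lemma remove_box:
  assumes r: "1 \<le> r" "row_len \<rho> (r + 1) < row_len \<rho> r"
  obtains \<rho>' where "\<And>s. row_len \<rho>' s = (if s = r then row_len \<rho> r - 1 else row_len \<rho> s)"
    "diagram \<rho>' = diagram \<rho> - {(r, row_len \<rho> r)}"
proof -
  let ?f = "\<lambda>s. if s = r then row_len \<rho> r - 1 else row_len \<rho> s"
  have "?f j \<le> ?f i" if "1 \<le> i" "i \<le> j" for i j
    using that r row_len_antimono[of i j \<rho>] row_len_antimono[of "r + 1" j \<rho>] by auto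
  moreover have "?f s = 0" if "s > length (parts \<rho>) + r" for s
    using that by (simp add: row_len_eq_0)
  ultimately obtain \<rho>' where "\<And>s. 1 \<le> s \<Longrightarrow> row_len \<rho>' s = ?f s"
    using int_partition_of_rows[of ?f "length (parts \<rho>) + r"] by blast
  then have row: "row_len \<rho>' s = ?f s" for s
    using r by (cases "s = 0") auto
  have "diagram \<rho>' = diagram \<rho> - {(r, row_len \<rho> r)}"
    using r by (auto simp: diagram_def row split: if_splits)
  with row show ?thesis by (rule that)
qed

text \<open>Lengthening row \<open>r\<close> moves its vertical edge from \<open>c - 1\<close> to
  \<open>c\<close>. This is possible since a row above of equal length would have its own edge at
  \<open>c\<close>, where the sequence has a 1.\<close>

lemma add_box_edge:
  assumes "edge \<rho> (c - 1) = 0" "edge \<rho> c = 1"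
  obtains \<rho>' b where "edge \<rho>' = (edge \<rho>)(c - 1 := 1, c := 0)" "psize \<rho>' = psize \<rho> + 1"
    "b \<notin> diagram \<rho>" "diagram \<rho>' = insert b (diagram \<rho>)" "content b = c"
proof -
  obtain r where r: "1 \<le> r" "beta \<rho> r = c - 1"
    using assms(1) by (auto simp: edge_eq_0_iff)
  have "r = 1 \<or> row_len \<rho> r < row_len \<rho> (r - 1)"
  proof (rule ccontr)
    assume *: "\<not> ?thesis"
    then have "beta \<rho> (r - 1) = c"
      using r row_len_antimono[of "r - 1" r \<rho>] by (auto simp: beta_def)
    then have "edge \<rho> c = 0"
      using * r by (auto simp: edge_eq_0_iff intro!: exI[of _ "r - 1"])
    with assms(2) show False by simp
  qed
  from add_box[OF r(1) this] obtain \<rho>' where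
    row: "\<And>s. row_len \<rho>' s = (if s = r then row_len \<rho> r + 1 else row_len \<rho> s)"
    and d: "diagram \<rho>' = insert (r, row_len \<rho> r + 1) (diagram \<rho>)"
    by metis
  have beta: "beta \<rho>' s = (if s = r then c else beta \<rho> s)" for s
    using r row by (auto simp: beta_def)
  have "edge \<rho>' i = ((edge \<rho>)(c - 1 := 1, c := 0)) i" for i
  proof -
    have "(\<exists>s \<ge> 1. i = beta \<rho>' s) \<longleftrightarrow> i = c \<or> (\<exists>s \<ge> 1. i = beta \<rho> s \<and> i \<noteq> c - 1)"
      using r beta_eq_iff[of _ r \<rho>] by (auto simp: beta)
    then show ?thesis
      by (auto simp: edge_def)
  qed
  then have "edge \<rho>' = (edge \<rho>)(c - 1 := 1, c := 0)" by blast
  moreover have "psize \<rho>' = psize \<rho> + 1"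
  proof -
    define N where "N = length (parts \<rho>) + length (parts \<rho>') + r"
    have "psize \<rho>' = (\<Sum>s = 1..N. row_len \<rho>' s)"
      by (rule psize_eq_sum) (simp add: N_def)
    also have "\<dots> = (\<Sum>s = 1..N. row_len \<rho> s + (if s = r then 1 else 0))"
      by (rule sum.cong) (auto simp: row)
    also have "\<dots> = (\<Sum>s = 1..N. row_len \<rho> s) + 1"
      using r by (subst sum.distrib) (auto simp: N_def)
    also have "(\<Sum>s = 1..N. row_len \<rho> s) = psize \<rho>"
      by (rule psize_eq_sum[symmetric]) (simp add: N_def)
    finally show ?thesis .
  qed
  moreover have "(r, row_len \<rho> r + 1) \<notin> diagram \<rho>"
    by (simp add: diagram_def)
  moreover have "content (r, row_len \<rho> r + 1) = c"
    using r by (simp add: content_def beta_def)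
  ultimately show ?thesis using d that by blast
qed

lemma remove_box_edge:
  assumes "edge \<rho> (c - 1) = 1" "edge \<rho> c = 0"
  obtains \<rho>' where "edge \<rho>' = (edge \<rho>)(c - 1 := 0, c := 1)"
proof -
  obtain r where r: "1 \<le> r" "beta \<rho> r = c"
    using assms(2) by (auto simp: edge_eq_0_iff)
  have rr: "row_len \<rho> (r + 1) < row_len \<rho> r"
  proof (rule ccontr)
    assume *: "\<not> ?thesis"
    then have "beta \<rho> (r + 1) = c - 1"
      using r row_len_antimono[of r "r + 1" \<rho>] by (auto simp: beta_def)
    then have "edge \<rho> (c - 1) = 0"
      using * r by (auto simp: edge_eq_0_iff intro!: exI[of _ "r + 1"])
    with assms(1) show False by simp
  qed
  from remove_box[OF r(1) this] obtain \<rho>' where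
    row: "\<And>s. row_len \<rho>' s = (if s = r then row_len \<rho> r - 1 else row_len \<rho> s)"
    and "diagram \<rho>' = diagram \<rho> - {(r, row_len \<rho> r)}"
    by metis
  have beta: "beta \<rho>' s = (if s = r then c - 1 else beta \<rho> s)" for s
    using r row rr by (auto simp: beta_def)
  have "edge \<rho>' i = ((edge \<rho>)(c - 1 := 0, c := 1)) i" for i
  proof -
    have "(\<exists>s \<ge> 1. i = beta \<rho>' s) \<longleftrightarrow> i = c - 1 \<or> (\<exists>s \<ge> 1. i = beta \<rho> s \<and> i \<noteq> c)"
      using r beta_eq_iff[of _ r \<rho>] by (auto simp: beta)
    then show ?thesis
      by (auto simp: edge_def)
  qed
  then show ?thesis using that by blast
qed

text \<open>A hook is moved one step at a time, in the order in which the steps do not collide.\<close>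

lemma add_hook_edge:
  assumes "t > 0" "edge \<rho> i = 0" "edge \<rho> (i + int t) = 1"
  shows "\<exists>\<rho>'. edge \<rho>' = (edge \<rho>)(i := 1, i + int t := 0) \<and> psize \<rho>' = psize \<rho> + t"
  using assms
proof (induction t arbitrary: \<rho> i rule: nat_induct_non_zero)
  case 1
  then show ?case
    using add_box_edge[of \<rho> "i + 1"] by (metis add_diff_cancel_right' of_nat_1)
next
  case (Suc t)
  have t1: "i + int (Suc t) - 1 = i + int t" by simp
  show ?case
  proof (cases "edge \<rho> (i + int t) = 0")
    case True
    \<comment> \<open>The place \<open>i + t\<close> is occupied by a 0: it moves on first, and the
      0 coming from \<open>i\<close> takes its place. The 0s are indistinguishable, so the net
      effect is the desired swap.\<close>
    obtain \<rho>1 where 1: "edge \<rho>1 = (edge \<rho>)(i + int t := 1, i + int (Suc t) := 0)" "psize \<rho>1 = psize \<rho> + 1"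
      using add_box_edge[of \<rho> "i + int (Suc t)"] True Suc.prems t1 by metis
    have "edge \<rho>1 i = 0" "edge \<rho>1 (i + int t) = 1"
      using 1 Suc by auto
    from Suc.IH[OF this] obtain \<rho>' where
      "edge \<rho>' = (edge \<rho>1)(i := 1, i + int t := 0)" "psize \<rho>' = psize \<rho>1 + t"
      by blast
    then show ?thesis
      using True 1 Suc.hyps by (intro exI[of _ \<rho>']) (auto simp: fun_eq_iff)
  next
    case False
    then have "edge \<rho> (i + int t) = 1" using edge_cases[of \<rho> "i + int t"] by simp
    from Suc.IH[OF Suc.prems(1) this] obtain \<rho>1 where
      1: "edge \<rho>1 = (edge \<rho>)(i := 1, i + int t := 0)" "psize \<rho>1 = psize \<rho> + t"
      by blast
    have "edge \<rho>1 (i + int (Suc t)) = 1" "edge \<rho>1 (i + int (Suc t) - 1) = 0"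
      using 1 Suc.prems by auto
    then obtain \<rho>' where "edge \<rho>' = (edge \<rho>1)(i + int t := 1, i + int (Suc t) := 0)" "psize \<rho>' = psize \<rho>1 + 1"
      using add_box_edge[of \<rho>1 "i + int (Suc t)"] t1 by metis
    then show ?thesis
      using \<open>edge \<rho> (i + int t) = 1\<close> 1 Suc.hyps by (intro exI[of _ \<rho>']) (auto simp: fun_eq_iff)
  qed
qed

lemma remove_hook_edge:
  assumes "t > 0" "edge \<rho> i = 1" "edge \<rho> (i + int t) = 0"
  shows "\<exists>\<rho>'. edge \<rho>' = (edge \<rho>)(i := 0, i + int t := 1)"
  using assms
proof (induction t arbitrary: \<rho> i rule: nat_induct_non_zero)
  case 1
  then show ?case
    using remove_box_edge[of \<rho> "i + 1"] by (metis add_diff_cancel_right' of_nat_1)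
next
  case (Suc t)
  have t1: "i + int (Suc t) - 1 = i + int t" by simp
  show ?case
  proof (cases "edge \<rho> (i + int t) = 0")
    case False
    then have F: "edge \<rho> (i + int t) = 1" using edge_cases[of \<rho> "i + int t"] by simp
    obtain \<rho>1 where 1: "edge \<rho>1 = (edge \<rho>)(i + int t := 0, i + int (Suc t) := 1)"
      using remove_box_edge[of \<rho> "i + int (Suc t)"] F Suc.prems t1 by metis
    have "edge \<rho>1 i = 1" "edge \<rho>1 (i + int t) = 0"
      using 1 Suc by auto
    from Suc.IH[OF this] obtain \<rho>' where
      "edge \<rho>' = (edge \<rho>1)(i := 0, i + int t := 1)"
      by blast
    then show ?thesis
      using F 1 Suc.hyps by (intro exI[of _ \<rho>']) (auto simp: fun_eq_iff)
  next
    case True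
    from Suc.IH[OF Suc.prems(1) True] obtain \<rho>1 where
      1: "edge \<rho>1 = (edge \<rho>)(i := 0, i + int t := 1)"
      by blast
    have "edge \<rho>1 (i + int (Suc t)) = 0" "edge \<rho>1 (i + int (Suc t) - 1) = 1"
      using 1 Suc.prems by auto
    then obtain \<rho>' where "edge \<rho>' = (edge \<rho>1)(i + int t := 0, i + int (Suc t) := 1)"
      using remove_box_edge[of \<rho>1 "i + int (Suc t)"] t1 by metis
    then show ?thesis
      using True 1 Suc.hyps by (intro exI[of _ \<rho>']) (auto simp: fun_eq_iff)
  qed
qed

section \<open>Sizes under hook addition and existence of cores\<close>

lemma adds_hook_iff:
  "adds_hook t \<mu> \<kappa> \<longleftrightarrow>
     (\<exists>i. edge \<mu> i = 0 \<and> edge \<mu> (i + int t) = 1 \<and> edge \<kappa> = (edge \<mu>)(i := 1, i + int t := 0))"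
  by (simp add: adds_hook_def seq01_eq_edge)

lemma psize_adds_hook:
  assumes "t > 0" "adds_hook t \<mu> \<kappa>"
  shows "psize \<kappa> = psize \<mu> + t"
  using assms add_hook_edge[OF assms(1)] unfolding adds_hook_iff by (metis edge_inject)

lemma psize_hook_ge:
  assumes "t > 0" "hook_ge t \<kappa> \<mu>"
  shows "\<exists>n. psize \<kappa> = psize \<mu> + n * t"
  using assms(2) unfolding hook_ge_def
proof (induction rule: rtranclp_induct)
  case base
  show ?case by (rule exI[of _ 0]) simp
next
  case (step y z)
  then show ?case using psize_adds_hook[OF assms(1) step(2)] by (auto intro: exI[of _ "Suc _"])
qed

lemma adds_hook_exists:
  assumes "t > 0" "edge \<kappa> i = 1" "edge \<kappa> (i + int t) = 0"
  shows "\<exists>\<rho>. adds_hook t \<rho> \<kappa>"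
proof -
  obtain \<rho> where "edge \<rho> = (edge \<kappa>)(i := 0, i + int t := 1)"
    using remove_hook_edge[OF assms] by blast
  then show ?thesis
    using assms unfolding adds_hook_iff by (intro exI[of _ \<rho>] exI[of _ i]) (auto simp: fun_eq_iff)
qed

lemma core_exists:
  assumes "t > 0"
  shows "\<exists>\<mu>. hook_ge t \<kappa> \<mu> \<and> \<not> (\<exists>\<rho>. adds_hook t \<rho> \<mu>)"
proof (induction "psize \<kappa>" arbitrary: \<kappa> rule: less_induct)
  case less
  show ?case
  proof (cases "\<exists>\<rho>. adds_hook t \<rho> \<kappa>")
    case True
    then obtain \<rho> where \<rho>: "adds_hook t \<rho> \<kappa>" by blast
    then have "psize \<rho> < psize \<kappa>"
      using psize_adds_hook[OF assms] assms by simp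
    from less[OF this] \<rho> show ?thesis
      unfolding hook_ge_def by (meson rtranclp.rtrancl_into_rtrancl)
  qed (auto simp: hook_ge_def)
qed

section \<open>Quotients\<close>

lemma edge_empty: "\<exists>\<rho>. \<forall>i. edge \<rho> i = (if i < 0 then 0 else 1)"
proof -
  obtain \<rho> where "\<And>r. 1 \<le> r \<Longrightarrow> row_len \<rho> r = 0"
    using int_partition_of_rows[of "\<lambda>_. 0" 0] by blast
  then have \<rho>: "\<And>r. 1 \<le> r \<Longrightarrow> beta \<rho> r = - int r"
    by (simp add: beta_def)
  have "(\<exists>r \<ge> 1. i = beta \<rho> r) \<longleftrightarrow> i < 0" for i
  proof
    assume "i < 0"
    then show "\<exists>r \<ge> 1. i = beta \<rho> r"
      by (intro exI[of _ "nat (- i)"]) (auto simp: \<rho>)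
  qed (auto simp: \<rho>)
  then have "edge \<rho> i = (if i < 0 then 0 else 1)" for i
    by (simp add: edge_def)
  then show ?thesis by blast
qed

text \<open>In a core no 1 is followed, \<open>t\<close> places later, by a 0; so each residue class
  is a block of 0s followed by a block of 1s, the word of the empty partition up to a shift.\<close>

lemma core_subword:
  assumes "t > 0" "\<not> (\<exists>\<rho>. adds_hook t \<rho> \<mu>)"
  shows "\<exists>d. \<forall>j. edge \<mu> (int t * j + int m) = (if j + d < 0 then 0 else 1)"
proof -
  define y where "y = (\<lambda>j. edge \<mu> (int t * j + int m))"
  have step: "y (j + 1) = 1" if "y j = 1" for j
  proof (rule ccontr)
    assume "y (j + 1) \<noteq> 1"
    then have "edge \<mu> (int t * j + int m + int t) = 0"
      unfolding y_def using edge_cases[of \<mu> "int t * (j + 1) + int m"] by (simp add: algebra_simps)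
    then show False
      using adds_hook_exists[OF assms(1)] assms(2) that unfolding y_def by blast
  qed
  have up: "y (j + int n) = 1" if "y j = 1" for j n
  proof (induction n)
    case (Suc n)
    then show ?case using step[of "j + int n"] by (simp add: algebra_simps)
  qed (use that in simp)
  \<comment> \<open>For \<open>j \<le> - N\<close> the place in question is at most
    \<open>- N + m\<close>, which lies in the initial stretch of 0s.\<close>
  define N where "N = int (length (parts \<mu>)) + int m + 1"
  have low: "y j = 0" if "j \<le> - N" for j
  proof -
    have "int t * j \<le> int t * (- N)"
      using that by (intro mult_left_mono) auto
    also have "\<dots> \<le> 1 * (- N)"
      using assms(1) by (intro mult_right_mono_neg) (auto simp: N_def)
    finally show ?thesis
      unfolding y_def N_def by (intro edge_left) simp
  qed
  define R where "R = row_len \<mu> 1"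
  have "int t * int R \<ge> 1 * int R"
    using assms(1) by (intro mult_right_mono) auto
  then have "y (int R) = 1"
    unfolding y_def R_def by (intro edge_right) simp
  then have ex: "\<exists>n. y (- N + int n) = 1"
    by (intro exI[of _ "nat (int R + N)"]) (simp add: N_def)
  define n where "n = (LEAST n. y (- N + int n) = 1)"
  have n: "y (- N + int n) = 1"
    unfolding n_def using ex by (rule LeastI_ex)
  have "y j = (if j + (N - int n) < 0 then 0 else 1)" for j
  proof (cases "j + (N - int n) < 0")
    case True
    have "y j = 0" if "j > - N"
    proof (rule ccontr)
      assume "y j \<noteq> 0"
      then have "y j = 1" unfolding y_def using edge_cases by metis
      moreover have "j = - N + int (nat (j + N))" using that by simp
      ultimately have "n \<le> nat (j + N)"
        unfolding n_def by (intro Least_le) simp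
      with True that show False by simp
    qed
    then show ?thesis using True low[of j] by (cases "j \<le> - N") auto
  next
    case False
    then have "j = - N + int n + int (nat (j + N - int n))" by simp
    with up[OF n, of "nat (j + N - int n)"] False show ?thesis by auto
  qed
  then show ?thesis unfolding y_def by blast
qed

lemma subword_index_eq_iff:
  assumes "t > 0" "m < t"
  shows "int t * j + int m = i \<longleftrightarrow> j = i div int t \<and> int m = i mod int t"
  using assms by (auto simp: mult.commute)

text \<open>The places \<open>i\<close> and \<open>i + t\<close> lie in the same class modulo
  \<open>t\<close> and are neighbours there; the other classes are untouched.\<close>

lemma subword_adds_hook:
  assumes "t > 0" "m < t" "edge \<kappa>' = (edge \<kappa>)(i := 1, i + int t := 0)"
  shows "edge \<kappa>' (int t * j + int m) =
    (if int m = i mod int t then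
      ((\<lambda>j. edge \<kappa> (int t * j + int m))(i div int t := 1, i div int t + 1 := 0)) j
     else edge \<kappa> (int t * j + int m))"
proof -
  have "int t * j + int m = i + int t \<longleftrightarrow> j = i div int t + 1 \<and> int m = i mod int t"
    using subword_index_eq_iff[OF assms(1,2), of j "i + int t"] assms(1) by simp
  then show ?thesis
    unfolding assms(3) fun_upd_apply subword_index_eq_iff[OF assms(1,2)] by auto
qed

text \<open>Inside the class of \<open>i\<close> the hook is a swap of neighbouring entries, that
  is, a single added box. The shift \<open>d\<close> is kept, so the content of the box is the
  position of \<open>i\<close> in its class plus \<open>d + 1\<close>.\<close>

lemma adds_hook_quotient:
  assumes "t > 0" "m < t" "edge \<kappa> i = 0" "edge \<kappa> (i + int t) = 1"
    "edge \<kappa>' = (edge \<kappa>)(i := 1, i + int t := 0)"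
    and \<rho>: "\<And>j. edge \<kappa> (int t * j + int m) = edge \<rho> (j + d)"
    and m: "int m = i mod int t"
  obtains \<rho>' b where "\<And>j. edge \<kappa>' (int t * j + int m) = edge \<rho>' (j + d)"
    "edge \<rho> (i div int t + d) = 0" "edge \<rho> (i div int t + d + 1) = 1"
    "edge \<rho>' = (edge \<rho>)(i div int t + d := 1, i div int t + d + 1 := 0)"
    "b \<notin> diagram \<rho>" "diagram \<rho>' = insert b (diagram \<rho>)" "content b = i div int t + d + 1"
proof -
  let ?c = "i div int t + d + 1"
  have i: "i = int t * (i div int t) + int m" unfolding m by simp
  have 0: "edge \<rho> (?c - 1) = 0" using \<rho>[of "i div int t"] assms(3) i by simp
  have "i + int t = int t * (i div int t + 1) + int m" using i by (simp add: algebra_simps)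
  then have "edge \<rho> (i div int t + 1 + d) = 1" using \<rho>[of "i div int t + 1"] assms(4) by metis
  then have 1: "edge \<rho> ?c = 1" by (simp add: ac_simps)
  obtain \<rho>' b where *: "edge \<rho>' = (edge \<rho>)(?c - 1 := 1, ?c := 0)"
    "b \<notin> diagram \<rho>" "diagram \<rho>' = insert b (diagram \<rho>)" "content b = ?c"
    using add_box_edge[OF 0 1] by metis
  have "edge \<kappa>' (int t * j + int m) = edge \<rho>' (j + d)" for j
    unfolding subword_adds_hook[OF assms(1,2,5)] *(1) using m \<rho> by (auto simp: algebra_simps)
  then show ?thesis
    using 0 1 * by (intro that[of \<rho>' b]) (auto simp: algebra_simps)
qed

lemma subword_hook_ge:
  assumes "t > 0" "m < t" "hook_ge t \<kappa> \<mu>" "\<And>j. edge \<mu> (int t * j + int m) = edge \<rho> (j + d)"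
  shows "\<exists>\<rho>'. \<forall>j. edge \<kappa> (int t * j + int m) = edge \<rho>' (j + d)"
  using assms(3) unfolding hook_ge_def
proof (induction rule: rtranclp_induct)
  case base
  show ?case using assms(4) by blast
next
  case (step \<kappa> \<kappa>')
  then obtain \<rho>' where \<rho>': "\<And>j. edge \<kappa> (int t * j + int m) = edge \<rho>' (j + d)" by blast
  from step(2) obtain i where i: "edge \<kappa> i = 0" "edge \<kappa> (i + int t) = 1"
    "edge \<kappa>' = (edge \<kappa>)(i := 1, i + int t := 0)"
    unfolding adds_hook_iff by blast
  show ?case
  proof (cases "int m = i mod int t")
    case True
    then show ?thesis
      using adds_hook_quotient[OF assms(1,2) i \<rho>' True] by metis
  next
    case False
    then show ?thesis
      using \<rho>' subword_adds_hook[OF assms(1,2) i(3)] by auto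
  qed
qed

text \<open>Existence is obtained from below: the classes of a core belong to the empty partition,
  and each added hook keeps them words of partitions.\<close>

lemma subword_exists:
  assumes "t > 0" "m < t"
  shows "\<exists>\<rho> d. \<forall>j. edge \<kappa> (int t * j + int m) = edge \<rho> (j + d)"
proof -
  obtain \<mu> where \<mu>: "hook_ge t \<kappa> \<mu>" "\<not> (\<exists>\<rho>. adds_hook t \<rho> \<mu>)"
    using core_exists[OF assms(1)] by blast
  obtain d where "\<And>j. edge \<mu> (int t * j + int m) = (if j + d < 0 then 0 else 1)"
    using core_subword[OF assms(1) \<mu>(2)] by blast
  moreover obtain \<rho> where "\<And>i. edge \<rho> i = (if i < 0 then 0 else 1)"
    using edge_empty by blast
  ultimately have "edge \<mu> (int t * j + int m) = edge \<rho> (j + d)" for j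
    by simp
  from subword_hook_ge[OF assms \<mu>(1) this] show ?thesis by blast
qed

text \<open>Offset between the possibly unbalanced subsequence and the 01-sequence of the quotient.
  Adding hooks does not change it, so it depends only on the core.\<close>

definition quotient_shift :: "nat \<Rightarrow> nat \<Rightarrow> int_partition \<Rightarrow> int" where
  "quotient_shift t m \<kappa> = (THE d. \<exists>\<rho>. \<forall>j. edge \<kappa> (int t * j + int m) = edge \<rho> (j + d))"

lemma quotient_eqI:
  assumes "\<And>j. edge \<kappa> (int t * j + int m) = edge \<rho> (j + d)"
  shows "t_quotient t m \<kappa> = \<rho>" "quotient_shift t m \<kappa> = d"
proof -
  show "t_quotient t m \<kappa> = \<rho>"
    unfolding t_quotient_def
  proof (rule the_equality)
    show "boundary_word \<rho> (\<lambda>j. seq01 \<kappa> (int t * j + int m))"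
      using assms unfolding boundary_word_iff seq01_eq_edge by blast
  next
    fix \<rho>' assume "boundary_word \<rho>' (\<lambda>j. seq01 \<kappa> (int t * j + int m))"
    then show "\<rho>' = \<rho>"
      using assms edge_shift_unique unfolding boundary_word_iff seq01_eq_edge by metis
  qed
  show "quotient_shift t m \<kappa> = d"
    unfolding quotient_shift_def
    by (rule the_equality) (use assms edge_shift_unique in metis)+
qed

lemma edge_quotient:
  assumes "t > 0" "m < t"
  shows "edge \<kappa> (int t * j + int m) = edge (t_quotient t m \<kappa>) (j + quotient_shift t m \<kappa>)"
proof -
  obtain \<rho> d where \<rho>: "\<And>j. edge \<kappa> (int t * j + int m) = edge \<rho> (j + d)"
    using subword_exists[OF assms] by blast
  show ?thesis using quotient_eqI[OF \<rho>] \<rho> by simp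
qed

lemma quotient_shift_hook_ge:
  assumes "t > 0" "m < t" "hook_ge t \<kappa> \<mu>"
  shows "quotient_shift t m \<kappa> = quotient_shift t m \<mu>"
  using subword_hook_ge[OF assms edge_quotient[OF assms(1,2)]] quotient_eqI(2) by metis

text \<open>All classes of a core are shifted words of the empty partition, so a core is determined
  by its \<open>t\<close> shifts, and these are the shifts of \<open>\<kappa>\<close>.\<close>

lemma core_unique:
  assumes "t > 0" "hook_ge t \<kappa> \<mu>1" "hook_ge t \<kappa> \<mu>2"
    "\<not> (\<exists>\<rho>. adds_hook t \<rho> \<mu>1)" "\<not> (\<exists>\<rho>. adds_hook t \<rho> \<mu>2)"
  shows "\<mu>1 = \<mu>2"
proof -
  obtain \<rho> where \<rho>: "\<And>i. edge \<rho> i = (if i < 0 then 0 else 1)"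
    using edge_empty by blast
  have core: "edge \<mu> (int t * j + int m) = edge \<rho> (j + quotient_shift t m \<kappa>)"
    if m: "m < t" and \<mu>: "hook_ge t \<kappa> \<mu>" "\<not> (\<exists>\<rho>. adds_hook t \<rho> \<mu>)" for \<mu> m j
  proof -
    obtain d where d: "\<And>j. edge \<mu> (int t * j + int m) = edge \<rho> (j + d)"
      using core_subword[OF assms(1) \<mu>(2)] unfolding \<rho> by blast
    have "quotient_shift t m \<kappa> = d"
      using quotient_shift_hook_ge[OF assms(1) m \<mu>(1)] quotient_eqI(2)[OF d] by simp
    then show ?thesis using d by simp
  qed
  have "edge \<mu>1 i = edge \<mu>2 i" for i
  proof -
    have "i = int t * (i div int t) + int (nat (i mod int t))" "nat (i mod int t) < t"
      using assms(1) by (simp_all add: nat_less_iff)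
    then show ?thesis
      using core[of "nat (i mod int t)" _ "i div int t"] assms by metis
  qed
  then show ?thesis using edge_inject by blast
qed

lemma core_of_eqI:
  assumes "t > 0" "hook_ge t \<kappa> \<mu>" "\<not> (\<exists>\<rho>. adds_hook t \<rho> \<mu>)"
  shows "core_of t \<kappa> = \<mu>"
  unfolding core_of_def using assms core_unique[OF assms(1)] by (intro the_equality) blast+

lemma core_of_spec:
  assumes "t > 0"
  shows "hook_ge t \<kappa> (core_of t \<kappa>)" "\<not> (\<exists>\<rho>. adds_hook t \<rho> (core_of t \<kappa>))"
  using core_exists[OF assms] core_of_eqI[OF assms] by metis+

lemma core_of_adds_hook:
  assumes "t > 0" "adds_hook t \<kappa> \<kappa>'"
  shows "core_of t \<kappa>' = core_of t \<kappa>"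
proof (rule core_of_eqI[OF assms(1)])
  show "hook_ge t \<kappa>' (core_of t \<kappa>)"
    using core_of_spec(1)[OF assms(1), of \<kappa>] assms(2) unfolding hook_ge_def
    by (rule rtranclp.rtrancl_into_rtrancl)
qed (rule core_of_spec(2)[OF assms(1)])

section \<open>Hooks and inversions\<close>

text \<open>Row lengths of the conjugate partition. For \<open>c = 0\<close> no \<open>k\<close>
  qualifies and the value is unspecified, hence the hypotheses \<open>1 \<le> c\<close>
  below.\<close>

definition col_len :: "int_partition \<Rightarrow> nat \<Rightarrow> nat" where
  "col_len \<rho> c = (LEAST k. row_len \<rho> (Suc k) < c)"

lemma le_col_len_iff:
  assumes "1 \<le> r" "1 \<le> c"
  shows "r \<le> col_len \<rho> c \<longleftrightarrow> c \<le> row_len \<rho> r"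
proof
  assume *: "r \<le> col_len \<rho> c"
  have "\<not> row_len \<rho> (Suc (r - 1)) < c"
    by (rule not_less_Least) (use * assms in \<open>auto simp: col_len_def\<close>)
  then show "c \<le> row_len \<rho> r" using assms by simp
next
  assume *: "c \<le> row_len \<rho> r"
  have "row_len \<rho> (Suc (length (parts \<rho>))) < c"
    using assms by (simp add: row_len_def)
  then have "row_len \<rho> (Suc (col_len \<rho> c)) < c"
    unfolding col_len_def by (rule LeastI)
  then show "r \<le> col_len \<rho> c"
    using * row_len_antimono[of "Suc (col_len \<rho> c)" r \<rho>] by (cases "r \<le> col_len \<rho> c") auto
qed

text \<open>Index of the horizontal edge at the foot of column \<open>c\<close>: the content of its
  left end point, which lies \<open>col_len \<rho> c\<close> rows down and \<open>c - 1\<close>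
  columns to the right.\<close>

definition column_edge :: "int_partition \<Rightarrow> nat \<Rightarrow> int" where
  "column_edge \<rho> c = int c - 1 - int (col_len \<rho> c)"

text \<open>Arm plus leg plus one is
  \<open>(row_len \<rho> r - c) + (col_len \<rho> c - r) + 1\<close>: the hook length is the
  distance between the boundary edges at the two ends of the hook.\<close>

lemma hook_length_eq:
  assumes "(r, c) \<in> diagram \<rho>"
  shows "int (hook_length \<rho> (r, c)) = beta \<rho> r - column_edge \<rho> c"
proof -
  have rc: "1 \<le> r" "1 \<le> c" "c \<le> row_len \<rho> r" "r \<le> col_len \<rho> c"
    using assms by (auto simp: diagram_def le_col_len_iff)
  have "{j'. j' > c \<and> (r, j') \<in> diagram \<rho>} = {c<..row_len \<rho> r}"
    using rc by (auto simp: diagram_def)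
  moreover have "{i'. i' > r \<and> (i', c) \<in> diagram \<rho>} = {r<..col_len \<rho> c}"
    using rc by (auto simp: diagram_def le_col_len_iff)
  ultimately show ?thesis
    using rc by (simp add: hook_length_def beta_def column_edge_def)
qed

lemma edge_column_edge:
  assumes "1 \<le> c"
  shows "edge \<rho> (column_edge \<rho> c) = 1"
proof -
  have "column_edge \<rho> c \<noteq> beta \<rho> r" if "1 \<le> r" for r
    using le_col_len_iff[OF that assms, of \<rho>]
    by (cases "r \<le> col_len \<rho> c") (auto simp: column_edge_def beta_def)
  then show ?thesis by (simp add: edge_def)
qed

lemma edge_eq_1_column:
  assumes "edge \<rho> i = 1"
  obtains c where "1 \<le> c" "i = column_edge \<rho> c"
proof -
  obtain p where "p \<in> boundary \<rho>" "content p = i"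
    by (rule boundary_point_exists)
  then obtain r c where p: "(r, c) \<in> boundary \<rho>" "int c - int r = i"
    by (cases p) (simp add: content_def)
  have 1: "beta \<rho> (Suc r) < i" "r = 0 \<or> i \<le> beta \<rho> r"
    using p unfolding mem_boundary_iff by auto
  have "i \<noteq> beta \<rho> r" if "r \<noteq> 0"
    using assms that unfolding edge_eq_1_iff by (metis One_nat_def Suc_leI neq0_conv)
  with 1 have r: "beta \<rho> (Suc r) < i" "r = 0 \<or> i < beta \<rho> r"
    by (cases "r = 0", auto simp: order_le_less)
  have "col_len \<rho> (Suc c) = r"
  proof (rule antisym)
    show "col_len \<rho> (Suc c) \<le> r"
      using le_col_len_iff[of "Suc r" "Suc c" \<rho>] r p(2) by (simp add: beta_def)
    show "r \<le> col_len \<rho> (Suc c)"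
      using le_col_len_iff[of r "Suc c" \<rho>] r p(2) by (cases "r = 0") (auto simp: beta_def)
  qed
  then show ?thesis
    using p(2) by (intro that[of "Suc c"]) (simp_all add: column_edge_def)
qed

lemma column_edge_strict:
  assumes "1 \<le> c" "c < c'"
  shows "column_edge \<rho> c < column_edge \<rho> c'"
proof -
  have "col_len \<rho> c' \<le> col_len \<rho> c"
    using le_col_len_iff[of "col_len \<rho> c'" c' \<rho>] le_col_len_iff[of "col_len \<rho> c'" c \<rho>] assms
    by (cases "col_len \<rho> c' = 0") auto
  then show ?thesis using assms by (simp add: column_edge_def)
qed

lemma mem_diagram_iff:
  assumes "1 \<le> r" "1 \<le> c"
  shows "(r, c) \<in> diagram \<rho> \<longleftrightarrow> column_edge \<rho> c < beta \<rho> r"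
  using assms le_col_len_iff[OF assms, of \<rho>]
  by (cases "r \<le> col_len \<rho> c") (auto simp: diagram_def column_edge_def beta_def)

definition inversions :: "int_partition \<Rightarrow> (int \<times> int) set" where
  "inversions \<rho> = {(i, j). i < j \<and> edge \<rho> i = 1 \<and> edge \<rho> j = 0}"

text \<open>A position lies in the diagram exactly if the foot of its column precedes the end of its
  row on the boundary; every 1 is such a foot and every 0 such an end. Hooks thus become inversions,
  with the hook length as distance.\<close>

lemma bij_betw_diagram_inversions:
  "bij_betw (\<lambda>(r, c). (column_edge \<rho> c, beta \<rho> r)) (diagram \<rho>) (inversions \<rho>)"
  unfolding bij_betw_def
proof
  show "inj_on (\<lambda>(r, c). (column_edge \<rho> c, beta \<rho> r)) (diagram \<rho>)"
  proof (rule inj_onI, clarsimp)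
    fix r c r' c'
    assume D: "(r, c) \<in> diagram \<rho>" "(r', c') \<in> diagram \<rho>"
      and eq: "column_edge \<rho> c = column_edge \<rho> c'" "beta \<rho> r = beta \<rho> r'"
    then have "1 \<le> r" "1 \<le> r'" "1 \<le> c" "1 \<le> c'" by (auto simp: diagram_def)
    then show "r = r' \<and> c = c'"
      using eq beta_eq_iff column_edge_strict[of c c' \<rho>] column_edge_strict[of c' c \<rho>]
      by (metis less_irrefl linorder_neqE_nat)
  qed
  show "(\<lambda>(r, c). (column_edge \<rho> c, beta \<rho> r)) ` diagram \<rho> = inversions \<rho>"
  proof (intro equalityI subsetI)
    fix p assume "p \<in> (\<lambda>(r, c). (column_edge \<rho> c, beta \<rho> r)) ` diagram \<rho>"
    then obtain r c where p: "p = (column_edge \<rho> c, beta \<rho> r)" "(r, c) \<in> diagram \<rho>" by auto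
    then have "1 \<le> r" "1 \<le> c" by (auto simp: diagram_def)
    then show "p \<in> inversions \<rho>"
      using p mem_diagram_iff[of r c \<rho>] edge_column_edge[of c \<rho>]
      unfolding inversions_def by (auto simp: edge_eq_0_iff)
  next
    fix p assume "p \<in> inversions \<rho>"
    then obtain i j where p: "p = (i, j)" "i < j" "edge \<rho> i = 1" "edge \<rho> j = 0"
      by (auto simp: inversions_def)
    from p(4) obtain r where r: "1 \<le> r" "j = beta \<rho> r" by (auto simp: edge_eq_0_iff)
    from p(3) obtain c where c: "1 \<le> c" "i = column_edge \<rho> c" by (rule edge_eq_1_column)
    have "(r, c) \<in> diagram \<rho>" using mem_diagram_iff[of r c] r c p by simp
    then show "p \<in> (\<lambda>(r, c). (column_edge \<rho> c, beta \<rho> r)) ` diagram \<rho>"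
      using p r c by (auto intro!: image_eqI[of _ _ "(r, c)"])
  qed
qed

lemma finite_inversions: "finite (inversions \<rho>)"
  using bij_betw_finite[OF bij_betw_diagram_inversions] finite_diagram by blast

lemma G_hook_eq:
  "(G_hook t \<rho> :: 'a :: field_char_0) =
     1 / (\<Prod>p \<in> {p \<in> inversions \<rho>. int t dvd snd p - fst p}. of_int (snd p - fst p))"
proof -
  have hl: "int (hook_length \<rho> b) = beta \<rho> (fst b) - column_edge \<rho> (snd b)" if "b \<in> diagram \<rho>" for b
    using hook_length_eq[of "fst b" "snd b" \<rho>] that by simp
  have dv: "t dvd hook_length \<rho> b \<longleftrightarrow> int t dvd beta \<rho> (fst b) - column_edge \<rho> (snd b)" if "b \<in> diagram \<rho>" for b
    using hl[OF that] by (metis int_dvd_int_iff)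
  have "(\<Prod>h \<in># filter_mset (\<lambda>h. t dvd h) (hook_lengths \<rho>). of_nat h :: 'a) =
    (\<Prod>b \<in> {b \<in> diagram \<rho>. t dvd hook_length \<rho> b}. of_nat (hook_length \<rho> b))"
    by (simp add: hook_lengths_def filter_mset_image_mset prod_unfold_prod_mset
        filter_mset_mset_set[OF finite_diagram] multiset.map_comp comp_def)
  also have "\<dots> = (\<Prod>b \<in> {b \<in> diagram \<rho>. t dvd hook_length \<rho> b}.
      (\<lambda>p. of_int (snd p - fst p)) ((\<lambda>(r, c). (column_edge \<rho> c, beta \<rho> r)) b))"
  proof (rule prod.cong)
    fix b assume "b \<in> {b \<in> diagram \<rho>. t dvd hook_length \<rho> b}"
    then have "of_nat (hook_length \<rho> b) = (of_int (beta \<rho> (fst b) - column_edge \<rho> (snd b)) :: 'a)"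
      using hl by (metis (no_types, lifting) mem_Collect_eq of_int_of_nat_eq)
    then show "of_nat (hook_length \<rho> b) =
      (of_int (snd ((\<lambda>(r, c). (column_edge \<rho> c, beta \<rho> r)) b) -
        fst ((\<lambda>(r, c). (column_edge \<rho> c, beta \<rho> r)) b)) :: 'a)"
      by (simp add: case_prod_beta)
  qed simp
  also have "\<dots> = (\<Prod>p \<in> {p \<in> inversions \<rho>. int t dvd snd p - fst p}. of_int (snd p - fst p))"
    by (rule prod.reindex_bij_betw, rule bij_betw_Collect[OF bij_betw_diagram_inversions])
      (auto simp: dv)
  finally show ?thesis by (simp add: G_hook_def)
qed

text \<open>Connects the two notions of core: a partition obtained by adding a hook has a 1 and,
  \<open>t\<close> places later, a 0. This is an inversion, hence a box of hook length exactly
  \<open>t\<close>.\<close>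

lemma is_core_imp_not_adds_hook:
  assumes "t > 0" "is_core t \<mu>"
  shows "\<not> (\<exists>\<rho>. adds_hook t \<rho> \<mu>)"
proof
  assume "\<exists>\<rho>. adds_hook t \<rho> \<mu>"
  then obtain \<rho> i where "edge \<mu> = (edge \<rho>)(i := 1, i + int t := 0)"
    unfolding adds_hook_iff by blast
  then have "edge \<mu> i = 1" "edge \<mu> (i + int t) = 0"
    using assms(1) by simp_all
  then have "(i, i + int t) \<in> inversions \<mu>"
    using assms(1) by (simp add: inversions_def)
  then have "(i, i + int t) \<in> (\<lambda>(r, c). (column_edge \<mu> c, beta \<mu> r)) ` diagram \<mu>"
    using bij_betw_imp_surj_on[OF bij_betw_diagram_inversions[of \<mu>]] by simp
  then obtain r c where rc: "(r, c) \<in> diagram \<mu>" "i = column_edge \<mu> c" "i + int t = beta \<mu> r"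
    by auto
  then have "hook_length \<mu> (r, c) = t"
    using hook_length_eq[OF rc(1)] by simp
  moreover have "hook_length \<mu> (r, c) \<in># hook_lengths \<mu>"
    using rc(1) finite_diagram[of \<mu>] by (simp add: hook_lengths_def)
  ultimately show False
    using assms(2) unfolding is_core_def by (metis dvd_refl)
qed

text \<open>A hook of length \<open>h\<close> in a quotient accounts for a hook of length
  \<open>t * h\<close> in the original partition; this is the share of one quotient in the
  denominator of \<open>G_hook\<close>.\<close>

definition scaled_hook_product :: "nat \<Rightarrow> int_partition \<Rightarrow> 'a :: field_char_0" where
  "scaled_hook_product t \<rho> = (\<Prod>p \<in> inversions \<rho>. of_nat t * of_int (snd p - fst p))"

lemma scaled_hook_product_nonzero:
  assumes "t > 0"
  shows "(scaled_hook_product t \<rho> :: 'a :: field_char_0) \<noteq> 0"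
proof -
  have "of_nat t * of_int (snd p - fst p) \<noteq> (0 :: 'a)" if "p \<in> inversions \<rho>" for p
  proof -
    have "snd p - fst p \<noteq> 0"
      using that by (auto simp: inversions_def)
    then show ?thesis
      using assms by (simp only: mult_eq_0_iff of_int_eq_0_iff of_nat_eq_0_iff) simp
  qed
  then show ?thesis
    unfolding scaled_hook_product_def prod_zero_iff[OF finite_inversions] by blast
qed

text \<open>An inversion whose distance is divisible by \<open>t\<close> stays within one residue
  class, where the distance shrinks by the factor \<open>t\<close>; the shifts cancel in
  differences.\<close>

lemma G_hook_quotients:
  assumes "t > 0"
  shows "G_hook t \<kappa> = 1 / (\<Prod>m < t. scaled_hook_product t (t_quotient t m \<kappa>) :: 'a :: field_char_0)"
proof -
  let ?d = "\<lambda>m. quotient_shift t m \<kappa>"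
  let ?f = "\<lambda>(m, a, b). (int t * (a - ?d m) + int m, int t * (b - ?d m) + int m)"
  let ?S = "SIGMA m:{..<t}. inversions (t_quotient t m \<kappa>)"
  let ?T = "{p \<in> inversions \<kappa>. int t dvd snd p - fst p}"
  have e: "edge (t_quotient t m \<kappa>) a = edge \<kappa> (int t * (a - ?d m) + int m)" if "m < t" for m a
    using edge_quotient[OF assms that, of \<kappa> "a - ?d m"] by simp
  have "(\<Prod>m < t. scaled_hook_product t (t_quotient t m \<kappa>) :: 'a) =
    (\<Prod>(m, p) \<in> ?S. of_nat t * of_int (snd p - fst p))"
    unfolding scaled_hook_product_def by (subst prod.Sigma) (auto simp: finite_inversions)
  also have "\<dots> = (\<Prod>p \<in> ?T. of_int (snd p - fst p))"
  proof (rule prod.reindex_bij_witness[where j = ?f and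
        i = "\<lambda>(i, j). (nat (i mod int t), i div int t + ?d (nat (i mod int t)), j div int t + ?d (nat (i mod int t)))"])
    fix x assume "x \<in> ?S"
    then obtain m a b where x: "x = (m, a, b)" "m < t" "a < b"
      "edge (t_quotient t m \<kappa>) a = 1" "edge (t_quotient t m \<kappa>) b = 0"
      by (auto simp: inversions_def)
    show "(case ?f x of (i, j) \<Rightarrow> (nat (i mod int t), i div int t + ?d (nat (i mod int t)),
        j div int t + ?d (nat (i mod int t)))) = x"
      using x(2) assms by (simp add: x(1))
    have "int t dvd int t * (b - ?d m) + int m - (int t * (a - ?d m) + int m)"
      by (simp add: algebra_simps flip: right_diff_distrib)
    then show "?f x \<in> ?T"
      using x assms e[OF x(2)] by (auto simp: inversions_def)
    show "of_int (snd (?f x) - fst (?f x)) = ((case x of (m, p) \<Rightarrow> of_nat t * of_int (snd p - fst p)) :: 'a)"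
      by (simp add: x(1) algebra_simps)
  next
    fix y assume "y \<in> ?T"
    then obtain i j where y: "y = (i, j)" "i < j" "edge \<kappa> i = 1" "edge \<kappa> j = 0" "int t dvd j - i"
      by (auto simp: inversions_def)
    then have mod: "j mod int t = i mod int t" by (simp add: mod_eq_dvd_iff)
    then have ij: "int t * (i div int t) + int (nat (i mod int t)) = i"
      "int t * (j div int t) + int (nat (i mod int t)) = j"
      using assms by (simp, simp add: mod[symmetric])
    show "?f (case y of (i, j) \<Rightarrow> (nat (i mod int t), i div int t + ?d (nat (i mod int t)),
        j div int t + ?d (nat (i mod int t)))) = y"
      using ij by (simp add: y(1))
    have m: "nat (i mod int t) < t" using assms by (simp add: nat_less_iff)
    have "i div int t < j div int t"
      using ij y(2) assms by (metis add_less_cancel_right mult_less_cancel_left_pos of_nat_0_less_iff)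
    then show "(case y of (i, j) \<Rightarrow> (nat (i mod int t), i div int t + ?d (nat (i mod int t)),
        j div int t + ?d (nat (i mod int t)))) \<in> ?S"
      using m e[OF m] ij y by (simp add: inversions_def)
  qed
  finally have "(\<Prod>m < t. scaled_hook_product t (t_quotient t m \<kappa>) :: 'a) = (\<Prod>p \<in> ?T. of_int (snd p - fst p))" .
  then show ?thesis unfolding G_hook_eq by simp
qed

section \<open>Contents of addable and removable boxes\<close>

definition addable_contents :: "int_partition \<Rightarrow> int set" where
  "addable_contents \<rho> = {c. edge \<rho> (c - 1) = 0 \<and> edge \<rho> c = 1}"

definition removable_contents :: "int_partition \<Rightarrow> int set" where
  "removable_contents \<rho> = {c. edge \<rho> (c - 1) = 1 \<and> edge \<rho> c = 0}"

lemma edge_bounds: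
  obtains N where "\<And>i. i < - int N \<Longrightarrow> edge \<rho> i = 0" "\<And>i. i \<ge> int N \<Longrightarrow> edge \<rho> i = 1"
  by (rule that[of "length (parts \<rho>) + row_len \<rho> 1"]) (simp_all add: edge_left edge_right)

lemma content_bounds:
  obtains N where "addable_contents \<rho> \<subseteq> {- int N..int N}" "removable_contents \<rho> \<subseteq> {- int N..int N}"
proof -
  obtain N where N: "\<And>i. i < - int N \<Longrightarrow> edge \<rho> i = 0" "\<And>i. i \<ge> int N \<Longrightarrow> edge \<rho> i = 1"
    by (rule edge_bounds) (rule that)
  have "c \<in> {- int N..int N}" if "edge \<rho> (c - 1) \<noteq> edge \<rho> c" for c
  proof (rule ccontr)
    assume "c \<notin> {- int N..int N}"
    then have "c < - int N \<or> c - 1 \<ge> int N" by auto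
    then show False using N[of c] N[of "c - 1"] that by auto
  qed
  then show ?thesis
    by (intro that[of N]) (auto simp: addable_contents_def removable_contents_def)
qed

lemma finite_contents: "finite (addable_contents \<rho>)" "finite (removable_contents \<rho>)"
  by (meson content_bounds finite_atLeastAtMost_int finite_subset)+

text \<open>Kerov's transition measure of \<open>\<rho>\<close>: the probability, in Plancherel
  growth, of adding the box of content \<open>c\<close>. For addable \<open>c\<close> it is the
  ratio of the plain hook products before and after.\<close>

definition add_weight :: "int_partition \<Rightarrow> int \<Rightarrow> 'a :: field_char_0" where
  "add_weight \<rho> c =
     (\<Prod>y \<in> removable_contents \<rho>. of_int (c - y)) / (\<Prod>x \<in> addable_contents \<rho> - {c}. of_int (c - x))"

text \<open>Within a maximal run of indices satisfying \<open>b\<close> the ratios telescope,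
  leaving \<open>v\<close> at the start of the run over \<open>v\<close> just past its end. The last
  factor belongs to a run still open at \<open>M\<close>.\<close>

lemma prod_ratio_telescope:
  fixes v :: "nat \<Rightarrow> 'a :: field"
  assumes "\<not> b 0" "\<And>n. n \<ge> 1 \<Longrightarrow> v n \<noteq> 0"
  shows "(\<Prod>n = 1..M. if b n then v n / v (Suc n) else 1) =
    (\<Prod>n = 1..M. if b n \<and> \<not> b (n - 1) then v n else 1) /
    (\<Prod>n = 1..M. if \<not> b n \<and> b (n - 1) then v n else 1) * (if b M then 1 / v (Suc M) else 1)"
proof (induction M)
  case (Suc M)
  have "v (Suc M) \<noteq> 0" using assms(2) by simp
  then show ?case
    by (cases "b M"; cases "b (Suc M)") (simp_all add: Suc.IH[unfolded One_nat_def])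
qed (use assms(1) in simp)

lemma prod_split_int:
  fixes f :: "int \<Rightarrow> 'a :: comm_monoid_mult"
  assumes "S \<subseteq> {c - int M..c + int M}" "c \<notin> S"
  shows "prod f S = (\<Prod>n = 1..M. if c - int n \<in> S then f (c - int n) else 1) *
    (\<Prod>n = 1..M. if c + int n \<in> S then f (c + int n) else 1)"
proof -
  have fin: "finite S" using assms(1) by (rule finite_subset) simp
  have "prod f {s \<in> S. s < c} = prod (\<lambda>n. f (c - int n)) {n \<in> {1..M}. c - int n \<in> S}"
    by (rule prod.reindex_bij_witness[of _ "\<lambda>n. c - int n" "\<lambda>s. nat (c - s)"]) (use assms(1) in auto)
  moreover have "prod f {s \<in> S. c < s} = prod (\<lambda>n. f (c + int n)) {n \<in> {1..M}. c + int n \<in> S}"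
    by (rule prod.reindex_bij_witness[of _ "\<lambda>n. c + int n" "\<lambda>s. nat (s - c)"]) (use assms(1) in auto)
  moreover have "s < c \<or> c < s" if "s \<in> S" for s
    using assms(2) that by (cases s c rule: linorder_cases) auto
  then have "S = {s \<in> S. s < c} \<union> {s \<in> S. c < s}"
    by blast
  then have "prod f S = prod f ({s \<in> S. s < c} \<union> {s \<in> S. c < s})"
    by simp
  then have "prod f S = prod f {s \<in> S. s < c} * prod f {s \<in> S. c < s}"
    using fin by (subst (asm) prod.union_disjoint) auto
  ultimately show ?thesis
    by (simp only: prod.inter_filter[OF finite_atLeastAtMost])
qed

text \<open>Walking away from \<open>c\<close>, each run of 1s on the left or of 0s on the right
  starts at a removable content and stops at an addable one, so telescoping along the runs leaves
  exactly the factors of \<open>add_weight\<close>.\<close>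

lemma hook_ratio_eq_add_weight:
  assumes "c \<in> addable_contents \<rho>"
  shows "(\<Prod>i \<in> {i. i < c - 1 \<and> edge \<rho> i = 1}. of_int (c - 1 - i) / of_int (c - i)) *
      (\<Prod>j \<in> {j. c < j \<and> edge \<rho> j = 0}. of_int (j - c) / of_int (j - c + 1)) =
    (add_weight \<rho> c :: 'a :: field_char_0)"
proof -
  have c: "edge \<rho> (c - 1) = 0" "edge \<rho> c = 1"
    using assms by (simp_all add: addable_contents_def)
  obtain N where N: "\<And>i. i < - int N \<Longrightarrow> edge \<rho> i = 0" "\<And>i. i \<ge> int N \<Longrightarrow> edge \<rho> i = 1"
    by (rule edge_bounds) (rule that)
  obtain N' where N': "addable_contents \<rho> \<subseteq> {- int N'..int N'}" "removable_contents \<rho> \<subseteq> {- int N'..int N'}"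
    by (rule content_bounds) (rule that)
  \<comment> \<open>Large enough for the sequence to be constant beyond \<open>c - M\<close> and
    \<open>c + M\<close>, so that no run is open at \<open>M\<close>.\<close>
  define M where "M = N + N' + nat \<bar>c\<bar>"
  define b1 where "b1 = (\<lambda>n. edge \<rho> (c - 1 - int n) = 1)"
  define b2 where "b2 = (\<lambda>n. edge \<rho> (c + int n) = 0)"
  have b0: "\<not> b1 0" "\<not> b2 0" using c by (simp_all add: b1_def b2_def)
  have "edge \<rho> (c - 1 - int M) = 0" "edge \<rho> (c + int M) = 1"
    using N by (auto simp: M_def)
  then have bM: "\<not> b1 M" "\<not> b2 M" by (simp_all add: b1_def b2_def)
  have mem: "c - int n \<in> removable_contents \<rho> \<longleftrightarrow> b1 n \<and> \<not> b1 (n - 1)"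
    "c - int n \<in> addable_contents \<rho> \<longleftrightarrow> \<not> b1 n \<and> b1 (n - 1)"
    "c + int n \<in> removable_contents \<rho> \<longleftrightarrow> b2 n \<and> \<not> b2 (n - 1)"
    "c + int n \<in> addable_contents \<rho> \<longleftrightarrow> \<not> b2 n \<and> b2 (n - 1)" if "1 \<le> n" for n
  proof -
    have e1: "edge \<rho> i = Suc 0 \<longleftrightarrow> edge \<rho> i \<noteq> 0" for i
      by (simp add: edge_def)
    have "c - 1 - int (n - 1) = c - int n" "c + int (n - 1) = c + int n - 1"
      using that by simp_all
    then show "c - int n \<in> removable_contents \<rho> \<longleftrightarrow> b1 n \<and> \<not> b1 (n - 1)"
      "c - int n \<in> addable_contents \<rho> \<longleftrightarrow> \<not> b1 n \<and> b1 (n - 1)"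
      "c + int n \<in> removable_contents \<rho> \<longleftrightarrow> b2 n \<and> \<not> b2 (n - 1)"
      "c + int n \<in> addable_contents \<rho> \<longleftrightarrow> \<not> b2 n \<and> b2 (n - 1)"
      unfolding b1_def b2_def removable_contents_def addable_contents_def
      by (auto simp: e1 add_diff_eq diff_diff_eq add.commute)
  qed
  have "(\<Prod>i \<in> {i. i < c - 1 \<and> edge \<rho> i = 1}. of_int (c - 1 - i) / of_int (c - i) :: 'a) =
      (\<Prod>n \<in> {n \<in> {1..M}. b1 n}. of_nat n / of_nat (Suc n))"
  proof (rule prod.reindex_bij_witness[of _ "\<lambda>n. c - 1 - int n" "\<lambda>i. nat (c - 1 - i)"], goal_cases)
    case (2 i)
    then have "- int N \<le> i" using N(1)[of i] by (cases "- int N \<le> i") auto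
    then show ?case using 2 by (auto simp: b1_def M_def)
  next
    case (5 i)
    then have "c - 1 - i = int (nat (c - 1 - i))" "c - i = int (Suc (nat (c - 1 - i)))" by auto
    then show ?case by (metis of_int_of_nat_eq)
  qed (auto simp: b1_def)
  also have "\<dots> = (\<Prod>n = 1..M. if b1 n then of_nat n / of_nat (Suc n) else 1)"
    by (rule prod.inter_filter) simp
  also have "\<dots> = (\<Prod>n = 1..M. if b1 n \<and> \<not> b1 (n - 1) then of_nat n else 1) /
      (\<Prod>n = 1..M. if \<not> b1 n \<and> b1 (n - 1) then of_nat n else 1)"
    using bM by (subst prod_ratio_telescope) (use b0 in auto)
  finally have L: "(\<Prod>i \<in> {i. i < c - 1 \<and> edge \<rho> i = 1}. of_int (c - 1 - i) / of_int (c - i) :: 'a) = \<dots>" .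
  \<comment> \<open>The signs cancel in each ratio but are needed after telescoping, where
    \<open>c - (c + n) = - n\<close>.\<close>
  have "(\<Prod>j \<in> {j. c < j \<and> edge \<rho> j = 0}. of_int (j - c) / of_int (j - c + 1) :: 'a) =
      (\<Prod>n \<in> {n \<in> {1..M}. b2 n}. - of_nat n / - of_nat (Suc n))"
  proof (rule prod.reindex_bij_witness[of _ "\<lambda>n. c + int n" "\<lambda>j. nat (j - c)"], goal_cases)
    case (2 j)
    then have "j < int N" using N(2)[of j] by (cases "j < int N") auto
    then show ?case using 2 by (auto simp: b2_def M_def)
  next
    case (5 j)
    then have "j - c = int (nat (j - c))" "j - c + 1 = int (Suc (nat (j - c)))" by auto
    then show ?case by (metis of_int_of_nat_eq minus_divide_divide)
  qed (auto simp: b2_def)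
  also have "\<dots> = (\<Prod>n = 1..M. if b2 n then - of_nat n / - of_nat (Suc n) else 1)"
    by (rule prod.inter_filter) simp
  also have "\<dots> = (\<Prod>n = 1..M. if b2 n \<and> \<not> b2 (n - 1) then - of_nat n else 1) /
      (\<Prod>n = 1..M. if \<not> b2 n \<and> b2 (n - 1) then - of_nat n else 1)"
    using bM by (subst prod_ratio_telescope) (use b0 in \<open>auto simp: add_eq_0_iff\<close>)
  finally have R: "(\<Prod>j \<in> {j. c < j \<and> edge \<rho> j = 0}. of_int (j - c) / of_int (j - c + 1) :: 'a) = \<dots>" .
  have bnd: "{- int N'..int N'} \<subseteq> {c - int M..c + int M}"
    by (auto simp: M_def)
  have Y: "(\<Prod>y \<in> removable_contents \<rho>. of_int (c - y) :: 'a) =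
    (\<Prod>n = 1..M. if b1 n \<and> \<not> b1 (n - 1) then of_nat n else 1) *
    (\<Prod>n = 1..M. if b2 n \<and> \<not> b2 (n - 1) then - of_nat n else 1)"
  proof (subst prod_split_int[where c = c and M = M])
    show "c \<notin> removable_contents \<rho>" using c by (simp add: removable_contents_def)
  qed (use N'(2) bnd in \<open>auto simp: mem intro!: arg_cong2[of _ _ _ _ "(*)"] prod.cong\<close>)
  have X: "(\<Prod>x \<in> addable_contents \<rho> - {c}. of_int (c - x) :: 'a) =
    (\<Prod>n = 1..M. if \<not> b1 n \<and> b1 (n - 1) then of_nat n else 1) *
    (\<Prod>n = 1..M. if \<not> b2 n \<and> b2 (n - 1) then - of_nat n else 1)"
    by (subst prod_split_int[where c = c and M = M])
      (use N'(1) bnd in \<open>auto simp: mem intro!: arg_cong2[of _ _ _ _ "(*)"] prod.cong\<close>)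
  show ?thesis
    unfolding add_weight_def L R X Y by simp
qed

text \<open>Only inversions through \<open>c - 1\<close> or \<open>c\<close> change: the distances
  to the 1s on their left and to the 0s on their right grow by 1, and the new pair
  \<open>(c - 1, c)\<close> is a hook of length 1. All factors \<open>t\<close> cancel except that
  of the new pair.\<close>

lemma scaled_hook_product_add_box:
  assumes t: "t > 0" and c: "c \<in> addable_contents \<rho>" and \<rho>': "edge \<rho>' = (edge \<rho>)(c - 1 := 1, c := 0)"
  shows "scaled_hook_product t \<rho> / scaled_hook_product t \<rho>' =
    (add_weight \<rho> c / of_nat t :: 'a :: field_char_0)"
proof -
  define A where "A = {i. i < c - 1 \<and> edge \<rho> i = 1}"
  define B where "B = {j. c < j \<and> edge \<rho> j = 0}"
  define R where "R = {p \<in> inversions \<rho>. fst p \<noteq> c \<and> snd p \<noteq> c - 1}"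
  define f where "f = (\<lambda>p :: int \<times> int. of_nat t * of_int (snd p - fst p) :: 'a)"
  have e: "edge \<rho> (c - 1) = 0" "edge \<rho> c = 1"
    using c by (simp_all add: addable_contents_def)
  have e': "edge \<rho>' i = (if i = c then 0 else if i = c - 1 then 1 else edge \<rho> i)" for i
    by (simp add: \<rho>')
  have inv: "inversions \<rho> = R \<union> ((\<lambda>i. (i, c - 1)) ` A \<union> (\<lambda>j. (c, j)) ` B)"
    using e by (auto simp: inversions_def R_def A_def B_def)
  have inv': "inversions \<rho>' = R \<union> ((\<lambda>i. (i, c)) ` A \<union> (\<lambda>j. (c - 1, j)) ` B \<union> {(c - 1, c)})"
    using e unfolding inversions_def R_def A_def B_def e'
    by (auto split: if_splits)
  have "finite (R \<union> ((\<lambda>i. (i, c - 1)) ` A \<union> (\<lambda>j. (c, j)) ` B))"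
    using finite_inversions[of \<rho>] inv by simp
  then have fin: "finite R" "finite A" "finite B"
    by (auto dest!: finite_imageD simp: inj_on_def)
  have H: "scaled_hook_product t \<rho> = prod f R * ((\<Prod>i \<in> A. f (i, c - 1)) * (\<Prod>j \<in> B. f (c, j)))"
    unfolding scaled_hook_product_def f_def[symmetric] inv
    using fin e by (subst prod.union_disjoint, simp, simp, force simp: R_def inversions_def A_def B_def)+
      (simp add: prod.reindex inj_on_def)
  have H': "scaled_hook_product t \<rho>' =
    prod f R * ((\<Prod>i \<in> A. f (i, c)) * (\<Prod>j \<in> B. f (c - 1, j)) * f (c - 1, c))"
    unfolding scaled_hook_product_def f_def[symmetric] inv'
    using fin e by (subst prod.union_disjoint, simp, simp, force simp: R_def inversions_def A_def B_def)+
      (simp add: prod.reindex inj_on_def)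
  have R0: "prod f R \<noteq> 0"
    using scaled_hook_product_nonzero[OF t, of \<rho>, where 'a = 'a] H by auto
  have fA: "(\<Prod>i \<in> A. f (i, c - 1)) / (\<Prod>i \<in> A. f (i, c)) =
      (\<Prod>i \<in> A. of_int (c - 1 - i) / of_int (c - i))"
    using t unfolding prod_dividef[symmetric] by (simp add: f_def del: of_int_diff)
  have jc: "j - (c - 1) = j - c + 1" for j by simp
  have fB: "(\<Prod>j \<in> B. f (c, j)) / (\<Prod>j \<in> B. f (c - 1, j)) =
      (\<Prod>j \<in> B. of_int (j - c) / of_int (j - c + 1))"
    using t unfolding prod_dividef[symmetric] by (simp add: f_def jc del: of_int_diff of_int_add)
  have "scaled_hook_product t \<rho> / scaled_hook_product t \<rho>' =
    ((\<Prod>i \<in> A. f (i, c - 1)) / (\<Prod>i \<in> A. f (i, c))) * ((\<Prod>j \<in> B. f (c, j)) / (\<Prod>j \<in> B. f (c - 1, j))) / f (c - 1, c)"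
    unfolding H H' using R0 by simp
  also have "\<dots> = (\<Prod>i \<in> A. of_int (c - 1 - i) / of_int (c - i)) *
      (\<Prod>j \<in> B. of_int (j - c) / of_int (j - c + 1)) / of_nat t"
    unfolding fA fB by (simp add: f_def)
  also have "\<dots> = add_weight \<rho> c / of_nat t"
    using hook_ratio_eq_add_weight[OF c, where 'a = 'a] by (simp add: A_def B_def)
  finally show ?thesis .
qed

section \<open>Corners of the diagram and the functions q\<close>

lemma removable_iff:
  "(r, c) \<in> removable \<rho> \<longleftrightarrow> 1 \<le> r \<and> c = row_len \<rho> r \<and> row_len \<rho> (r + 1) < row_len \<rho> r"
proof
  assume "(r, c) \<in> removable \<rho>"
  then obtain \<rho>' where rc: "(r, c) \<in> diagram \<rho>" and \<rho>': "diagram \<rho>' = diagram \<rho> - {(r, c)}"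
    by (auto simp: removable_def)
  have pos: "1 \<le> r" "1 \<le> c" "c \<le> row_len \<rho> r" using rc by (auto simp: diagram_def)
  have no: "row_len \<rho>' r < c"
    using \<rho>' pos by (force simp: diagram_def)
  have "c = row_len \<rho> r"
  proof (rule ccontr)
    assume "c \<noteq> row_len \<rho> r"
    then have "(r, c + 1) \<in> diagram \<rho>'" using \<rho>' pos by (simp add: diagram_def)
    with no show False by (simp add: diagram_def)
  qed
  moreover have "row_len \<rho> (r + 1) < c"
  proof (rule ccontr)
    assume "\<not> row_len \<rho> (r + 1) < c"
    then have "(r + 1, c) \<in> diagram \<rho>'" using \<rho>' pos by (simp add: diagram_def)
    then show False using no row_len_antimono[of r "r + 1" \<rho>'] pos by (simp add: diagram_def)
  qed
  ultimately show "1 \<le> r \<and> c = row_len \<rho> r \<and> row_len \<rho> (r + 1) < row_len \<rho> r"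
    using pos by simp
next
  assume *: "1 \<le> r \<and> c = row_len \<rho> r \<and> row_len \<rho> (r + 1) < row_len \<rho> r"
  then obtain \<rho>' where "diagram \<rho>' = diagram \<rho> - {(r, row_len \<rho> r)}"
    using remove_box[of r \<rho>] by metis
  moreover have "(r, c) \<in> diagram \<rho>" using * by (simp add: diagram_def)
  ultimately show "(r, c) \<in> removable \<rho>" using * by (auto simp: removable_def)
qed

definition corner_rows :: "int_partition \<Rightarrow> nat set" where
  "corner_rows \<rho> = {r. 1 \<le> r \<and> row_len \<rho> (r + 1) < row_len \<rho> r}"

lemma fst_removable: "fst ` removable \<rho> = corner_rows \<rho>"
proof -
  have "fst ` removable \<rho> = {r. \<exists>c. (r, c) \<in> removable \<rho>}"
    by force
  then show ?thesis by (simp add: corner_rows_def removable_iff)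
qed

lemma finite_corner_rows: "finite (corner_rows \<rho>)"
proof (rule finite_subset)
  show "corner_rows \<rho> \<subseteq> {1..length (parts \<rho>)}"
    using row_len_pos_iff[of \<rho>] by (force simp: corner_rows_def)
qed simp

lemma row_len_between_corners:
  assumes "\<And>r. a < r \<Longrightarrow> r < b \<Longrightarrow> r \<notin> corner_rows \<rho>" "a < b"
  shows "row_len \<rho> (a + 1) = row_len \<rho> b"
proof -
  have "row_len \<rho> (a + 1) = row_len \<rho> (a + 1 + n)" if "a + 1 + n \<le> b" for n
    using that
  proof (induction n)
    case (Suc n)
    then have "a + 1 + n \<notin> corner_rows \<rho>" by (intro assms(1)) auto
    then have "row_len \<rho> (a + 1 + n) \<le> row_len \<rho> (a + 1 + Suc n)"
      by (simp add: corner_rows_def)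
    then show ?case
      using Suc row_len_antimono[of "a + 1 + n" "a + 1 + Suc n" \<rho>] by simp
  qed simp
  from this[of "b - (a + 1)"] assms(2) show ?thesis by simp
qed

lemma edge_beta: "1 \<le> r \<Longrightarrow> edge \<rho> (beta \<rho> r) = 0"
  by (auto simp: edge_eq_0_iff)

text \<open>A box can be added in the row after a corner row, and in the first row, for which the
  index 0 stands.\<close>

lemma addable_contents_eq:
  "addable_contents \<rho> = (\<lambda>r. beta \<rho> (r + 1) + 1) ` insert 0 (corner_rows \<rho>)"
proof (intro equalityI subsetI)
  fix c assume c: "c \<in> addable_contents \<rho>"
  then obtain s where s: "1 \<le> s" "c - 1 = beta \<rho> s"
    by (auto simp: addable_contents_def edge_eq_0_iff)
  have "s - 1 \<in> insert 0 (corner_rows \<rho>)"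
  proof (cases "s = 1")
    case False
    then have s1: "1 \<le> s - 1" using s by simp
    then have "beta \<rho> (s - 1) \<noteq> c"
      using c False s edge_beta[of "s - 1" \<rho>] by (auto simp: addable_contents_def)
    then show ?thesis
      using s False row_len_antimono[OF s1, of s \<rho>] by (auto simp: corner_rows_def beta_def)
  qed simp
  then show "c \<in> (\<lambda>r. beta \<rho> (r + 1) + 1) ` insert 0 (corner_rows \<rho>)"
    using s by (intro image_eqI[of _ _ "s - 1"]) auto
next
  fix c assume "c \<in> (\<lambda>r. beta \<rho> (r + 1) + 1) ` insert 0 (corner_rows \<rho>)"
  then obtain r where r: "c = beta \<rho> (r + 1) + 1" "r = 0 \<or> r \<in> corner_rows \<rho>" by auto
  then have "edge \<rho> (c - 1) = 0" by (auto simp: edge_eq_0_iff)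
  moreover have "edge \<rho> c = 1"
    by (rule edge_eq_1_if[of _ r]) (use r in \<open>auto simp: corner_rows_def beta_def\<close>)
  ultimately show "c \<in> addable_contents \<rho>" by (simp add: addable_contents_def)
qed

lemma removable_contents_eq: "removable_contents \<rho> = beta \<rho> ` corner_rows \<rho>"
proof (intro equalityI subsetI)
  fix c assume c: "c \<in> removable_contents \<rho>"
  then obtain r where r: "1 \<le> r" "c = beta \<rho> r"
    by (auto simp: removable_contents_def edge_eq_0_iff)
  have "beta \<rho> (r + 1) \<noteq> c - 1"
    using c edge_beta[of "r + 1" \<rho>] by (auto simp: removable_contents_def)
  then have "r \<in> corner_rows \<rho>"
    using r row_len_antimono[of r "r + 1" \<rho>] by (auto simp: corner_rows_def beta_def)
  with r show "c \<in> beta \<rho> ` corner_rows \<rho>" by simp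
next
  fix c assume "c \<in> beta \<rho> ` corner_rows \<rho>"
  then obtain r where r: "c = beta \<rho> r" "r \<in> corner_rows \<rho>" by auto
  then have "edge \<rho> c = 0" by (auto simp: edge_eq_0_iff corner_rows_def)
  moreover have "edge \<rho> (c - 1) = 1"
    by (rule edge_eq_1_if[of _ r]) (use r in \<open>auto simp: corner_rows_def beta_def\<close>)
  ultimately show "c \<in> removable_contents \<rho>" by (simp add: removable_contents_def)
qed

lemma inj_on_beta: "0 \<notin> S \<Longrightarrow> inj_on (beta \<rho>) S"
  by (rule inj_onI) (metis beta_eq_iff less_one linorder_not_le)

lemma inj_beta_Suc: "inj_on (\<lambda>r. beta \<rho> (r + 1) + 1) S"
  by (rule inj_onI) (use beta_eq_iff[of "_ + 1" "_ + 1" \<rho>] in auto)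

lemma card_addable_contents: "card (addable_contents \<rho>) = card (removable_contents \<rho>) + 1"
proof -
  have "0 \<notin> corner_rows \<rho>" by (simp add: corner_rows_def)
  then show ?thesis
    unfolding addable_contents_eq removable_contents_eq card_image[OF inj_beta_Suc]
      card_image[OF inj_on_beta[OF \<open>0 \<notin> corner_rows \<rho>\<close>]]
    using finite_corner_rows[of \<rho>] by simp
qed

text \<open>Row lengths are constant between corners, so \<open>\<beta>_i\<close> is the length of
  the row just below row \<open>\<alpha>_(i+1)\<close>; thus \<open>x_i\<close> is an addable
  content and \<open>y_j\<close> a removable one. The conventions
  \<open>\<beta>_0 = \<alpha>_(m+1) = 0\<close> account for the empty row below the diagram and for
  the first row.\<close>

lemma q_fun_eq:
  "q_fun k \<rho> = (\<Sum>x \<in> addable_contents \<rho>. x ^ k) - (\<Sum>y \<in> removable_contents \<rho>. y ^ k)"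
proof -
  define xs where "xs = rev (sorted_list_of_set (corner_rows \<rho>))"
  define m where "m = length xs"
  \<comment> \<open>The value 0 outside \<open>1..m\<close> serves both ends: it is the index before
    the first row, and row 0 has length 0 as required of \<open>\<beta>_0\<close>.\<close>
  define al where "al = (\<lambda>j. if 1 \<le> j \<and> j \<le> m then xs ! (j - 1) else 0)"
  have xs: "set xs = corner_rows \<rho>" "distinct xs"
    using finite_corner_rows by (auto simp: xs_def)
  have idx: "\<exists>k < m. r = xs ! k" if "r \<in> corner_rows \<rho>" for r
    using that unfolding xs(1)[symmetric] in_set_conv_nth m_def by metis
  have "sorted_wrt (\<lambda>x y. y < x) xs"
    unfolding xs_def sorted_wrt_rev by (simp add: strict_sorted_list_of_set)
  then have desc: "xs ! j < xs ! i" if "i < j" "j < m" for i j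
    using that unfolding m_def by (rule sorted_wrt_nth_less)
  have corners: "corners \<rho> = map (\<lambda>i. (i, row_len \<rho> i)) xs"
    by (simp add: corners_def fst_removable xs_def)
  have len: "length (corners \<rho>) = m" by (simp add: corners m_def)
  have ab: "corner_alpha \<rho> j = int (al j)" "corner_beta \<rho> j = int (row_len \<rho> (al j))" for j
    by (auto simp: corner_alpha_def corner_beta_def len al_def) (auto simp: corners m_def)
  have bij: "bij_betw al {1..m} (corner_rows \<rho>)"
    unfolding bij_betw_def
  proof
    show "inj_on al {1..m}"
      using xs(2) unfolding m_def by (auto simp: al_def inj_on_def m_def nth_eq_iff_index_eq)
    show "al ` {1..m} = corner_rows \<rho>"
    proof (intro equalityI subsetI)
      fix r assume "r \<in> corner_rows \<rho>"
      then obtain i where "i < m" "r = xs ! i" using idx by blast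
      then show "r \<in> al ` {1..m}" by (intro image_eqI[of _ _ "Suc i"]) (auto simp: al_def)
    next
      fix r assume "r \<in> al ` {1..m}"
      then obtain j where j: "1 \<le> j" "j \<le> m" "r = al j" by auto
      then have "r = xs ! (j - 1)" "j - 1 < length xs" by (auto simp: al_def m_def)
      then show "r \<in> corner_rows \<rho>" using nth_mem xs(1) by metis
    qed
  qed
  have row: "row_len \<rho> (al i) = row_len \<rho> (al (i + 1) + 1)" if "i \<le> m" for i
  proof (cases "i = 0")
    case True
    define b where "b = al 1 + length (parts \<rho>) + 1"
    have "row_len \<rho> (al 1 + 1) = row_len \<rho> b"
    proof (rule row_len_between_corners)
      fix r assume r: "al 1 < r"
      show "r \<notin> corner_rows \<rho>"
      proof
        assume "r \<in> corner_rows \<rho>"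
        from idx[OF this] obtain k where k: "k < m" "r = xs ! k" by (elim exE conjE)
        then have "r \<le> xs ! 0" using desc[of 0 k] by (cases "k = 0") simp_all
        moreover have "al 1 = xs ! 0" using k by (simp add: al_def)
        ultimately have "r \<le> al 1" by simp
        with r show False by simp
      qed
    qed (simp add: b_def)
    also have "\<dots> = 0" by (simp add: b_def row_len_eq_0)
    finally show ?thesis using True by (simp add: al_def)
  next
    case False
    have "xs ! (i - 1) \<in> corner_rows \<rho>"
      using that False xs(1) by (metis Suc_diff_1 Suc_le_lessD m_def neq0_conv nth_mem)
    then have "0 < xs ! (i - 1)" by (simp add: corner_rows_def)
    then have lt: "al (i + 1) < al i"
      using that False desc[of "i - 1" i] by (auto simp: al_def)
    have "row_len \<rho> (al (i + 1) + 1) = row_len \<rho> (al i)"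
    proof (rule row_len_between_corners[OF _ lt])
      fix r assume r: "al (i + 1) < r" "r < al i"
      show "r \<notin> corner_rows \<rho>"
      proof
        assume "r \<in> corner_rows \<rho>"
        from idx[OF this] obtain k where k: "k < m" "r = xs ! k" by (elim exE conjE)
        have "i - 1 < m" using that False by simp
        then have "\<not> k \<le> i - 1"
          using r(2) k desc[of k "i - 1"] that False by (cases "k = i - 1") (auto simp: al_def)
        moreover have "\<not> i \<le> k"
          using r(1) k desc[of i k] that False by (cases "k = i") (auto simp: al_def)
        ultimately show False by simp
      qed
    qed
    then show ?thesis by simp
  qed
  have "(\<Sum>i = 0..m. (corner_beta \<rho> i - corner_alpha \<rho> (i + 1)) ^ k) =
      (\<Sum>i = 0..m. (beta \<rho> (al (i + 1) + 1) + 1) ^ k)"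
    by (rule sum.cong) (auto simp: ab row beta_def)
  also have "\<dots> = (\<Sum>i \<in> {1..m + 1}. (beta \<rho> (al i + 1) + 1) ^ k)"
    by (rule sum.reindex_bij_witness[of _ "\<lambda>i. i - 1" Suc]) auto
  also have "\<dots> = (\<Sum>i \<in> {1..m}. (beta \<rho> (al i + 1) + 1) ^ k) + (beta \<rho> 1 + 1) ^ k"
    by (simp add: al_def)
  also have "(\<Sum>i \<in> {1..m}. (beta \<rho> (al i + 1) + 1) ^ k) =
      (\<Sum>r \<in> corner_rows \<rho>. (beta \<rho> (r + 1) + 1) ^ k)"
    by (rule sum.reindex_bij_betw[OF bij])
  also have "\<dots> + (beta \<rho> 1 + 1) ^ k = (\<Sum>r \<in> insert 0 (corner_rows \<rho>). (beta \<rho> (r + 1) + 1) ^ k)"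
    using finite_corner_rows[of \<rho>] by (subst sum.insert) (auto simp: corner_rows_def)
  also have "\<dots> = (\<Sum>x \<in> addable_contents \<rho>. x ^ k)"
    unfolding addable_contents_eq by (subst sum.reindex[OF inj_beta_Suc]) simp
  finally have X: "(\<Sum>i = 0..m. (corner_beta \<rho> i - corner_alpha \<rho> (i + 1)) ^ k) = \<dots>" .
  have "(\<Sum>j = 1..m. (corner_beta \<rho> j - corner_alpha \<rho> j) ^ k) = (\<Sum>j = 1..m. beta \<rho> (al j) ^ k)"
    by (simp add: ab beta_def)
  also have "\<dots> = (\<Sum>r \<in> corner_rows \<rho>. beta \<rho> r ^ k)"
    by (rule sum.reindex_bij_betw[OF bij])
  also have "\<dots> = (\<Sum>y \<in> removable_contents \<rho>. y ^ k)"
    unfolding removable_contents_eq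
    by (subst sum.reindex) (auto intro!: inj_on_beta simp: corner_rows_def)
  finally show ?thesis unfolding q_fun_def len X by simp
qed

text \<open>The difference sequence of the 01-sequence is 1 at addable contents, -1 at removable
  ones and 0 elsewhere. The set \<open>J\<close> is left free so that two partitions can be compared
  over the same range.\<close>

lemma q_fun_eq_sum_edges:
  assumes "finite J" "addable_contents \<rho> \<union> removable_contents \<rho> \<subseteq> J"
  shows "q_fun k \<rho> = (\<Sum>i \<in> J. (int (edge \<rho> i) - int (edge \<rho> (i - 1))) * i ^ k)"
proof -
  have "(\<Sum>i \<in> J. (int (edge \<rho> i) - int (edge \<rho> (i - 1))) * i ^ k) =
    (\<Sum>i \<in> J. (if i \<in> addable_contents \<rho> then i ^ k else 0) - (if i \<in> removable_contents \<rho> then i ^ k else 0))"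
    by (rule sum.cong) (auto simp: addable_contents_def removable_contents_def edge_def)
  also have "\<dots> = (\<Sum>x \<in> J \<inter> addable_contents \<rho>. x ^ k) - (\<Sum>y \<in> J \<inter> removable_contents \<rho>. y ^ k)"
    by (simp add: sum_subtractf sum.inter_restrict[OF assms(1)])
  also have "\<dots> = (\<Sum>x \<in> addable_contents \<rho>. x ^ k) - (\<Sum>y \<in> removable_contents \<rho>. y ^ k)"
    using assms(2) by (simp add: Int_absorb1)
  finally show ?thesis by (simp add: q_fun_eq)
qed

text \<open>Whatever corners appear or vanish, the swap changes the difference sequence by 1, -2, 1
  at \<open>c - 1\<close>, \<open>c\<close>, \<open>c + 1\<close>; hence a second difference of the
  \<open>k\<close>-th power.\<close>

lemma q_fun_add_box:
  assumes c: "c \<in> addable_contents \<rho>" and \<rho>': "edge \<rho>' = (edge \<rho>)(c - 1 := 1, c := 0)"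
  shows "q_fun k \<rho>' = q_fun k \<rho> + (c + 1) ^ k + (c - 1) ^ k - 2 * c ^ k"
proof -
  define J where "J = addable_contents \<rho> \<union> removable_contents \<rho> \<union>
    (addable_contents \<rho>' \<union> removable_contents \<rho>') \<union> {c - 1, c, c + 1}"
  have J: "finite J" "c - 1 \<in> J" "c \<in> J" "c + 1 \<in> J"
    by (simp_all add: J_def finite_contents)
  define f where "f = (\<lambda>i :: int. i ^ k)"
  have e: "edge \<rho> (c - 1) = 0" "edge \<rho> c = 1"
    using c by (simp_all add: addable_contents_def)
  have "q_fun k \<rho>' - q_fun k \<rho> = (\<Sum>i \<in> J. (int (edge \<rho>' i) - int (edge \<rho>' (i - 1))) * f i) -
      (\<Sum>i \<in> J. (int (edge \<rho> i) - int (edge \<rho> (i - 1))) * f i)"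
    unfolding f_def by (intro arg_cong2[of _ _ _ _ minus] q_fun_eq_sum_edges) (auto simp: J_def finite_contents)
  also have "\<dots> = (\<Sum>i \<in> J. (int (edge \<rho>' i) - int (edge \<rho>' (i - 1))) * f i -
      (int (edge \<rho> i) - int (edge \<rho> (i - 1))) * f i)"
    by (rule sum_subtractf[symmetric])
  also have "\<dots> = (\<Sum>i \<in> J. (if i = c - 1 then f i else 0) + (if i = c + 1 then f i else 0) - 2 * (if i = c then f i else 0))"
  proof (rule sum.cong)
    fix i
    consider "i = c - 1" | "i = c" | "i = c + 1" | "i \<noteq> c - 1" "i \<noteq> c" "i \<noteq> c + 1" by blast
    then show "(int (edge \<rho>' i) - int (edge \<rho>' (i - 1))) * f i - (int (edge \<rho> i) - int (edge \<rho> (i - 1))) * f i =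
      (if i = c - 1 then f i else 0) + (if i = c + 1 then f i else 0) - 2 * (if i = c then f i else 0)"
      by cases (simp_all add: \<rho>' e left_diff_distrib)
  qed simp
  also have "\<dots> = f (c - 1) + f (c + 1) - 2 * f c"
    using J by (simp add: sum_subtractf sum.distrib sum_distrib_left[symmetric])
  finally show ?thesis by (simp add: f_def)
qed

section \<open>Moments of the transition weights\<close>

text \<open>Lagrange interpolation of the left side at the nodes \<open>X\<close>: its degree is
  below \<open>card X\<close>, and \<open>w x\<close> times the node product at \<open>x\<close> is
  its value there.\<close>

lemma lagrange_interpolation_prod:
  fixes X Y :: "'a :: field_char_0 set"
  assumes fin: "finite X" "finite Y" and card: "card X = card Y + 1"
  defines "w \<equiv> \<lambda>x. (\<Prod>y \<in> Y. x - y) / (\<Prod>x' \<in> X - {x}. x - x')"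
  shows "(\<Prod>y \<in> Y. [:- y, 1:]) = (\<Sum>x \<in> X. smult (w x) (\<Prod>x' \<in> X - {x}. [:- x', 1:]))"
proof (rule poly_eqI_degree[where A = X])
  have deg: "degree (\<Prod>x \<in> S. [:- x, 1:]) = card S" if "finite S" for S :: "'a set"
    by (subst degree_prod_eq_sum_degree) auto
  show "card X > degree (\<Prod>y \<in> Y. [:- y, 1:])" using card deg[OF fin(2)] by simp
  have "degree (smult (w x) (\<Prod>x' \<in> X - {x}. [:- x', 1:])) \<le> card Y" if "x \<in> X" for x
    using deg[of "X - {x}"] fin card that by (intro order.trans[OF degree_smult_le]) simp
  then have "degree (\<Sum>x \<in> X. smult (w x) (\<Prod>x' \<in> X - {x}. [:- x', 1:])) \<le> card Y"
    using fin by (intro degree_sum_le) auto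
  then show "card X > degree (\<Sum>x \<in> X. smult (w x) (\<Prod>x' \<in> X - {x}. [:- x', 1:]))"
    using card by simp
  fix x assume x: "x \<in> X"
  have "poly (\<Sum>x \<in> X. smult (w x) (\<Prod>x' \<in> X - {x}. [:- x', 1:])) x =
    (\<Sum>z \<in> X. if z = x then w x * (\<Prod>x' \<in> X - {x}. x - x') else 0)"
    unfolding poly_sum
  proof (rule sum.cong)
    fix z assume "z \<in> X"
    have "(\<Prod>x' \<in> X - {z}. x - x') = 0" if "z \<noteq> x"
      using fin x that by (intro prod_zero) auto
    then show "poly (smult (w z) (\<Prod>x' \<in> X - {z}. [:- x', 1:])) x =
        (if z = x then w x * (\<Prod>x' \<in> X - {x}. x - x') else 0)"
      by (auto simp: poly_prod)
  qed simp
  also have "\<dots> = w x * (\<Prod>x' \<in> X - {x}. x - x')" using fin x by simp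
  also have "(\<Prod>x' \<in> X - {x}. x - x') \<noteq> 0" using fin by auto
  then have "w x * (\<Prod>x' \<in> X - {x}. x - x') = (\<Prod>y \<in> Y. x - y)" by (simp add: w_def)
  finally show "poly (\<Prod>y \<in> Y. [:- y, 1:]) x =
      poly (\<Sum>x \<in> X. smult (w x) (\<Prod>x' \<in> X - {x}. [:- x', 1:])) x"
    by (simp add: poly_prod)
qed

text \<open>Coefficient reversal: evaluate at \<open>1 / u\<close> and multiply by
  \<open>u ^ card Y\<close>, which is the right power on both sides because each product on the
  right has \<open>card X - 1 = card Y\<close> factors.\<close>

lemma lagrange_interpolation_prod_reflected:
  fixes X Y :: "'a :: field_char_0 set"
  assumes fin: "finite X" "finite Y" and card: "card X = card Y + 1"
  defines "w \<equiv> \<lambda>x. (\<Prod>y \<in> Y. x - y) / (\<Prod>x' \<in> X - {x}. x - x')"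
  shows "(\<Prod>y \<in> Y. [:1, - y:]) = (\<Sum>x \<in> X. smult (w x) (\<Prod>x' \<in> X - {x}. [:1, - x':]))"
    (is "?P = ?Q")
proof -
  have "poly ?P u = poly ?Q u" if "u \<noteq> 0" for u
  proof -
    have refl: "(\<Prod>s \<in> S. 1 - s * u) = u ^ card S * (\<Prod>s \<in> S. 1 / u - s)" for S
    proof -
      have "(\<Prod>s \<in> S. 1 - s * u) = (\<Prod>s \<in> S. u * (1 / u - s))"
        using that by (intro prod.cong) (auto simp: field_simps)
      then show ?thesis by (simp add: prod.distrib)
    qed
    have "poly ?P u = u ^ card Y * (\<Prod>y \<in> Y. 1 / u - y)"
      using refl[of Y] by (simp add: poly_prod mult.commute)
    also have "(\<Prod>y \<in> Y. 1 / u - y) = poly (\<Prod>y \<in> Y. [:- y, 1:]) (1 / u)"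
      by (simp add: poly_prod)
    also have "\<dots> = (\<Sum>x \<in> X. w x * (\<Prod>x' \<in> X - {x}. 1 / u - x'))"
      unfolding lagrange_interpolation_prod[OF fin card] by (simp add: poly_sum poly_prod w_def)
    also have "u ^ card Y * \<dots> = (\<Sum>x \<in> X. w x * (\<Prod>x' \<in> X - {x}. 1 - x' * u))"
      unfolding sum_distrib_left refl using fin card by (intro sum.cong) (auto simp: mult_ac)
    finally show ?thesis by (simp add: poly_sum poly_prod mult.commute)
  qed
  \<comment> \<open>The substitution says nothing at \<open>u = 0\<close>; multiplying both sides by
    the variable makes them agree there too, and the variable is cancelled afterwards.\<close>
  then have "poly ([:0, 1:] * ?P) u = poly ([:0, 1:] * ?Q) u" for u
    by (cases "u = 0") auto
  then have "[:0, 1:] * ?P = [:0, 1:] * ?Q"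
    by (simp add: poly_eq_poly_eq_iff[symmetric] fun_eq_iff)
  then show ?thesis by simp
qed

text \<open>Logarithmic derivative, free of division because the geometric series is the inverse of
  the linear factor.\<close>

lemma fps_deriv_prod_linear:
  fixes S :: "'a :: field_char_0 set"
  assumes "finite S"
  shows "fps_deriv (\<Prod>s \<in> S. 1 - fps_const s * fps_X) =
    - (\<Prod>s \<in> S. 1 - fps_const s * fps_X) * (\<Sum>s \<in> S. fps_const s * Abs_fps (\<lambda>n. s ^ n))"
  using assms
proof (induction S)
  case (insert s S)
  have geo: "(1 - fps_const s * fps_X) * Abs_fps (\<lambda>n. s ^ n) = 1"
    by (rule fps_ext) (auto simp: left_diff_distrib mult.assoc fps_X_mult_nth power_eq_if)
  let ?P = "\<Prod>s \<in> S. 1 - fps_const s * fps_X"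
  let ?K = "\<Sum>s \<in> S. fps_const s * Abs_fps (\<lambda>n. s ^ n)"
  have "fps_deriv (\<Prod>s \<in> insert s S. 1 - fps_const s * fps_X) =
    - fps_const s * ?P + (1 - fps_const s * fps_X) * (- ?P * ?K)"
    using insert by simp
  also have "\<dots> = - fps_const s * ?P * ((1 - fps_const s * fps_X) * Abs_fps (\<lambda>n. s ^ n)) +
      (1 - fps_const s * fps_X) * (- ?P * ?K)"
    by (simp add: geo)
  also have "\<dots> = - (\<Prod>s \<in> insert s S. 1 - fps_const s * fps_X) *
      (\<Sum>s \<in> insert s S. fps_const s * Abs_fps (\<lambda>n. s ^ n))"
    using insert by (simp add: algebra_simps del: fps_const_neg)
  finally show ?case .
qed simp

text \<open>The generating function of the moments is the quotient of the two products
  \<open>\<Prod>\<^sub>y (1 - y u)\<close> and \<open>\<Prod>\<^sub>x (1 - x u)\<close>; the recursion is its logarithmic derivative.\<close>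

lemma interpolation_moments:
  fixes X Y :: "'a :: field_char_0 set"
  assumes fin: "finite X" "finite Y" and card: "card X = card Y + 1"
  defines "w \<equiv> \<lambda>x. (\<Prod>y \<in> Y. x - y) / (\<Prod>x' \<in> X - {x}. x - x')"
  defines "h \<equiv> \<lambda>n. \<Sum>x \<in> X. w x * x ^ n"
  shows "h 0 = 1"
    and "of_nat (Suc n) * h (Suc n) =
      (\<Sum>k = 0..n. h k * ((\<Sum>x \<in> X. x ^ Suc (n - k)) - (\<Sum>y \<in> Y. y ^ Suc (n - k))))"
proof -
  define E where "E = (\<lambda>s :: 'a. 1 - fps_const s * fps_X)"
  define G where "G = (\<lambda>s :: 'a. Abs_fps (\<lambda>n. s ^ n))"
  define H where "H = Abs_fps h"
  have geo: "E s * G s = 1" for s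
    unfolding E_def G_def
    by (rule fps_ext) (auto simp: left_diff_distrib mult.assoc fps_X_mult_nth power_eq_if)
  have E: "E s = fps_of_poly [:1, - s:]" for s
    by (simp add: E_def fps_of_poly_linear' del: fps_const_neg)
  have H: "H = (\<Sum>x \<in> X. fps_const (w x) * G x)"
    by (rule fps_ext) (simp add: H_def h_def G_def fps_sum_nth)
  have "(\<Prod>x \<in> X. E x) * H = (\<Sum>x \<in> X. fps_const (w x) * (\<Prod>x' \<in> X - {x}. E x'))"
    unfolding H sum_distrib_left
  proof (rule sum.cong)
    fix x assume "x \<in> X"
    then have "prod E X = E x * prod E (X - {x})" using fin by (simp add: prod.remove)
    then have "prod E X * (fps_const (w x) * G x) = fps_const (w x) * prod E (X - {x}) * (E x * G x)"
      by (simp add: mult_ac)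
    then show "prod E X * (fps_const (w x) * G x) = fps_const (w x) * prod E (X - {x})"
      by (simp add: geo)
  qed simp
  also have "\<dots> = fps_of_poly (\<Sum>x \<in> X. smult (w x) (\<Prod>x' \<in> X - {x}. [:1, - x':]))"
    by (simp add: E fps_of_poly_sum fps_of_poly_smult fps_of_poly_prod)
  also have "\<dots> = (\<Prod>y \<in> Y. E y)"
    unfolding w_def lagrange_interpolation_prod_reflected[OF fin card, symmetric]
    by (simp add: E fps_of_poly_prod)
  finally have AH: "(\<Prod>x \<in> X. E x) * H = (\<Prod>y \<in> Y. E y)" .
  have A0: "fps_nth (\<Prod>s \<in> S. E s) 0 = 1" for S
    by (induction S rule: infinite_finite_induct) (simp_all add: E_def)
  have "fps_nth ((\<Prod>x \<in> X. E x) * H) 0 = 1" unfolding AH by (rule A0)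
  then show "h 0 = 1" using A0[of X] by (simp add: H_def)
  define K where "K = (\<lambda>S. \<Sum>s \<in> S. fps_const s * G s)"
  have Kn: "fps_nth (K S) j = (\<Sum>s \<in> S. s ^ Suc j)" for S j
    by (simp add: K_def G_def fps_sum_nth)
  have D: "fps_deriv (\<Prod>s \<in> S. E s) = - (\<Prod>s \<in> S. E s) * K S" if "finite S" for S
    unfolding E_def G_def K_def using that by (rule fps_deriv_prod_linear)
  have "fps_deriv ((\<Prod>x \<in> X. E x) * H) = - (\<Prod>y \<in> Y. E y) * K Y"
    unfolding AH by (rule D[OF fin(2)])
  also have "\<dots> = - ((\<Prod>x \<in> X. E x) * H) * K Y" unfolding AH ..
  \<comment> \<open>With \<open>A\<close>, \<open>B\<close> the products over \<open>X\<close>,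
    \<open>Y\<close>, differentiating \<open>A * H = B\<close> gives
    \<open>- A * K X * H + A * H' = - A * H * K Y\<close>; \<open>A\<close> has constant coefficient
    1 and can be cancelled.\<close>
  finally have "(\<Prod>x \<in> X. E x) * (fps_deriv H - H * (K X - K Y)) = 0"
    by (simp add: D[OF fin(1)] algebra_simps)
  moreover have "(\<Prod>x \<in> X. E x) \<noteq> 0" using A0[of X] by auto
  ultimately have "fps_deriv H = H * (K X - K Y)" by simp
  then have "fps_nth (fps_deriv H) n = fps_nth (H * (K X - K Y)) n" by simp
  then show "of_nat (Suc n) * h (Suc n) =
      (\<Sum>k = 0..n. h k * ((\<Sum>x \<in> X. x ^ Suc (n - k)) - (\<Sum>y \<in> Y. y ^ Suc (n - k))))"
    by (simp add: H_def fps_mult_nth Kn)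
qed

definition add_moment :: "nat \<Rightarrow> int_partition \<Rightarrow> 'a :: field_char_0" where
  "add_moment n \<rho> = (\<Sum>c \<in> addable_contents \<rho>. add_weight \<rho> c * of_int c ^ n)"

text \<open>The contents serve as nodes: there is one more addable than removable content, and the
  differences of power sums are the q's. The total mass 1 is what later cancels the unchanged part
  of \<open>f\<close> in \<open>D_hook\<close>.\<close>

lemma add_moment_rec:
  shows "add_moment 0 \<rho> = (1 :: 'a :: field_char_0)"
    and "of_nat (Suc n) * add_moment (Suc n) \<rho> =
      (\<Sum>k = 0..n. add_moment k \<rho> * of_int (q_fun (Suc (n - k)) \<rho>) :: 'a)"
proof -
  let ?X = "of_int ` addable_contents \<rho> :: 'a set" and ?Y = "of_int ` removable_contents \<rho> :: 'a set"
  have inj: "inj_on (of_int :: int \<Rightarrow> 'a) S" for S by (simp add: inj_on_def)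
  have card: "card ?X = card ?Y + 1"
    by (simp add: card_image inj card_addable_contents)
  have fin: "finite ?X" "finite ?Y" by (simp_all add: finite_contents)
  have w: "(\<Prod>y \<in> ?Y. of_int c - y) / (\<Prod>x \<in> ?X - {of_int c}. of_int c - x) = add_weight \<rho> c"
    if "c \<in> addable_contents \<rho>" for c
  proof -
    have "?X - {of_int c} = of_int ` (addable_contents \<rho> - {c})" by auto
    then show ?thesis by (simp add: add_weight_def prod.reindex inj)
  qed
  have m: "(\<Sum>x \<in> ?X. (\<Prod>y \<in> ?Y. x - y) / (\<Prod>x' \<in> ?X - {x}. x - x') * x ^ n) = add_moment n \<rho>" for n
    unfolding add_moment_def sum.reindex[OF inj] o_def by (intro sum.cong refl) (simp only: w)
  have q: "(\<Sum>x \<in> ?X. x ^ k) - (\<Sum>y \<in> ?Y. y ^ k) = of_int (q_fun k \<rho>)" for k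
    by (simp add: q_fun_eq sum.reindex inj)
  show "add_moment 0 \<rho> = (1 :: 'a)"
    using interpolation_moments(1)[OF fin card] unfolding m .
  show "of_nat (Suc n) * add_moment (Suc n) \<rho> =
      (\<Sum>k = 0..n. add_moment k \<rho> * of_int (q_fun (Suc (n - k)) \<rho>) :: 'a)"
    using interpolation_moments(2)[OF fin card, of n] unfolding m q .
qed

section \<open>Polynomials in the functions q of the quotients and in a content\<close>

text \<open>\<open>d\<close> bounds the weighted degree, with weight \<open>k\<close> for
  \<open>q_fun k\<close>, of some expression for the function. Only such an upper bound is recorded,
  so it may be raised at will.\<close>

inductive q_poly :: "nat \<Rightarrow> nat \<Rightarrow> (int_partition \<Rightarrow> 'a :: field_char_0) \<Rightarrow> bool" for t where
  q_poly_const: "q_poly t d (\<lambda>_. a)"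
| q_poly_q_fun: "m < t \<Longrightarrow> k \<le> d \<Longrightarrow> q_poly t d (\<lambda>\<kappa>. of_int (q_fun k (t_quotient t m \<kappa>)))"
| q_poly_add: "q_poly t d f \<Longrightarrow> q_poly t d g \<Longrightarrow> q_poly t d (\<lambda>\<kappa>. f \<kappa> + g \<kappa>)"
| q_poly_mult: "q_poly t d f \<Longrightarrow> q_poly t e g \<Longrightarrow> d + e \<le> n \<Longrightarrow> q_poly t n (\<lambda>\<kappa>. f \<kappa> * g \<kappa>)"

lemma q_poly_mono: "q_poly t d f \<Longrightarrow> d \<le> e \<Longrightarrow> q_poly t e f"
proof (induction arbitrary: e rule: q_poly.induct)
  case (q_poly_mult d f d' g n)
  show ?case
    by (rule q_poly.q_poly_mult[OF q_poly_mult.hyps(1,2)]) (use q_poly_mult in simp)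
qed (auto intro: q_poly.intros)

lemma q_poly_sum:
  assumes "\<And>x. x \<in> A \<Longrightarrow> q_poly t d (f x)"
  shows "q_poly t d (\<lambda>\<kappa>. \<Sum>x \<in> A. f x \<kappa>)"
  using assms by (induction A rule: infinite_finite_induct) (auto intro: q_poly.intros)

lemma q_poly_prod:
  assumes "\<And>x. x \<in> A \<Longrightarrow> \<exists>d. q_poly t d (f x)"
  shows "\<exists>d. q_poly t d (\<lambda>\<kappa>. \<Prod>x \<in> A. f x \<kappa>)"
  using assms
proof (induction A rule: infinite_finite_induct)
  case (insert x A)
  then obtain d e where "q_poly t d (f x)" "q_poly t e (\<lambda>\<kappa>. \<Prod>x \<in> A. f x \<kappa>)" by blast
  then have "q_poly t (d + e) (\<lambda>\<kappa>. f x \<kappa> * (\<Prod>x \<in> A. f x \<kappa>))"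
    by (rule q_poly_mult) simp
  then show ?case using insert by auto
qed (auto intro: q_poly_const)

lemma q_poly_q_part:
  assumes "m < t"
  shows "\<exists>d. q_poly t d (\<lambda>\<kappa>. of_int (q_part \<delta> (t_quotient t m \<kappa>)) :: 'a :: field_char_0)"
proof -
  have "\<exists>d. q_poly t d (\<lambda>\<kappa>. of_int (\<Prod>k \<leftarrow> ks. q_fun k (t_quotient t m \<kappa>)) :: 'a)" for ks
  proof (induction ks)
    case (Cons k ks)
    then obtain d where "q_poly t d (\<lambda>\<kappa>. of_int (\<Prod>k \<leftarrow> ks. q_fun k (t_quotient t m \<kappa>)) :: 'a)" ..
    then have "q_poly t (k + d) (\<lambda>\<kappa>. of_int (q_fun k (t_quotient t m \<kappa>)) *
        of_int (\<Prod>k \<leftarrow> ks. q_fun k (t_quotient t m \<kappa>)) :: 'a)"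
      by (intro q_poly_mult[of t k _ d] q_poly_q_fun assms) simp_all
    then show ?case by auto
  qed (auto intro: q_poly_const)
  then show ?thesis by (simp add: q_part_def)
qed

lemma q_poly_prod_q_part:
  "\<exists>d. q_poly t d (\<lambda>\<kappa>. \<Prod>j < t. of_int (q_part (\<tau> j) (t_quotient t j \<kappa>)) :: 'a :: field_char_0)"
  by (rule q_poly_prod) (simp add: q_poly_q_part)

lemma q_poly_common_degree:
  assumes "finite A" "\<And>x. x \<in> A \<Longrightarrow> \<exists>d. q_poly t d (f x)"
  shows "\<exists>d. \<forall>x \<in> A. q_poly t d (f x)"
proof -
  obtain e where e: "\<And>x. x \<in> A \<Longrightarrow> q_poly t (e x) (f x)"
    using assms(2) by metis
  have "q_poly t (sum e A) (f x)" if "x \<in> A" for x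
    using e[OF that] member_le_sum[OF that, of e] assms(1) by (auto intro: q_poly_mono)
  then show ?thesis by blast
qed

lemma q_linear_combination_imp_q_poly:
  fixes \<eta> :: "int_partition \<Rightarrow> 'a :: field_char_0"
  assumes "q_linear_combination t \<eta>"
  shows "\<exists>d. q_poly t d \<eta>"
proof -
  obtain T a where T: "finite T" and
    \<eta>: "\<And>\<kappa>. \<eta> \<kappa> = (\<Sum>\<tau> \<in> T. a \<tau> * (\<Prod>j < t. of_int (q_part (\<tau> j) (t_quotient t j \<kappa>))))"
    using assms unfolding q_linear_combination_def by blast
  let ?f = "\<lambda>\<tau> \<kappa>. \<Prod>j < t. of_int (q_part (\<tau> j) (t_quotient t j \<kappa>)) :: 'a"
  have "\<exists>d. \<forall>\<tau> \<in> T. q_poly t d (?f \<tau>)"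
    by (rule q_poly_common_degree[OF T q_poly_prod_q_part])
  then obtain d where d: "\<And>\<tau>. \<tau> \<in> T \<Longrightarrow> q_poly t d (?f \<tau>)"
    by blast
  have "q_poly t d (\<lambda>\<kappa>. a \<tau> * ?f \<tau> \<kappa>)" if "\<tau> \<in> T" for \<tau>
    using q_poly_mult[OF q_poly_const[of t 0 "a \<tau>"] d[OF that], of d] by simp
  then have "q_poly t d (\<lambda>\<kappa>. \<Sum>\<tau> \<in> T. a \<tau> * ?f \<tau> \<kappa>)"
    by (rule q_poly_sum)
  then show ?thesis using \<eta> by (metis (no_types, lifting) ext)
qed

text \<open>The bound on the degree is strict, so that bound 0 forces the zero function.\<close>

inductive content_poly :: "nat \<Rightarrow> nat \<Rightarrow> (int_partition \<Rightarrow> int \<Rightarrow> 'a :: field_char_0) \<Rightarrow> bool" for t where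
  content_poly_zero: "content_poly t d (\<lambda>_ _. 0)"
| content_poly_term: "q_poly t e \<eta> \<Longrightarrow> e + s < d \<Longrightarrow> content_poly t d (\<lambda>\<kappa> c. \<eta> \<kappa> * of_int c ^ s)"
| content_poly_add: "content_poly t d F \<Longrightarrow> content_poly t d H \<Longrightarrow> content_poly t d (\<lambda>\<kappa> c. F \<kappa> c + H \<kappa> c)"

lemma content_poly_mono: "content_poly t d F \<Longrightarrow> d \<le> e \<Longrightarrow> content_poly t e F"
  by (induction rule: content_poly.induct) (auto intro: content_poly.intros)

lemma content_poly_sum:
  assumes "\<And>x. x \<in> A \<Longrightarrow> content_poly t d (F x)"
  shows "content_poly t d (\<lambda>\<kappa> c. \<Sum>x \<in> A. F x \<kappa> c)"
  using assms by (induction A rule: infinite_finite_induct) (auto intro: content_poly.intros)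

lemma content_poly_mult:
  assumes "content_poly t d F" "content_poly t e H"
  shows "content_poly t (d + e) (\<lambda>\<kappa> c. F \<kappa> c * H \<kappa> c)"
  using assms(1)
proof (induction rule: content_poly.induct)
  case (content_poly_term d1 \<eta> s d)
  note 1 = this
  from assms(2) show ?case
  proof (induction rule: content_poly.induct)
    case (content_poly_term d2 \<theta> s' e)
    have "q_poly t (d1 + d2) (\<lambda>\<kappa>. \<eta> \<kappa> * \<theta> \<kappa>)"
      using 1(1) content_poly_term(1) by (rule q_poly_mult) simp
    then have "content_poly t (d + e) (\<lambda>\<kappa> c. (\<eta> \<kappa> * \<theta> \<kappa>) * of_int c ^ (s + s'))"
      by (rule content_poly.content_poly_term) (use 1(2) content_poly_term(2) in simp)
    then show ?case by (simp add: power_add mult_ac)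
  next
    case (content_poly_add e F H)
    then show ?case using content_poly.content_poly_add by (simp add: distrib_left)
  qed (simp add: content_poly_zero)
next
  case (content_poly_add d F H)
  then show ?case using content_poly.content_poly_add by (simp add: distrib_right)
qed (simp add: content_poly_zero)

lemma content_poly_of_q_poly: "q_poly t d f \<Longrightarrow> content_poly t (Suc d) (\<lambda>\<kappa> _. f \<kappa>)"
  using content_poly_term[of t d f 0 "Suc d"] by simp

lemma content_poly_mult_q_poly:
  assumes "content_poly t d F" "q_poly t e f"
  shows "content_poly t (d + e) (\<lambda>\<kappa> c. F \<kappa> c * f \<kappa>)"
  using assms(1)
proof (induction rule: content_poly.induct)
  case (content_poly_term d1 \<eta> s d)
  have "q_poly t (d1 + e) (\<lambda>\<kappa>. \<eta> \<kappa> * f \<kappa>)"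
    using content_poly_term(1) assms(2) by (rule q_poly_mult) simp
  then have "content_poly t (d + e) (\<lambda>\<kappa> c. (\<eta> \<kappa> * f \<kappa>) * of_int c ^ s)"
    by (rule content_poly.content_poly_term) (use content_poly_term(2) in simp)
  then show ?case by (simp add: mult_ac)
next
  case (content_poly_add d F H)
  then show ?case using content_poly.content_poly_add by (simp add: distrib_right)
qed (simp add: content_poly_zero)

lemma content_poly_prod:
  assumes "\<And>x. x \<in> A \<Longrightarrow> \<exists>d. content_poly t d (F x)"
  shows "\<exists>d. content_poly t d (\<lambda>\<kappa> c. \<Prod>x \<in> A. F x \<kappa> c)"
  using assms
proof (induction A rule: infinite_finite_induct)
  case (insert x A)
  then obtain d e where "content_poly t d (F x)" "content_poly t e (\<lambda>\<kappa> c. \<Prod>x \<in> A. F x \<kappa> c)" by blast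
  from content_poly_mult[OF this] show ?case using insert by auto
qed (use content_poly_of_q_poly[OF q_poly_const[of t 0 1]] in auto)

text \<open>The top powers of \<open>c\<close> cancel; as the bound is strict, this is the source of
  the loss of degree.\<close>

lemma content_poly_power_diff:
  "content_poly t k (\<lambda>\<kappa> c. (of_int c + a) ^ k - of_int c ^ k :: 'a :: field_char_0)"
proof -
  have "(of_int c + a) ^ k - of_int c ^ k =
    (\<Sum>s < k. (of_nat (k choose s) * a ^ (k - s)) * of_int c ^ s :: 'a)" for c
  proof -
    have "(of_int c + a) ^ k = (\<Sum>s < Suc k. of_nat (k choose s) * of_int c ^ s * a ^ (k - s))"
      by (simp only: binomial_ring lessThan_Suc_atMost)
    then show ?thesis by (simp add: mult_ac)
  qed
  moreover have "content_poly t k (\<lambda>\<kappa> c. \<Sum>s < k. (of_nat (k choose s) * a ^ (k - s)) * of_int c ^ s :: 'a)"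
    by (intro content_poly_sum content_poly_term[OF q_poly_const[of t 0]]) simp
  ultimately show ?thesis by simp
qed

text \<open>The relation occurring in the definition of admissibility; its last two conditions follow from
  the others.\<close>

definition adds_quotient_box ::
  "nat \<Rightarrow> nat \<Rightarrow> int_partition \<Rightarrow> int_partition \<Rightarrow> int \<Rightarrow> bool" where
  "adds_quotient_box t m \<kappa> \<kappa>' c \<longleftrightarrow>
     core_of t \<kappa>' = core_of t \<kappa> \<and>
     (\<forall>j < t. j \<noteq> m \<longrightarrow> t_quotient t j \<kappa>' = t_quotient t j \<kappa>) \<and>
     (\<exists>b. b \<notin> diagram (t_quotient t m \<kappa>) \<and>
        diagram (t_quotient t m \<kappa>') = insert b (diagram (t_quotient t m \<kappa>)) \<and> content b = c) \<and>
     c \<in> addable_contents (t_quotient t m \<kappa>) \<and>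
     edge (t_quotient t m \<kappa>') = (edge (t_quotient t m \<kappa>))(c - 1 := 1, c := 0)"

text \<open>The change may depend on the old partition and the content only. It is restricted to
  core \<open>\<mu>\<close> because nothing is known about an admissible function elsewhere.\<close>

definition has_difference ::
  "nat \<Rightarrow> int_partition \<Rightarrow> nat \<Rightarrow> (int_partition \<Rightarrow> 'a :: field_char_0) \<Rightarrow>
     (int_partition \<Rightarrow> int \<Rightarrow> 'a) \<Rightarrow> bool" where
  "has_difference t \<mu> m f F \<longleftrightarrow>
     (\<forall>\<kappa> \<kappa>' c. core_of t \<kappa> = \<mu> \<longrightarrow> adds_quotient_box t m \<kappa> \<kappa>' c \<longrightarrow> f \<kappa>' = f \<kappa> + F \<kappa> c)"

text \<open>By the product rule the change of \<open>f * g\<close> is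
  \<open>F * g + H * f + F * H\<close>, and strictness in one factor makes the bound of the product
  strict. For \<open>d = 0\<close> the change vanishes.\<close>

lemma q_poly_difference:
  assumes "q_poly t d f"
  shows "\<exists>F. content_poly t d F \<and> has_difference t \<mu> m f F"
  using assms
proof (induction rule: q_poly.induct)
  case (q_poly_const d a)
  then show ?case
    by (intro exI[of _ "\<lambda>_ _. 0"]) (auto simp: has_difference_def content_poly_zero)
next
  case (q_poly_q_fun m' k d)
  show ?case
  proof (cases "m' = m")
    case True
    let ?F = "\<lambda>(\<kappa> :: int_partition) c :: int. ((of_int c + 1) ^ k - of_int c ^ k) + ((of_int c + (-1)) ^ k - of_int c ^ k :: 'a)"
    have "content_poly t k ?F"
      by (intro content_poly_add content_poly_power_diff)
    then have "content_poly t d ?F" using q_poly_q_fun by (auto intro: content_poly_mono)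
    moreover have "has_difference t \<mu> m (\<lambda>\<kappa>. of_int (q_fun k (t_quotient t m' \<kappa>))) ?F"
      using True by (auto simp: has_difference_def adds_quotient_box_def q_fun_add_box)
    ultimately show ?thesis by blast
  next
    case False
    then show ?thesis using q_poly_q_fun
      by (intro exI[of _ "\<lambda>_ _. 0"])
        (auto simp: has_difference_def adds_quotient_box_def content_poly_zero)
  qed
next
  case (q_poly_add d f g)
  then obtain F H where "content_poly t d F" "has_difference t \<mu> m f F"
    "content_poly t d H" "has_difference t \<mu> m g H" by blast
  then show ?case
    by (intro exI[of _ "\<lambda>\<kappa> c. F \<kappa> c + H \<kappa> c"]) (auto simp: has_difference_def content_poly_add)
next
  case (q_poly_mult d f e g n)
  then obtain F H where F: "content_poly t d F" "has_difference t \<mu> m f F"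
    and H: "content_poly t e H" "has_difference t \<mu> m g H" by blast
  let ?P = "\<lambda>\<kappa> c. F \<kappa> c * g \<kappa> + H \<kappa> c * f \<kappa> + F \<kappa> c * H \<kappa> c"
  have "content_poly t (d + e) ?P"
    using content_poly_mult_q_poly[OF F(1) q_poly_mult(2)] content_poly_mult_q_poly[OF H(1) q_poly_mult(1)]
      content_poly_mult[OF F(1) H(1)] by (intro content_poly_add) (simp_all add: add.commute)
  then have "content_poly t n ?P" using q_poly_mult(3) by (rule content_poly_mono)
  moreover have "has_difference t \<mu> m (\<lambda>\<kappa>. f \<kappa> * g \<kappa>) ?P"
    using F(2) H(2) by (auto simp: has_difference_def algebra_simps)
  ultimately show ?case by blast
qed

text \<open>The bound \<open>d\<close> is not related to any degree of \<open>g\<close>, which is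
  why admissible factors are not handled by degree but removed one after another.\<close>

lemma admissible_difference:
  assumes "admissible t \<mu> g" "m < t"
  shows "\<exists>d F. content_poly t d F \<and> has_difference t \<mu> m g F"
proof -
  from assms obtain s' \<eta> where \<eta>: "\<forall>s \<le> s'. q_linear_combination t (\<eta> s)" and
    g: "\<forall>\<kappa> \<kappa>' b. core_of t \<kappa> = \<mu> \<and> core_of t \<kappa>' = \<mu> \<and>
       (\<forall>j < t. j \<noteq> m \<longrightarrow> t_quotient t j \<kappa>' = t_quotient t j \<kappa>) \<and>
       b \<notin> diagram (t_quotient t m \<kappa>) \<and>
       diagram (t_quotient t m \<kappa>') = insert b (diagram (t_quotient t m \<kappa>)) \<longrightarrow>
       g \<kappa>' - g \<kappa> = (\<Sum>s \<le> s'. \<eta> s \<kappa> * of_int (content b) ^ s)"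
    unfolding admissible_def by blast
  have "\<exists>d. \<forall>s \<in> {..s'}. q_poly t d (\<eta> s)"
    by (rule q_poly_common_degree) (use q_linear_combination_imp_q_poly \<eta> in blast)+
  then obtain d where d: "\<And>s. s \<le> s' \<Longrightarrow> q_poly t d (\<eta> s)"
    by blast
  have "content_poly t (Suc (d + s')) (\<lambda>\<kappa> c. \<Sum>s \<le> s'. \<eta> s \<kappa> * of_int c ^ s)"
    by (intro content_poly_sum content_poly_term[OF d]) auto
  moreover have "has_difference t \<mu> m g (\<lambda>\<kappa> c. \<Sum>s \<le> s'. \<eta> s \<kappa> * of_int c ^ s)"
    unfolding has_difference_def adds_quotient_box_def
  proof (intro allI impI, elim conjE exE)
    fix \<kappa> \<kappa>' c b
    assume "core_of t \<kappa> = \<mu>" "core_of t \<kappa>' = core_of t \<kappa>"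
      "\<forall>j < t. j \<noteq> m \<longrightarrow> t_quotient t j \<kappa>' = t_quotient t j \<kappa>"
      "b \<notin> diagram (t_quotient t m \<kappa>)"
      "diagram (t_quotient t m \<kappa>') = insert b (diagram (t_quotient t m \<kappa>))" and c: "content b = c"
    then have "g \<kappa>' - g \<kappa> = (\<Sum>s \<le> s'. \<eta> s \<kappa> * of_int (content b) ^ s)"
      by (intro g[rule_format] conjI) simp_all
    then show "g \<kappa>' = g \<kappa> + (\<Sum>s \<le> s'. \<eta> s \<kappa> * of_int c ^ s)"
      unfolding c by (simp add: algebra_simps)
  qed
  ultimately show ?thesis by blast
qed

section \<open>The difference operator\<close>

text \<open>Expectation of \<open>F\<close> under the transition measure of the \<open>m\<close>-th
  quotient.\<close>

definition average ::
  "nat \<Rightarrow> nat \<Rightarrow> (int_partition \<Rightarrow> int \<Rightarrow> 'a :: field_char_0) \<Rightarrow> int_partition \<Rightarrow> 'a" where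
  "average t m F \<kappa> =
     (\<Sum>c \<in> addable_contents (t_quotient t m \<kappa>). add_weight (t_quotient t m \<kappa>) c * F \<kappa> c)"

lemma average_add: "average t m (\<lambda>\<kappa> c. F \<kappa> c + H \<kappa> c) \<kappa> = average t m F \<kappa> + average t m H \<kappa>"
  by (simp add: average_def distrib_left sum.distrib)

lemma average_mult: "average t m (\<lambda>\<kappa> c. f \<kappa> * F \<kappa> c) \<kappa> = f \<kappa> * average t m F \<kappa>"
  by (simp add: average_def sum_distrib_left mult_ac)

lemma average_sum: "average t m (\<lambda>\<kappa> c. \<Sum>x \<in> A. F x \<kappa> c) \<kappa> = (\<Sum>x \<in> A. average t m (F x) \<kappa>)"
  unfolding average_def sum_distrib_left by (rule sum.swap)

lemma average_power: "average t m (\<lambda>\<kappa> c. of_int c ^ s) \<kappa> = add_moment s (t_quotient t m \<kappa>)"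
  by (simp add: average_def add_moment_def)

text \<open>Strong induction along the Newton recursion: the \<open>j\<close>-th moment and
  \<open>q_fun (n - j)\<close> have weights adding up to \<open>n\<close>, and characteristic 0
  permits the division by \<open>n\<close>.\<close>

lemma q_poly_add_moment:
  assumes "m < t"
  shows "q_poly t n (\<lambda>\<kappa>. add_moment n (t_quotient t m \<kappa>) :: 'a :: field_char_0)"
proof (induction n rule: less_induct)
  case (less n)
  show ?case
  proof (cases n)
    case 0
    then show ?thesis by (simp add: add_moment_rec(1) q_poly_const)
  next
    case (Suc k)
    have "q_poly t n (\<lambda>\<kappa>. add_moment j (t_quotient t m \<kappa>) * of_int (q_fun (Suc (k - j)) (t_quotient t m \<kappa>)) :: 'a)"
      if "j \<in> {0..k}" for j
      by (rule q_poly_mult[OF less q_poly_q_fun[OF assms order_refl]]) (use that Suc in auto)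
    then have "q_poly t n (\<lambda>\<kappa>. \<Sum>j = 0..k. add_moment j (t_quotient t m \<kappa>) *
        of_int (q_fun (Suc (k - j)) (t_quotient t m \<kappa>)) :: 'a)"
      by (rule q_poly_sum)
    from q_poly_mult[OF q_poly_const[of t 0 "1 / of_nat n"] this, of n]
    show ?thesis
      unfolding Suc add_moment_rec(2)[symmetric] by (simp del: of_nat_Suc)
  qed
qed

text \<open>A hook can be added where a 0 is followed, \<open>t\<close> places later, by a 1;
  writing the place as \<open>t * j + m\<close> turns the hook into a box to be added to quotient
  \<open>m\<close>.\<close>

lemma adds_hook_bij:
  assumes "t > 0"
  obtains h where
    "bij_betw h (SIGMA m:{..<t}. addable_contents (t_quotient t m \<kappa>)) {\<kappa>'. adds_hook t \<kappa> \<kappa>'}"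
    "\<And>m c. m < t \<Longrightarrow> c \<in> addable_contents (t_quotient t m \<kappa>) \<Longrightarrow> adds_quotient_box t m \<kappa> (h (m, c)) c"
proof -
  let ?S = "SIGMA m:{..<t}. addable_contents (t_quotient t m \<kappa>)"
  let ?d = "\<lambda>m. quotient_shift t m \<kappa>"
  \<comment> \<open>The box of content \<open>c\<close> swaps the indices \<open>c - 1\<close> and
    \<open>c\<close> of the quotient; \<open>pos\<close> is where \<open>c - 1\<close> sits in the
    whole sequence.\<close>
  define pos where "pos = (\<lambda>(m, c). int t * (c - 1 - ?d m) + int m)"
  define I where "I = {i. edge \<kappa> i = 0 \<and> edge \<kappa> (i + int t) = 1}"
  define sw where "sw = (\<lambda>i. SOME \<kappa>'. edge \<kappa>' = (edge \<kappa>)(i := 1, i + int t := 0))"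
  have sw: "edge (sw i) = (edge \<kappa>)(i := 1, i + int t := 0)" if "i \<in> I" for i
  proof -
    have "edge \<kappa> i = 0" "edge \<kappa> (i + int t) = 1"
      using that by (simp_all add: I_def)
    from add_hook_edge[OF assms this] have "\<exists>\<kappa>'. edge \<kappa>' = (edge \<kappa>)(i := 1, i + int t := 0)"
      by metis
    then show ?thesis unfolding sw_def by (rule someI_ex)
  qed
  have e: "edge \<kappa> (pos (m, c)) = edge (t_quotient t m \<kappa>) (c - 1)"
    "edge \<kappa> (pos (m, c) + int t) = edge (t_quotient t m \<kappa>) c" if "m < t" for m c
  proof -
    show "edge \<kappa> (pos (m, c)) = edge (t_quotient t m \<kappa>) (c - 1)"
      using edge_quotient[OF assms that, of \<kappa> "c - 1 - ?d m"] by (simp add: pos_def)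
    have "pos (m, c) + int t = int t * (c - ?d m) + int m"
      by (simp add: pos_def algebra_simps)
    then show "edge \<kappa> (pos (m, c) + int t) = edge (t_quotient t m \<kappa>) c"
      using edge_quotient[OF assms that, of \<kappa> "c - ?d m"] by simp
  qed
  have md: "pos (m, c) mod int t = int m" "pos (m, c) div int t = c - 1 - ?d m" if "m < t" for m c
    using that assms by (simp_all add: pos_def)
  have bij1: "bij_betw pos ?S I"
  proof (rule bij_betwI[where g = "\<lambda>i. (nat (i mod int t), i div int t + 1 + ?d (nat (i mod int t)))"])
    show "pos \<in> ?S \<rightarrow> I"
      using e by (auto simp: I_def addable_contents_def)
    show "(nat (pos p mod int t), pos p div int t + 1 + ?d (nat (pos p mod int t))) = p" if "p \<in> ?S" for p
      using that by (cases p) (simp add: md)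
    have inv: "pos (nat (i mod int t), i div int t + 1 + ?d (nat (i mod int t))) = i" for i
      using assms by (simp add: pos_def)
    then show "pos (nat (i mod int t), i div int t + 1 + ?d (nat (i mod int t))) = i" if "i \<in> I" for i .
    show "(\<lambda>i. (nat (i mod int t), i div int t + 1 + ?d (nat (i mod int t)))) \<in> I \<rightarrow> ?S"
    proof
      fix i assume i: "i \<in> I"
      have m: "nat (i mod int t) < t" using assms by (simp add: nat_less_iff)
      show "(nat (i mod int t), i div int t + 1 + ?d (nat (i mod int t))) \<in> ?S"
        using i m e[OF m, of "i div int t + 1 + ?d (nat (i mod int t))"]
        unfolding inv by (simp add: I_def addable_contents_def)
    qed
  qed
  have "bij_betw sw I {\<kappa>'. adds_hook t \<kappa> \<kappa>'}"
    unfolding bij_betw_def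
  proof
    show "inj_on sw I"
    proof (rule inj_onI)
      fix i j assume ij: "i \<in> I" "j \<in> I" "sw i = sw j"
      then have "((edge \<kappa>)(i := 1, i + int t := 0)) i = ((edge \<kappa>)(j := 1, j + int t := 0)) i"
        using sw by metis
      then show "i = j"
        using ij(1) assms by (auto simp: I_def split: if_splits)
    qed
    show "sw ` I = {\<kappa>'. adds_hook t \<kappa> \<kappa>'}"
    proof (intro equalityI subsetI)
      fix \<kappa>' assume "\<kappa>' \<in> {\<kappa>'. adds_hook t \<kappa> \<kappa>'}"
      then obtain i where i: "i \<in> I" "edge \<kappa>' = (edge \<kappa>)(i := 1, i + int t := 0)"
        unfolding adds_hook_iff I_def by blast
      then have "\<kappa>' = sw i" using sw[OF i(1)] by (simp add: edge_inject[symmetric])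
      with i show "\<kappa>' \<in> sw ` I" by blast
    next
      fix \<kappa>' assume "\<kappa>' \<in> sw ` I"
      then show "\<kappa>' \<in> {\<kappa>'. adds_hook t \<kappa> \<kappa>'}"
        unfolding adds_hook_iff using sw by (auto simp: I_def)
    qed
  qed
  from bij_betw_trans[OF bij1 this] have bij: "bij_betw (sw \<circ> pos) ?S {\<kappa>'. adds_hook t \<kappa> \<kappa>'}" .
  have "adds_quotient_box t m \<kappa> ((sw \<circ> pos) (m, c)) c"
    if m: "m < t" and c: "c \<in> addable_contents (t_quotient t m \<kappa>)" for m c
  proof -
    define i where "i = pos (m, c)"
    define \<kappa>' where "\<kappa>' = sw i"
    have S: "(m, c) \<in> ?S" using m c by simp
    have "i \<in> I" using bij_betwE[OF bij1] S unfolding i_def by blast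
    then have i: "edge \<kappa> i = 0" "edge \<kappa> (i + int t) = 1" "edge \<kappa>' = (edge \<kappa>)(i := 1, i + int t := 0)"
      using sw by (auto simp: I_def \<kappa>'_def)
    have im: "int m = i mod int t" and id: "i div int t + ?d m + 1 = c"
      using md[OF m] by (simp_all add: i_def)
    obtain \<rho>' b where \<rho>': "\<And>j. edge \<kappa>' (int t * j + int m) = edge \<rho>' (j + ?d m)"
      "edge \<rho>' = (edge (t_quotient t m \<kappa>))(i div int t + ?d m := 1, i div int t + ?d m + 1 := 0)"
      "b \<notin> diagram (t_quotient t m \<kappa>)" "diagram \<rho>' = insert b (diagram (t_quotient t m \<kappa>))"
      "content b = i div int t + ?d m + 1"
      using adds_hook_quotient[OF assms m i edge_quotient[OF assms m] im] by metis
    have q: "t_quotient t m \<kappa>' = \<rho>'" using \<rho>'(1) by (rule quotient_eqI)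
    have "t_quotient t j \<kappa>' = t_quotient t j \<kappa>" if j: "j < t" "j \<noteq> m" for j
    proof (rule quotient_eqI)
      fix n
      have "int j \<noteq> i mod int t" using j im by simp
      then show "edge \<kappa>' (int t * n + int j) = edge (t_quotient t j \<kappa>) (n + ?d j)"
        using subword_adds_hook[OF assms j(1) i(3)] edge_quotient[OF assms j(1)] by simp
    qed
    moreover have "core_of t \<kappa>' = core_of t \<kappa>"
      by (rule core_of_adds_hook[OF assms]) (use i in \<open>auto simp: adds_hook_iff\<close>)
    moreover have "i div int t + ?d m = c - 1" using id by simp
    moreover have "\<exists>b. b \<notin> diagram (t_quotient t m \<kappa>) \<and>
        diagram \<rho>' = insert b (diagram (t_quotient t m \<kappa>)) \<and> content b = c"
      using \<rho>'(3-5) id by metis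
    ultimately show ?thesis
      using \<rho>'(2) c unfolding adds_quotient_box_def comp_def i_def[symmetric] \<kappa>'_def[symmetric] q id
      by simp
  qed
  with bij show ?thesis by (rule that)
qed

lemma finite_adds_hook:
  assumes "t > 0"
  shows "finite {\<kappa>'. adds_hook t \<kappa> \<kappa>'}"
proof -
  obtain h where "bij_betw h (SIGMA m:{..<t}. addable_contents (t_quotient t m \<kappa>)) {\<kappa>'. adds_hook t \<kappa> \<kappa>'}"
    using adds_hook_bij[OF assms] by metis
  moreover have "finite (SIGMA m:{..<t}. addable_contents (t_quotient t m \<kappa>))"
    by (simp add: finite_contents)
  ultimately show ?thesis using bij_betw_finite by blast
qed

lemma G_hook_adds_quotient_box:
  assumes "t > 0" "m < t" "adds_quotient_box t m \<kappa> \<kappa>' c"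
  shows "G_hook t \<kappa>' = G_hook t \<kappa> * (add_weight (t_quotient t m \<kappa>) c / of_nat t :: 'a :: field_char_0)"
proof -
  let ?s = "\<lambda>\<kappa> m. scaled_hook_product t (t_quotient t m \<kappa>) :: 'a"
  have split: "(\<Prod>j < t. ?s \<kappa> j) = ?s \<kappa> m * (\<Prod>j \<in> {..<t} - {m}. ?s \<kappa> j)" for \<kappa>
    using assms(2) by (intro prod.remove) auto
  have "(\<Prod>j \<in> {..<t} - {m}. ?s \<kappa>' j) = (\<Prod>j \<in> {..<t} - {m}. ?s \<kappa> j)"
    using assms(3) by (intro prod.cong) (auto simp: adds_quotient_box_def)
  moreover have "add_weight (t_quotient t m \<kappa>) c / of_nat t = ?s \<kappa> m / ?s \<kappa>' m"
    using assms by (intro scaled_hook_product_add_box[symmetric]) (auto simp: adds_quotient_box_def)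
  moreover have "?s \<kappa> m \<noteq> 0" "?s \<kappa>' m \<noteq> 0"
    by (rule scaled_hook_product_nonzero[OF assms(1)])+
  ultimately show ?thesis
    unfolding G_hook_quotients[OF assms(1)] split by simp
qed

text \<open>Each of the \<open>t\<close> quotients has total weight \<open>1 / t\<close>, so the
  unchanged part \<open>f \<kappa>\<close> is reproduced and cancels with the subtracted term; only
  the averaged changes remain.\<close>

lemma D_hook_G_mult:
  assumes "t > 0" "core_of t \<kappa> = \<mu>" and F: "\<And>m. m < t \<Longrightarrow> has_difference t \<mu> m f (F m)"
  shows "D_hook t (\<lambda>\<kappa>. G_hook t \<kappa> * f \<kappa>) \<kappa> =
    G_hook t \<kappa> * (1 / of_nat t * (\<Sum>m < t. average t m (F m) \<kappa>) :: 'a :: field_char_0)"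
proof -
  let ?w = "\<lambda>m c. add_weight (t_quotient t m \<kappa>) c :: 'a"
  let ?A = "\<lambda>m. addable_contents (t_quotient t m \<kappa>)"
  let ?S = "SIGMA m:{..<t}. ?A m"
  obtain h where bij: "bij_betw h ?S {\<kappa>'. adds_hook t \<kappa> \<kappa>'}" and
    h: "\<And>m c. m < t \<Longrightarrow> c \<in> ?A m \<Longrightarrow> adds_quotient_box t m \<kappa> (h (m, c)) c"
    using adds_hook_bij[OF assms(1)] by metis
  have "(\<Sum>\<kappa>' \<in> {\<kappa>'. adds_hook t \<kappa> \<kappa>'}. G_hook t \<kappa>' * f \<kappa>') = (\<Sum>p \<in> ?S. G_hook t (h p) * f (h p))"
    by (rule sum.reindex_bij_betw[OF bij, symmetric])
  also have "\<dots> = (\<Sum>(m, c) \<in> ?S. G_hook t \<kappa> * (?w m c / of_nat t) * (f \<kappa> + F m \<kappa> c))"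
  proof (rule sum.cong)
    fix p assume "p \<in> ?S"
    then obtain m c where p: "p = (m, c)" "m < t" "c \<in> ?A m" by auto
    have "f (h p) = f \<kappa> + F m \<kappa> c"
      using F[OF p(2)] h[OF p(2,3)] assms(2) unfolding has_difference_def p(1) by blast
    then show "G_hook t (h p) * f (h p) = (case p of (m, c) \<Rightarrow> G_hook t \<kappa> * (?w m c / of_nat t) * (f \<kappa> + F m \<kappa> c))"
      using G_hook_adds_quotient_box[OF assms(1) p(2) h[OF p(2,3)], where 'a = 'a] p(1) by simp
  qed simp
  also have "\<dots> = (\<Sum>m < t. \<Sum>c \<in> ?A m. G_hook t \<kappa> * (?w m c / of_nat t) * (f \<kappa> + F m \<kappa> c))"
    by (subst sum.Sigma) (auto simp: finite_contents)
  also have "\<dots> = (\<Sum>m < t. G_hook t \<kappa> / of_nat t * (f \<kappa> * add_moment 0 (t_quotient t m \<kappa>) + average t m (F m) \<kappa>))"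
    by (intro sum.cong refl)
      (simp add: add_moment_def average_def sum_distrib_left distrib_left sum.distrib mult_ac add_divide_distrib)
  also have "\<dots> = G_hook t \<kappa> / of_nat t * (of_nat t * f \<kappa> + (\<Sum>m < t. average t m (F m) \<kappa>))"
    by (simp only: add_moment_rec(1) mult_1_right sum_distrib_left[symmetric] sum.distrib
        sum_constant card_lessThan)
  finally show ?thesis
    using assms(1) by (simp add: D_hook_def field_simps)
qed

section \<open>Local nilpotency of the difference operator\<close>

lemma D_hook_cong:
  assumes "\<And>\<kappa>'. adds_hook t \<kappa> \<kappa>' \<Longrightarrow> u \<kappa>' = v \<kappa>'" "u \<kappa> = v \<kappa>"
  shows "D_hook t u \<kappa> = D_hook t v \<kappa>"
  unfolding D_hook_def assms(2) using assms(1) by (intro arg_cong2[of _ _ _ _ minus] sum.cong) auto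

lemma D_hook_pow_cong:
  assumes "t > 0" "\<And>\<kappa>. core_of t \<kappa> = \<mu> \<Longrightarrow> u \<kappa> = v \<kappa>" "core_of t \<kappa> = \<mu>"
  shows "(D_hook t ^^ r) u \<kappa> = (D_hook t ^^ r) v \<kappa>"
  using assms(3)
proof (induction r arbitrary: \<kappa>)
  case (Suc r)
  then have "(D_hook t ^^ r) u \<kappa>' = (D_hook t ^^ r) v \<kappa>'" if "adds_hook t \<kappa> \<kappa>'" for \<kappa>'
    using core_of_adds_hook[OF assms(1) that] by simp
  with Suc have "D_hook t ((D_hook t ^^ r) u) \<kappa> = D_hook t ((D_hook t ^^ r) v) \<kappa>"
    by (intro D_hook_cong) auto
  then show ?case by simp
qed (use assms in simp)

lemma D_hook_pow_zero: "(D_hook t ^^ r) (\<lambda>_. 0) = (\<lambda>_. 0)"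
  by (induction r) (simp_all add: D_hook_def)

lemma D_hook_pow_add:
  "(D_hook t ^^ r) (\<lambda>\<kappa>. u \<kappa> + v \<kappa>) = (\<lambda>\<kappa>. (D_hook t ^^ r) u \<kappa> + (D_hook t ^^ r) v \<kappa>)"
  by (induction r) (simp_all add: D_hook_def sum.distrib fun_eq_iff)

lemma D_hook_pow_mult:
  "(D_hook t ^^ r) (\<lambda>\<kappa>. a * u \<kappa>) = (\<lambda>\<kappa>. a * (D_hook t ^^ r) u \<kappa>)"
  by (induction r) (simp_all add: D_hook_def sum_distrib_left right_diff_distrib fun_eq_iff)

text \<open>One exponent must serve all partitions with core \<open>\<mu>\<close>. The factor
  \<open>G_hook\<close> is built in because \<open>D_hook\<close> preserves the form
  \<open>G_hook * f\<close>.\<close>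

definition D_nilpotent :: "nat \<Rightarrow> int_partition \<Rightarrow> (int_partition \<Rightarrow> 'a :: field_char_0) \<Rightarrow> bool" where
  "D_nilpotent t \<mu> f \<longleftrightarrow>
     (\<exists>r. \<forall>\<kappa>. core_of t \<kappa> = \<mu> \<longrightarrow> (D_hook t ^^ r) (\<lambda>\<kappa>. G_hook t \<kappa> * f \<kappa>) \<kappa> = 0)"

lemma D_hook_pow_zero_mono:
  assumes "t > 0" "\<And>\<kappa>. core_of t \<kappa> = \<mu> \<Longrightarrow> (D_hook t ^^ r) u \<kappa> = 0" "r \<le> s" "core_of t \<kappa> = \<mu>"
  shows "(D_hook t ^^ s) u \<kappa> = 0"
proof -
  have "(D_hook t ^^ s) u = (D_hook t ^^ (s - r)) ((D_hook t ^^ r) u)"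
    using assms(3) by (simp add: funpow_add[symmetric, THEN fun_cong, unfolded comp_def])
  moreover have "(D_hook t ^^ (s - r)) ((D_hook t ^^ r) u) \<kappa> = (D_hook t ^^ (s - r)) (\<lambda>_. 0) \<kappa>"
    using assms by (intro D_hook_pow_cong[of t \<mu>]) auto
  ultimately show ?thesis by (simp add: D_hook_pow_zero)
qed

lemma D_nilpotent_zero: "D_nilpotent t \<mu> (\<lambda>_. 0)"
  unfolding D_nilpotent_def by (rule exI[of _ 0]) simp

lemma D_nilpotent_add:
  assumes "t > 0" "D_nilpotent t \<mu> f" "D_nilpotent t \<mu> g"
  shows "D_nilpotent t \<mu> (\<lambda>\<kappa>. f \<kappa> + g \<kappa>)"
proof -
  obtain r where r: "\<And>\<kappa>. core_of t \<kappa> = \<mu> \<Longrightarrow> (D_hook t ^^ r) (\<lambda>\<kappa>. G_hook t \<kappa> * f \<kappa>) \<kappa> = 0"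
    using assms(2) unfolding D_nilpotent_def by blast
  obtain s where s: "\<And>\<kappa>. core_of t \<kappa> = \<mu> \<Longrightarrow> (D_hook t ^^ s) (\<lambda>\<kappa>. G_hook t \<kappa> * g \<kappa>) \<kappa> = 0"
    using assms(3) unfolding D_nilpotent_def by blast
  show ?thesis
    unfolding D_nilpotent_def distrib_left D_hook_pow_add
    using D_hook_pow_zero_mono[OF assms(1) r, where s = "max r s"] D_hook_pow_zero_mono[OF assms(1) s, where s = "max r s"]
    by (intro exI[of _ "max r s"]) simp
qed

lemma D_nilpotent_mult:
  assumes "D_nilpotent t \<mu> f"
  shows "D_nilpotent t \<mu> (\<lambda>\<kappa>. a * f \<kappa>)"
  using assms unfolding D_nilpotent_def mult.left_commute[of _ a] D_hook_pow_mult by auto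

lemma D_nilpotent_sum:
  assumes "t > 0" "\<And>x. x \<in> A \<Longrightarrow> D_nilpotent t \<mu> (f x)"
  shows "D_nilpotent t \<mu> (\<lambda>\<kappa>. \<Sum>x \<in> A. f x \<kappa>)"
  using assms(2)
  by (induction A rule: infinite_finite_induct)
    (simp_all add: D_nilpotent_zero D_nilpotent_add[OF assms(1)])

lemma D_nilpotent_step:
  assumes "t > 0" "D_nilpotent t \<mu> h"
    "\<And>\<kappa>. core_of t \<kappa> = \<mu> \<Longrightarrow> D_hook t (\<lambda>\<kappa>. G_hook t \<kappa> * f \<kappa>) \<kappa> = G_hook t \<kappa> * h \<kappa>"
  shows "D_nilpotent t \<mu> f"
proof -
  obtain r where r: "\<And>\<kappa>. core_of t \<kappa> = \<mu> \<Longrightarrow> (D_hook t ^^ r) (\<lambda>\<kappa>. G_hook t \<kappa> * h \<kappa>) \<kappa> = 0"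
    using assms(2) unfolding D_nilpotent_def by blast
  have "(D_hook t ^^ Suc r) (\<lambda>\<kappa>. G_hook t \<kappa> * f \<kappa>) \<kappa> = 0" if "core_of t \<kappa> = \<mu>" for \<kappa>
    unfolding funpow_Suc_right comp_def
    using D_hook_pow_cong[OF assms(1,3) that] r[OF that] by simp
  then show ?thesis unfolding D_nilpotent_def by blast
qed

text \<open>Averaging replaces \<open>c ^ s\<close> by the \<open>s\<close>-th moment, of weight
  \<open>s\<close>. A strict bound \<open>d\<close> thus yields terms of degree less than
  \<open>d\<close>, while \<open>p\<close>, being independent of \<open>c\<close>, is carried
  along.\<close>

lemma D_nilpotent_average:
  assumes t: "t > 0" and m: "m < t" and F: "content_poly t d F"
    and "\<And>e h. e < d \<Longrightarrow> q_poly t e h \<Longrightarrow> D_nilpotent t \<mu> (\<lambda>\<kappa>. p \<kappa> * h \<kappa>)"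
  shows "D_nilpotent t \<mu> (\<lambda>\<kappa>. p \<kappa> * average t m F \<kappa>)"
  using F assms(4)
proof (induction rule: content_poly.induct)
  case content_poly_zero
  then show ?case by (simp add: average_def D_nilpotent_zero)
next
  case (content_poly_term e \<eta> s d)
  have "q_poly t (e + s) (\<lambda>\<kappa>. \<eta> \<kappa> * add_moment s (t_quotient t m \<kappa>))"
    by (rule q_poly_mult[OF content_poly_term(1) q_poly_add_moment[OF m]]) simp
  from content_poly_term(3)[OF content_poly_term(2) this] show ?case
    by (simp add: average_mult average_power)
next
  case (content_poly_add d F H)
  then show ?case
    unfolding average_add distrib_left
    by (intro D_nilpotent_add[OF t] content_poly_add.IH(1)[OF content_poly_add.prems]
        content_poly_add.IH(2)[OF content_poly_add.prems])
qed

text \<open>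
  Induction on the set of admissible factors and then on the degree of the polynomial in the
  functions \<open>q\<close>: expanding the difference of the product, every term either loses a factor
  or keeps them all and has a polynomial of smaller degree.
\<close>

lemma D_nilpotent_prod_admissible:
  fixes g :: "'u \<Rightarrow> int_partition \<Rightarrow> 'a :: field_char_0"
  assumes t: "t > 0" and "finite A" "\<And>u. u \<in> A \<Longrightarrow> admissible t \<mu> (g u)" "q_poly t d f"
  shows "D_nilpotent t \<mu> (\<lambda>\<kappa>. (\<Prod>u \<in> A. g u \<kappa>) * f \<kappa>)"
  using assms(2-)
proof (induction A arbitrary: d f rule: finite_psubset_induct)
  case (psubset A)
  show ?case
    using psubset.prems(2)
  proof (induction d arbitrary: f rule: less_induct)
    case (less d)
    have "\<forall>m. \<exists>F. content_poly t d F \<and> has_difference t \<mu> m f F"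
      using q_poly_difference[OF less.prems] by blast
    then obtain F where F: "\<And>m. content_poly t d (F m)" "\<And>m. has_difference t \<mu> m f (F m)"
      by metis
    have "\<forall>u m. \<exists>d H. u \<in> A \<longrightarrow> m < t \<longrightarrow> content_poly t d H \<and> has_difference t \<mu> m (g u) H"
      using admissible_difference psubset.prems(1) by blast
    then obtain e H where H: "\<And>u m. u \<in> A \<Longrightarrow> m < t \<Longrightarrow> content_poly t (e u m) (H u m)"
      "\<And>u m. u \<in> A \<Longrightarrow> m < t \<Longrightarrow> has_difference t \<mu> m (g u) (H u m)"
      by metis
    \<comment> \<open>\<open>B\<close> collects the factors left as they are; the others contribute
      their change, and \<open>f\<close> enters with its new value.\<close>
    define R where "R = (\<lambda>B m \<kappa> c. (\<Prod>u \<in> A - B. H u m \<kappa> c) * (f \<kappa> + F m \<kappa> c))"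
    define L where "L = (\<lambda>m \<kappa> c. (\<Prod>u \<in> A. g u \<kappa>) * F m \<kappa> c + (\<Sum>B \<in> Pow A - {A}. (\<Prod>u \<in> B. g u \<kappa>) * R B m \<kappa> c))"
    have L: "has_difference t \<mu> m (\<lambda>\<kappa>. (\<Prod>u \<in> A. g u \<kappa>) * f \<kappa>) (L m)" if m: "m < t" for m
      unfolding has_difference_def
    proof (intro allI impI)
      fix \<kappa> \<kappa>' c assume \<kappa>: "core_of t \<kappa> = \<mu>" "adds_quotient_box t m \<kappa> \<kappa>' c"
      have f: "f \<kappa>' = f \<kappa> + F m \<kappa> c"
        using F(2)[of m] \<kappa> unfolding has_difference_def by blast
      have "(\<Prod>u \<in> A. g u \<kappa>') = (\<Prod>u \<in> A. g u \<kappa> + H u m \<kappa> c)"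
        using H(2)[OF _ m] \<kappa> unfolding has_difference_def by (intro prod.cong refl) blast
      also have "\<dots> = (\<Sum>B \<in> Pow A. (\<Prod>u \<in> B. g u \<kappa>) * (\<Prod>u \<in> A - B. H u m \<kappa> c))"
        by (rule prod_add[OF psubset.hyps(1)])
      also have "\<dots> = (\<Prod>u \<in> A. g u \<kappa>) + (\<Sum>B \<in> Pow A - {A}. (\<Prod>u \<in> B. g u \<kappa>) * (\<Prod>u \<in> A - B. H u m \<kappa> c))"
        using psubset.hyps(1) by (subst sum.remove[of _ A]) auto
      finally show "(\<Prod>u \<in> A. g u \<kappa>') * f \<kappa>' = (\<Prod>u \<in> A. g u \<kappa>) * f \<kappa> + L m \<kappa> c"
        unfolding f by (simp add: L_def R_def distrib_left distrib_right sum_distrib_right sum.distrib mult.assoc)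
    qed
    \<comment> \<open>All factors are kept: the change of \<open>f\<close> has the strict bound
      \<open>d\<close>, so its average falls under the inner induction.\<close>
    have "D_nilpotent t \<mu> (\<lambda>\<kappa>. (\<Prod>u \<in> A. g u \<kappa>) * average t m (F m) \<kappa>)" if "m < t" for m
      using less.IH by (intro D_nilpotent_average[OF t that F(1)])
    \<comment> \<open>For a proper subset \<open>B\<close> the outer induction hypothesis covers
      every degree, so the size of \<open>d1 + Suc d\<close> does not matter.\<close>
    moreover have "D_nilpotent t \<mu> (\<lambda>\<kappa>. (\<Prod>u \<in> B. g u \<kappa>) * average t m (R B m) \<kappa>)"
      if m: "m < t" and B: "B \<in> Pow A - {A}" for m B
    proof -
      obtain d1 where d1: "content_poly t d1 (\<lambda>\<kappa> c. \<Prod>u \<in> A - B. H u m \<kappa> c)"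
        using content_poly_prod[of "A - B" t "\<lambda>u. H u m"] H(1)[OF _ m] by blast
      have "content_poly t (Suc d) (\<lambda>\<kappa> c. f \<kappa> + F m \<kappa> c)"
        by (intro content_poly_add content_poly_of_q_poly less.prems content_poly_mono[OF F(1)]) simp
      then have "content_poly t (d1 + Suc d) (R B m)"
        unfolding R_def by (rule content_poly_mult[OF d1])
      moreover have "D_nilpotent t \<mu> (\<lambda>\<kappa>. (\<Prod>u \<in> B. g u \<kappa>) * h \<kappa>)" if "q_poly t e h" for e h
        using psubset.IH[of B e h] B psubset.prems(1) that by blast
      ultimately show ?thesis by (intro D_nilpotent_average[OF t m]) auto
    qed
    ultimately have "D_nilpotent t \<mu> (\<lambda>\<kappa>. 1 / of_nat t * (\<Sum>m < t. average t m (L m) \<kappa>))"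
      unfolding L_def average_add average_sum average_mult
      by (intro D_nilpotent_mult D_nilpotent_sum D_nilpotent_add t) auto
    then show ?case
      by (rule D_nilpotent_step[OF t]) (rule D_hook_G_mult[OF t _ L])
  qed
qed

section \<open>Summation over a level\<close>

definition level :: "nat \<Rightarrow> int_partition \<Rightarrow> nat \<Rightarrow> int_partition set" where
  "level t \<mu> n = {\<kappa>. core_of t \<kappa> = \<mu> \<and> int (psize \<kappa>) - int (psize \<mu>) = int (n * t)}"

lemma hook_ge_same_psize:
  assumes "t > 0" "hook_ge t \<kappa> \<mu>" "psize \<kappa> = psize \<mu>"
  shows "\<kappa> = \<mu>"
  using assms(2) unfolding hook_ge_def
proof (cases rule: rtranclp.cases)
  case (rtrancl_into_rtrancl \<rho>)
  then have "hook_ge t \<rho> \<mu>" by (simp add: hook_ge_def)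
  then show ?thesis
    using psize_hook_ge[OF assms(1)] psize_adds_hook[OF assms(1) rtrancl_into_rtrancl(2)] assms(1,3)
    by fastforce
qed simp

text \<open>Translates the index set of \<open>F_hook\<close>: each hook adds \<open>t\<close>
  boxes, so a size difference of \<open>t\<close> leaves room for exactly one.\<close>

lemma hook_ge_psize_step:
  assumes "t > 0"
  shows "hook_ge t \<kappa> \<rho> \<and> psize \<kappa> = psize \<rho> + t \<longleftrightarrow> adds_hook t \<rho> \<kappa>"
proof
  assume *: "hook_ge t \<kappa> \<rho> \<and> psize \<kappa> = psize \<rho> + t"
  then have "(adds_hook t)\<^sup>*\<^sup>* \<rho> \<kappa>" by (simp add: hook_ge_def)
  then show "adds_hook t \<rho> \<kappa>"
  proof (cases rule: rtranclp.cases)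
    case rtrancl_refl
    then show ?thesis using * assms by simp
  next
    case (rtrancl_into_rtrancl \<sigma>)
    then have "psize \<sigma> = psize \<rho>"
      using psize_adds_hook[OF assms rtrancl_into_rtrancl(2)] * by simp
    then have "\<sigma> = \<rho>"
      using rtrancl_into_rtrancl by (intro hook_ge_same_psize[OF assms]) (simp_all add: hook_ge_def)
    then show ?thesis using rtrancl_into_rtrancl by simp
  qed
qed (auto simp: psize_adds_hook[OF assms] hook_ge_def)

text \<open>Irreducibility is the form of being a core on which \<open>core_of\<close> is built;
  \<open>is_core\<close> implies it.\<close>

locale core_partition =
  fixes t :: nat and \<mu> :: int_partition
  assumes t: "t > 0" and irreducible: "\<not> (\<exists>\<rho>. adds_hook t \<rho> \<mu>)"
begin

lemma core_of_iff: "core_of t \<kappa> = \<mu> \<longleftrightarrow> hook_ge t \<kappa> \<mu>"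
  using core_of_eqI[OF t _ irreducible] core_of_spec(1)[OF t] by metis

lemma core_of_core: "core_of t \<mu> = \<mu>"
  by (simp add: core_of_iff hook_ge_def)

lemma level_0: "level t \<mu> 0 = {\<mu>}"
  using hook_ge_same_psize[OF t] by (auto simp: level_def core_of_iff) (auto simp: hook_ge_def)

lemma core_notin_level: "\<mu> \<notin> level t \<mu> (Suc n)"
  using t by (auto simp: level_def simp del: of_nat_mult of_nat_add)

lemma level_adds_hook:
  assumes "\<kappa> \<in> level t \<mu> n" "adds_hook t \<kappa> \<kappa>'"
  shows "\<kappa>' \<in> level t \<mu> (Suc n)"
  using assms core_of_adds_hook[OF t assms(2)] psize_adds_hook[OF t assms(2)] by (simp add: level_def)

lemma level_pred:
  assumes "\<kappa> \<in> level t \<mu> (Suc n)" "adds_hook t \<rho> \<kappa>"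
  shows "\<rho> \<in> level t \<mu> n"
  using assms core_of_adds_hook[OF t assms(2)] psize_adds_hook[OF t assms(2)] by (simp add: level_def)

lemma level_Suc: "level t \<mu> (Suc n) = (\<Union>\<rho> \<in> level t \<mu> n. {\<kappa>. adds_hook t \<rho> \<kappa>})"
proof (intro equalityI subsetI)
  fix \<kappa> assume \<kappa>: "\<kappa> \<in> level t \<mu> (Suc n)"
  then have "(adds_hook t)\<^sup>*\<^sup>* \<mu> \<kappa>" "\<kappa> \<noteq> \<mu>"
    using core_notin_level by (auto simp: level_def core_of_iff hook_ge_def)
  then obtain \<rho> where "adds_hook t \<rho> \<kappa>" by (metis rtranclp.cases)
  then show "\<kappa> \<in> (\<Union>\<rho> \<in> level t \<mu> n. {\<kappa>. adds_hook t \<rho> \<kappa>})"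
    using level_pred[OF \<kappa>] by blast
qed (use level_adds_hook in blast)

lemma finite_level: "finite (level t \<mu> n)"
  by (induction n) (simp_all add: level_0 level_Suc finite_adds_hook[OF t])

lemma F_hook_level:
  assumes "\<kappa> \<in> level t \<mu> (Suc n)"
  shows "F_hook t \<kappa> \<mu> = (\<Sum>\<rho> \<in> {\<rho> \<in> level t \<mu> n. adds_hook t \<rho> \<kappa>}. F_hook t \<rho> \<mu>)"
proof -
  have "\<kappa> \<noteq> \<mu>" using assms core_notin_level by blast
  moreover have "hook_ge t \<rho> \<mu>" if "\<rho> \<in> level t \<mu> n" for \<rho>
    using that by (simp add: level_def core_of_iff)
  then have "{\<rho>. hook_ge t \<kappa> \<rho> \<and> hook_ge t \<rho> \<mu> \<and> psize \<kappa> = psize \<rho> + t} =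
    {\<rho> \<in> level t \<mu> n. adds_hook t \<rho> \<kappa>}"
    using level_pred[OF assms] hook_ge_psize_step[OF t] by blast
  ultimately show ?thesis by (subst F_hook.simps) simp
qed

definition level_sum :: "nat \<Rightarrow> (int_partition \<Rightarrow> 'a :: field_char_0) \<Rightarrow> 'a" where
  "level_sum n f = (\<Sum>\<kappa> \<in> level t \<mu> n. of_nat (F_hook t \<kappa> \<mu>) * f \<kappa>)"

lemma level_sum_0: "level_sum 0 f = f \<mu>"
  by (simp add: level_sum_def level_0 F_hook.simps)

text \<open>\<open>F_hook\<close> counts paths by their last step. Exchanging the sums over
  \<open>\<kappa>\<close> and its predecessors \<open>\<rho>\<close> leaves, for each
  \<open>\<rho>\<close>, the sum of \<open>f\<close> over all successors, which is
  \<open>f \<rho> + D_hook t f \<rho>\<close>.\<close>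

lemma level_sum_Suc: "level_sum (Suc n) f = level_sum n f + level_sum n (D_hook t f)"
proof -
  have "level_sum (Suc n) f =
    (\<Sum>\<kappa> \<in> level t \<mu> (Suc n). \<Sum>\<rho> \<in> {\<rho> \<in> level t \<mu> n. adds_hook t \<rho> \<kappa>}. of_nat (F_hook t \<rho> \<mu>) * f \<kappa>)"
    unfolding level_sum_def by (intro sum.cong refl) (simp add: F_hook_level sum_distrib_right)
  also have "\<dots> = (\<Sum>\<rho> \<in> level t \<mu> n. \<Sum>\<kappa> \<in> {\<kappa> \<in> level t \<mu> (Suc n). adds_hook t \<rho> \<kappa>}. of_nat (F_hook t \<rho> \<mu>) * f \<kappa>)"
    by (rule sum.swap_restrict) (simp_all add: finite_level)
  also have "\<dots> = (\<Sum>\<rho> \<in> level t \<mu> n. of_nat (F_hook t \<rho> \<mu>) * (f \<rho> + D_hook t f \<rho>))"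
  proof (intro sum.cong refl)
    fix \<rho> assume "\<rho> \<in> level t \<mu> n"
    then have "{\<kappa> \<in> level t \<mu> (Suc n). adds_hook t \<rho> \<kappa>} = {\<kappa>. adds_hook t \<rho> \<kappa>}"
      using level_adds_hook by blast
    then show "(\<Sum>\<kappa> \<in> {\<kappa> \<in> level t \<mu> (Suc n). adds_hook t \<rho> \<kappa>}. of_nat (F_hook t \<rho> \<mu>) * f \<kappa>) =
      of_nat (F_hook t \<rho> \<mu>) * (f \<rho> + D_hook t f \<rho>)"
      by (simp add: D_hook_def sum_distrib_left)
  qed
  also have "\<dots> = level_sum n f + level_sum n (D_hook t f)"
    by (simp add: level_sum_def distrib_left sum.distrib)
  finally show ?thesis .
qed

text \<open>Raising the level by one amounts to applying the operator \<open>1 + D\<close> to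
  \<open>f\<close>; its \<open>n\<close>-th power is expanded by the binomial theorem.\<close>

lemma level_sum_binomial: "level_sum n f = (\<Sum>k \<le> n. of_nat (n choose k) * (D_hook t ^^ k) f \<mu>)"
proof (induction n arbitrary: f)
  case 0
  then show ?case by (simp add: level_sum_0)
next
  case (Suc n)
  let ?a = "\<lambda>k. (D_hook t ^^ k) f \<mu>"
  have "level_sum (Suc n) f = (\<Sum>k \<le> n. of_nat (n choose k) * ?a k) + (\<Sum>k \<le> n. of_nat (n choose k) * ?a (Suc k))"
    unfolding level_sum_Suc Suc.IH by (simp add: funpow_swap1)
  also have "(\<Sum>k \<le> n. of_nat (n choose k) * ?a k) = (\<Sum>k \<le> Suc n. of_nat (n choose k) * ?a k)"
    by simp
  also have "\<dots> = ?a 0 + (\<Sum>k \<le> n. of_nat (n choose Suc k) * ?a (Suc k))"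
    by (subst sum.atMost_Suc_shift) simp
  also have "\<dots> + (\<Sum>k \<le> n. of_nat (n choose k) * ?a (Suc k)) =
      ?a 0 + (\<Sum>k \<le> n. of_nat (Suc n choose Suc k) * ?a (Suc k))"
    by (simp add: sum.distrib distrib_right add_ac)
  also have "\<dots> = (\<Sum>k \<le> Suc n. of_nat (Suc n choose k) * ?a k)"
    by (subst sum.atMost_Suc_shift) simp
  finally show ?case .
qed

lemma level_sum_poly:
  assumes "\<And>\<kappa>. core_of t \<kappa> = \<mu> \<Longrightarrow> (D_hook t ^^ r) f \<kappa> = 0"
  shows "\<exists>P. \<forall>n. poly P (of_nat n) = level_sum n f"
proof (intro exI allI)
  fix n
  \<comment> \<open>The binomial coefficient \<open>n choose k\<close> as a falling factorial in
    \<open>n\<close> divided by \<open>fact k\<close>.\<close>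
  let ?b = "\<lambda>k. smult ((D_hook t ^^ k) f \<mu> / fact k) (\<Prod>i = 0..<k. [:- of_nat i, 1:])"
  have "poly (\<Sum>k < r. ?b k) (of_nat n) = (\<Sum>k < r. of_nat (n choose k) * (D_hook t ^^ k) f \<mu>)"
    by (simp add: poly_sum poly_prod binomial_gbinomial gbinomial_prod_rev mult.commute)
  \<comment> \<open>A common range for both cut-offs: terms with \<open>k \<ge> r\<close> vanish by
    nilpotency, those with \<open>k > n\<close> because the binomial coefficient does.\<close>
  also have "\<dots> = (\<Sum>k < r + Suc n. of_nat (n choose k) * (D_hook t ^^ k) f \<mu>)"
  proof (rule sum.mono_neutral_left)
    show "\<forall>k \<in> {..<r + Suc n} - {..<r}. of_nat (n choose k) * (D_hook t ^^ k) f \<mu> = 0"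
      using D_hook_pow_zero_mono[OF t assms _ core_of_core] by auto
  qed auto
  also have "\<dots> = (\<Sum>k \<le> n. of_nat (n choose k) * (D_hook t ^^ k) f \<mu>)"
    by (rule sum.mono_neutral_right) auto
  finally show "poly (\<Sum>k < r. ?b k) (of_nat n) = level_sum n f"
    unfolding level_sum_binomial .
qed

end

theorem theorem3p5:
  fixes t v :: nat
    and \<nu> \<mu> :: int_partition
    and g :: "nat \<Rightarrow> int_partition \<Rightarrow> 'a :: field_char_0"
  assumes "t > 0"
    and "is_core t \<mu>"
    and "\<forall>u \<in> {1..v}. admissible t \<mu> (g u)"
  shows "(\<exists>r :: nat. \<forall>\<kappa>. core_of t \<kappa> = \<mu> \<longrightarrow>
           (D_hook t ^^ r) (\<lambda>\<kappa>. G_hook t \<kappa> * (\<Prod>u = 1..v. g u \<kappa>) *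
             (\<Prod>i < t. of_int (q_part (t_quotient t i \<nu>) (t_quotient t i \<kappa>)))) \<kappa> = 0) \<and>
         (\<exists>P :: 'a poly. \<forall>n :: nat. poly P (of_nat n) =
           (\<Sum>\<kappa> \<in> {\<kappa>. core_of t \<kappa> = \<mu> \<and> int (psize \<kappa>) - int (psize \<mu>) = int (n * t)}.
             of_nat (F_hook t \<kappa> \<mu>) * G_hook t \<kappa> * (\<Prod>u = 1..v. g u \<kappa>)))"
proof
  interpret core_partition t \<mu>
    by unfold_locales (use assms is_core_imp_not_adds_hook in auto)
  have nil: "D_nilpotent t \<mu> (\<lambda>\<kappa>. (\<Prod>u = 1..v. g u \<kappa>) * f \<kappa>)" if "q_poly t d f" for d f
    using assms(3) by (intro D_nilpotent_prod_admissible[OF assms(1) _ _ that]) auto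
  obtain d where "q_poly t d (\<lambda>\<kappa>. \<Prod>i < t. of_int (q_part (t_quotient t i \<nu>) (t_quotient t i \<kappa>)) :: 'a)"
    using q_poly_prod_q_part[of t "\<lambda>i. t_quotient t i \<nu>"] by blast
  from nil[OF this] show "\<exists>r :: nat. \<forall>\<kappa>. core_of t \<kappa> = \<mu> \<longrightarrow>
      (D_hook t ^^ r) (\<lambda>\<kappa>. G_hook t \<kappa> * (\<Prod>u = 1..v. g u \<kappa>) *
        (\<Prod>i < t. of_int (q_part (t_quotient t i \<nu>) (t_quotient t i \<kappa>)))) \<kappa> = 0"
    unfolding D_nilpotent_def by (simp add: mult.assoc)
  \<comment> \<open>For the second claim the constant 1 takes the place of the product of
    q's.\<close>
  obtain r where "\<And>\<kappa>. core_of t \<kappa> = \<mu> \<Longrightarrow> (D_hook t ^^ r) (\<lambda>\<kappa>. G_hook t \<kappa> * (\<Prod>u = 1..v. g u \<kappa>)) \<kappa> = 0"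
    using nil[OF q_poly_const[of t 0 1]] unfolding D_nilpotent_def by auto
  from level_sum_poly[OF this] show "\<exists>P :: 'a poly. \<forall>n :: nat. poly P (of_nat n) =
      (\<Sum>\<kappa> \<in> {\<kappa>. core_of t \<kappa> = \<mu> \<and> int (psize \<kappa>) - int (psize \<mu>) = int (n * t)}.
        of_nat (F_hook t \<kappa> \<mu>) * G_hook t \<kappa> * (\<Prod>u = 1..v. g u \<kappa>))"
    by (simp add: level_sum_def level_def mult.assoc)
qed

end
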